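(* Let $(\alpha,\beta)\in\mathbb{K}^2\setminus\{(0,0)\}$ and let $\mathcal{A}_{\alpha,\beta}=\mathbb{K}[X_1,\ldots,X_6]/\langle\Omega_1-\alpha,\Omega_2-\beta\rangle$ be the Poisson algebra described in the context. Then: 1. If $\alpha,\beta\neq 0$, every Poisson derivation $\mathcal{D}$ of $\mathcal{A}_{\alpha,\beta}$ can uniquely be written as $\mathcal{D}=\mathrm{ham}_x$ with $x\in\mathcal{A}_{\alpha,\beta}$. 2. If $\alpha\neq 0$ and $\beta=0$, every Poisson derivation $\mathcal{D}$ of $\mathcal{A}_{\alpha,0}$ can uniquely be written as $\mathcal{D}=\mathrm{ham}_x+\lambda\vartheta$ with $\lambda\in\mathbb{K}$ and $x\in\mathcal{A}_{\alpha,0}$. 3. If $\alpha=0$ and $\beta\neq 0$, every Poisson derivation $\mathcal{D}$ of $\mathcal{A}_{0,\beta}$ can uniquely be written as $\mathcal{D}=\mathrm{ham}_x+\lambda\tilde{\vartheta}$ with $\lambda\in\mathbb{K}$ and $x\in\mathcal{A}_{0,\beta}$. 4. For $\alpha\ne 0$, $HP^1(\mathcal{A}_{\alpha,0})=\mathbb{K}[\vartheta]$, and for $\beta\neq 0$, $HP^1(\mathcal{A}_{0,\beta})=\mathbb{K}[\tilde{\vartheta}]$, where $[\vartheta]$ and $[\tilde\vartheta]$ denote the classes of $\vartheta$ and $\tilde\vartheta$ modulo the space of inner Poisson derivations. 5. If $\alpha,\beta\neq 0$, then $HP^1(\mathcal{A}_{\alpha,\beta})=\{[0]\}$. Here uniqueness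 means that the inner derivation $\mathrm{ham}_x$ and the scalar $\lambda$ are uniquely determined by $\mathcal{D}$.
   Context: $\mathbb{K}$ is a field of characteristic zero. $\mathcal{A}=\mathbb{K}[X_1,\ldots,X_6]$ is the polynomial algebra with the Poisson bracket $\{X_2,X_1\}=-3X_1X_2$, $\{X_3,X_1\}=-X_1X_3-X_2$, $\{X_3,X_2\}=-3X_2X_3$, $\{X_4,X_1\}=-2X_3^2$, $\{X_4,X_2\}=-3X_2X_4-4X_3^3$, $\{X_4,X_3\}=-3X_3X_4$, $\{X_5,X_1\}=X_1X_5-2X_3$, $\{X_5,X_2\}=-6X_3^2$, $\{X_5,X_3\}=-X_3X_5-3X_4$, $\{X_5,X_4\}=-3X_4X_5$, $\{X_6,X_1\}=3X_1X_6-3X_5$, $\{X_6,X_2\}=3X_2X_6+9X_4-18X_3X_5$, $\{X_6,X_3\}=-6X_5^2$, $\{X_6,X_4\}=-3X_4X_6-4X_5^3$, $\{X_6,X_5\}=-3X_5X_6$. The elements $\Omega_1=X_1X_3X_5-\frac32X_1X_4-\frac12X_2X_5+\frac12X_3^2$ and $\Omega_2=X_2X_4X_6-\frac23X_3^3X_6-\frac23X_2X_5^3+2X_3^2X_5^2-3X_3X_4X_5+\frac32X_4^2$ are Poisson central in $\mathcal{A}$, so $\mathcal{A}_{\alpha,\beta}:=\mathcal{A}/\langle\Omega_1-\alpha,\Omega_2-\beta\rangle$ carries the induced Poisson bracket; $x_i$ denotes the image of $X_i$. A Poisson derivation of a Poisson $\mathbb{K}$-algebra $B$ is a $\mathbb{K}$-linear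 map $\mathcal{D}:B\to B$ with $\mathcal{D}(ab)=\mathcal{D}(a)b+a\mathcal{D}(b)$ and $\mathcal{D}(\{a,b\})=\{\mathcal{D}(a),b\}+\{a,\mathcal{D}(b)\}$. For $x\in B$, $\mathrm{ham}_x:=\{x,-\}$; these are the inner Poisson derivations. $HP^1(B)$ (first Poisson cohomology group) is the space of Poisson derivations of $B$ modulo the inner ones. For $\alpha\neq0$, $\vartheta$ is the Poisson derivation of $\mathcal{A}_{\alpha,0}$ with $\vartheta(x_1)=-x_1$, $\vartheta(x_2)=-x_2$, $\vartheta(x_3)=0$, $\vartheta(x_4)=x_4$, $\vartheta(x_5)=x_5$, $\vartheta(x_6)=2x_6$. For $\beta\ne0$, $\tilde\vartheta$ is the Poisson derivation of $\mathcal{A}_{0,\beta}$ with $\tilde\vartheta(x_1)=-2x_1$, $\tilde\vartheta(x_2)=-3x_2$, $\tilde\vartheta(x_3)=-x_3$, $\tilde\vartheta(x_4)=0$, $\tilde\vartheta(x_5)=x_5$, $\tilde\vartheta(x_6)=3x_6$. *)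

theory Defs
  imports "HOL-Algebra.QuotRing" "HOL-Algebra.Module" "HOL-Library.Poly_Mapping"
begin

section \<open>Poisson algebras, Poisson derivations and the first Poisson cohomology group\<close>

text \<open>All elements of the type \<open>'k\<close> are scalars; algebras and modules are records with a carrier.\<close>

record ('k, 'a) poisson_algebra = "('k, 'a) module" +
  pbracket :: "'a \<Rightarrow> 'a \<Rightarrow> 'a"

definition quotient_smult ::
  "('k, 'a, 'm) module_scheme \<Rightarrow> 'a set \<Rightarrow> 'k \<Rightarrow> 'a set \<Rightarrow> 'a set" where
  "quotient_smult M N k C = (\<Union>c\<in>C. N +>\<^bsub>M\<^esub> (k \<odot>\<^bsub>M\<^esub> c))"

text \<open>The bracket of two cosets is formed as the product of cosets in \<open>rcoset_mult\<close>; it is again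
  a coset when \<open>I\<close> is a Poisson ideal, e.g. an ideal generated by Poisson central elements.\<close>

definition poisson_quotient ::
  "('k, 'a, 'm) poisson_algebra_scheme \<Rightarrow> 'a set \<Rightarrow> ('k, 'a set) poisson_algebra" where
  "poisson_quotient B I =
    \<lparr>carrier = carrier (B Quot I), mult = mult (B Quot I), one = one (B Quot I),
     zero = zero (B Quot I), add = add (B Quot I),
     smult = quotient_smult B I,
     pbracket = (\<lambda>C D. \<Union>a\<in>C. \<Union>b\<in>D. I +>\<^bsub>B\<^esub> pbracket B a b)\<rparr>"

text \<open>Maps on the carrier are extensional (\<open>undefined\<close> outside it), so that equality of
  derivations is equality on the carrier.\<close>

definition poisson_derivation ::
  "('k, 'a, 'm) poisson_algebra_scheme \<Rightarrow> ('a \<Rightarrow> 'a) \<Rightarrow> bool" where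
  "poisson_derivation B D \<longleftrightarrow>
     D \<in> carrier B \<rightarrow>\<^sub>E carrier B \<and>
     (\<forall>a\<in>carrier B. \<forall>b\<in>carrier B. D (a \<oplus>\<^bsub>B\<^esub> b) = D a \<oplus>\<^bsub>B\<^esub> D b) \<and>
     (\<forall>k. \<forall>a\<in>carrier B. D (k \<odot>\<^bsub>B\<^esub> a) = k \<odot>\<^bsub>B\<^esub> D a) \<and>
     (\<forall>a\<in>carrier B. \<forall>b\<in>carrier B.
        D (a \<otimes>\<^bsub>B\<^esub> b) = D a \<otimes>\<^bsub>B\<^esub> b \<oplus>\<^bsub>B\<^esub> a \<otimes>\<^bsub>B\<^esub> D b) \<and>
     (\<forall>a\<in>carrier B. \<forall>b\<in>carrier B.
        D (pbracket B a b) = pbracket B (D a) b \<oplus>\<^bsub>B\<^esub> pbracket B a (D b))"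

definition ham :: "('k, 'a, 'm) poisson_algebra_scheme \<Rightarrow> 'a \<Rightarrow> 'a \<Rightarrow> 'a" where
  "ham B x = (\<lambda>y\<in>carrier B. pbracket B x y)"

text \<open>The record \<open>module\<close> extends \<open>ring\<close>; the multiplicative fields are irrelevant for a module.\<close>

definition poisson_Der ::
  "('k, 'a, 'm) poisson_algebra_scheme \<Rightarrow> ('k, 'a \<Rightarrow> 'a) module" where
  "poisson_Der B =
    \<lparr>carrier = {D. poisson_derivation B D}, mult = undefined, one = undefined,
     zero = (\<lambda>a\<in>carrier B. \<zero>\<^bsub>B\<^esub>),
     add = (\<lambda>D E. \<lambda>a\<in>carrier B. D a \<oplus>\<^bsub>B\<^esub> E a),
     smult = (\<lambda>k D. \<lambda>a\<in>carrier B. k \<odot>\<^bsub>B\<^esub> D a)\<rparr>"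

definition inner_Der :: "('k, 'a, 'm) poisson_algebra_scheme \<Rightarrow> ('a \<Rightarrow> 'a) set" where
  "inner_Der B = ham B ` carrier B"

definition quotient_module ::
  "('k, 'a, 'm) module_scheme \<Rightarrow> 'a set \<Rightarrow> ('k, 'a set) module" where
  "quotient_module M N =
    \<lparr>carrier = a_rcosets\<^bsub>M\<^esub> N, mult = undefined, one = undefined,
     zero = N, add = set_add M, smult = quotient_smult M N\<rparr>"

definition HP1 ::
  "('k, 'a, 'm) poisson_algebra_scheme \<Rightarrow> ('k, ('a \<Rightarrow> 'a) set) module" where
  "HP1 B = quotient_module (poisson_Der B) (inner_Der B)"

definition HP1_class ::
  "('k, 'a, 'm) poisson_algebra_scheme \<Rightarrow> ('a \<Rightarrow> 'a) \<Rightarrow> ('a \<Rightarrow> 'a) set" where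
  "HP1_class B D = inner_Der B +>\<^bsub>poisson_Der B\<^esub> D"


section \<open>The Poisson algebra of polynomials in six variables\<close>

datatype var = V1 | V2 | V3 | V4 | V5 | V6

lemma UNIV_var: "(UNIV :: var set) = {V1, V2, V3, V4, V5, V6}"
  using var.exhaust by auto

instance var :: finite
  by standard (simp add: UNIV_var)

text \<open>A monomial is its exponent vector; a polynomial maps monomials to coefficients.\<close>

type_synonym 'k poly6 = "(var \<Rightarrow>\<^sub>0 nat) \<Rightarrow>\<^sub>0 'k"

definition Var :: "var \<Rightarrow> 'k::comm_ring_1 poly6" where
  "Var i = Poly_Mapping.single (Poly_Mapping.single i 1) 1"

definition Const :: "'k::comm_ring_1 \<Rightarrow> 'k poly6" where
  "Const c = Poly_Mapping.single 0 c"

abbreviation "X1 \<equiv> Var V1"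
abbreviation "X2 \<equiv> Var V2"
abbreviation "X3 \<equiv> Var V3"
abbreviation "X4 \<equiv> Var V4"
abbreviation "X5 \<equiv> Var V5"
abbreviation "X6 \<equiv> Var V6"

definition pdiff :: "var \<Rightarrow> 'k::comm_ring_1 poly6 \<Rightarrow> 'k poly6" where
  "pdiff i p = (\<Sum>m\<in>Poly_Mapping.keys p.
     Poly_Mapping.single (m - Poly_Mapping.single i 1)
       (of_nat (Poly_Mapping.lookup m i) * Poly_Mapping.lookup p m))"

text \<open>\<open>gen_bracket Vj Vi\<close> is the bracket of \<open>Xj\<close> and \<open>Xi\<close> for \<open>j > i\<close>. The remaining entries are
  placeholders: antisymmetry is built into \<open>poly_bracket\<close>.\<close>

fun gen_bracket :: "var \<Rightarrow> var \<Rightarrow> 'k::comm_ring_1 poly6" where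
  "gen_bracket V2 V1 = - 3 * X1 * X2"
| "gen_bracket V3 V1 = - X1 * X3 - X2"
| "gen_bracket V3 V2 = - 3 * X2 * X3"
| "gen_bracket V4 V1 = - 2 * X3 ^ 2"
| "gen_bracket V4 V2 = - 3 * X2 * X4 - 4 * X3 ^ 3"
| "gen_bracket V4 V3 = - 3 * X3 * X4"
| "gen_bracket V5 V1 = X1 * X5 - 2 * X3"
| "gen_bracket V5 V2 = - 6 * X3 ^ 2"
| "gen_bracket V5 V3 = - X3 * X5 - 3 * X4"
| "gen_bracket V5 V4 = - 3 * X4 * X5"
| "gen_bracket V6 V1 = 3 * X1 * X6 - 3 * X5"
| "gen_bracket V6 V2 = 3 * X2 * X6 + 9 * X4 - 18 * X3 * X5"
| "gen_bracket V6 V3 = - 6 * X5 ^ 2"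
| "gen_bracket V6 V4 = - 3 * X4 * X6 - 4 * X5 ^ 3"
| "gen_bracket V6 V5 = - 3 * X5 * X6"
| "gen_bracket _ _ = 0"

text \<open>The biderivation determined by its values on the variables; see \<open>poly_bracket_Var\<close>,
  \<open>poly_bracket_antisym\<close> and \<open>poly_bracket_mult\<close> below.\<close>

definition poly_bracket :: "'k::comm_ring_1 poly6 \<Rightarrow> 'k poly6 \<Rightarrow> 'k poly6" where
  "poly_bracket f g = (\<Sum>j\<in>UNIV. \<Sum>i\<in>UNIV.
     gen_bracket j i * (pdiff j f * pdiff i g - pdiff i f * pdiff j g))"

definition poly_alg :: "('k::comm_ring_1, 'k poly6) poisson_algebra" where
  "poly_alg = \<lparr>carrier = UNIV, mult = (*), one = 1, zero = 0, add = (+),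
     smult = (\<lambda>k p. Const k * p), pbracket = poly_bracket\<rparr>"

definition Omega1 :: "'k::field_char_0 poly6" where
  "Omega1 = X1 * X3 * X5 - Const (3/2) * X1 * X4 - Const (1/2) * X2 * X5 + Const (1/2) * X3 ^ 2"

definition Omega2 :: "'k::field_char_0 poly6" where
  "Omega2 = X2 * X4 * X6 - Const (2/3) * X3 ^ 3 * X6 - Const (2/3) * X2 * X5 ^ 3
     + 2 * X3 ^ 2 * X5 ^ 2 - 3 * X3 * X4 * X5 + Const (3/2) * X4 ^ 2"

definition A_ideal :: "'k::field_char_0 \<Rightarrow> 'k \<Rightarrow> 'k poly6 set" where
  "A_ideal \<alpha> \<beta> = genideal poly_alg {Omega1 - Const \<alpha>, Omega2 - Const \<beta>}"

definition A_alg :: "'k::field_char_0 \<Rightarrow> 'k \<Rightarrow> ('k, 'k poly6 set) poisson_algebra" where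
  "A_alg \<alpha> \<beta> = poisson_quotient poly_alg (A_ideal \<alpha> \<beta>)"

definition gen :: "'k::field_char_0 \<Rightarrow> 'k \<Rightarrow> var \<Rightarrow> 'k poly6 set" where
  "gen \<alpha> \<beta> i = A_ideal \<alpha> \<beta> +>\<^bsub>poly_alg\<^esub> Var i"

text \<open>Existence: weight derivations of the polynomial algebra. The bracket is homogeneous for both
  weights. For the first, \<open>Omega1\<close> and \<open>Omega2\<close> have weights \<open>0\<close> and \<open>2\<close>; for the second, \<open>-2\<close>
  and \<open>0\<close>. Uniqueness: the \<open>gen \<alpha> \<beta> i\<close> generate the algebra.\<close>

definition vartheta :: "'k::field_char_0 \<Rightarrow> 'k poly6 set \<Rightarrow> 'k poly6 set" where
  "vartheta \<alpha> = (THE D. poisson_derivation (A_alg \<alpha> 0) D \<and>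
     D (gen \<alpha> 0 V1) = (- 1) \<odot>\<^bsub>A_alg \<alpha> 0\<^esub> gen \<alpha> 0 V1 \<and>
     D (gen \<alpha> 0 V2) = (- 1) \<odot>\<^bsub>A_alg \<alpha> 0\<^esub> gen \<alpha> 0 V2 \<and>
     D (gen \<alpha> 0 V3) = \<zero>\<^bsub>A_alg \<alpha> 0\<^esub> \<and>
     D (gen \<alpha> 0 V4) = gen \<alpha> 0 V4 \<and>
     D (gen \<alpha> 0 V5) = gen \<alpha> 0 V5 \<and>
     D (gen \<alpha> 0 V6) = 2 \<odot>\<^bsub>A_alg \<alpha> 0\<^esub> gen \<alpha> 0 V6)"

definition vartheta_tilde :: "'k::field_char_0 \<Rightarrow> 'k poly6 set \<Rightarrow> 'k poly6 set" where
  "vartheta_tilde \<beta> = (THE D. poisson_derivation (A_alg 0 \<beta>) D \<and>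
     D (gen 0 \<beta> V1) = (- 2) \<odot>\<^bsub>A_alg 0 \<beta>\<^esub> gen 0 \<beta> V1 \<and>
     D (gen 0 \<beta> V2) = (- 3) \<odot>\<^bsub>A_alg 0 \<beta>\<^esub> gen 0 \<beta> V2 \<and>
     D (gen 0 \<beta> V3) = (- 1) \<odot>\<^bsub>A_alg 0 \<beta>\<^esub> gen 0 \<beta> V3 \<and>
     D (gen 0 \<beta> V4) = \<zero>\<^bsub>A_alg 0 \<beta>\<^esub> \<and>
     D (gen 0 \<beta> V5) = gen 0 \<beta> V5 \<and>
     D (gen 0 \<beta> V6) = 3 \<odot>\<^bsub>A_alg 0 \<beta>\<^esub> gen 0 \<beta> V6)"


section \<open>The bracket is the biderivation with the prescribed values\<close>

lemma pdiff_superset: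
  assumes "finite S" "Poly_Mapping.keys p \<subseteq> S"
  shows "pdiff i p = (\<Sum>m\<in>S. Poly_Mapping.single (m - Poly_Mapping.single i 1)
       (of_nat (Poly_Mapping.lookup m i) * Poly_Mapping.lookup p m))"
  unfolding pdiff_def using assms
  by (intro sum.mono_neutral_left) (auto simp: in_keys_iff)

lemma pdiff_add: "pdiff i (p + q) = pdiff i p + pdiff i q"
proof -
  let ?S = "Poly_Mapping.keys p \<union> Poly_Mapping.keys q"
  have "Poly_Mapping.keys (p + q) \<subseteq> ?S" by (rule Poly_Mapping.keys_add)
  then show ?thesis
    by (simp add: pdiff_superset[of ?S] lookup_add distrib_left single_add sum.distrib)
qed

lemma pdiff_zero [simp]: "pdiff i 0 = 0"
  by (simp add: pdiff_def)

lemma pdiff_single: "pdiff i (Poly_Mapping.single m c) =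
    Poly_Mapping.single (m - Poly_Mapping.single i 1) (of_nat (Poly_Mapping.lookup m i) * c)"
  by (subst pdiff_superset[of "{m}"]) auto

lemma pdiff_Var: "pdiff i (Var j) = (if i = j then 1 else 0)"
  by (auto simp: Var_def pdiff_single lookup_single)

lemma monom_shift:
  fixes m n :: "var \<Rightarrow>\<^sub>0 nat"
  assumes "Poly_Mapping.lookup m i \<noteq> 0"
  shows "m + n - Poly_Mapping.single i 1 = (m - Poly_Mapping.single i 1) + n"
  using assms
  by (intro poly_mapping_eqI) (auto simp: lookup_add lookup_minus lookup_single when_def)

lemma pdiff_mult_single:
  "pdiff i (Poly_Mapping.single m a * Poly_Mapping.single n b) =
   pdiff i (Poly_Mapping.single m a) * Poly_Mapping.single n b
   + Poly_Mapping.single m a * pdiff i (Poly_Mapping.single n b)"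
proof -
  let ?e = "Poly_Mapping.single i (1::nat)"
  let ?k = "Poly_Mapping.lookup m i" and ?l = "Poly_Mapping.lookup n i"
  have 1: "Poly_Mapping.single (m + n - ?e) (of_nat ?k * (a * b)) =
      Poly_Mapping.single (m - ?e + n) (of_nat ?k * (a * b))"
    using monom_shift[of m i n] by (cases "?k = 0") auto
  have 2: "Poly_Mapping.single (m + n - ?e) (of_nat ?l * (a * b)) =
      Poly_Mapping.single (m + (n - ?e)) (of_nat ?l * (a * b))"
    using monom_shift[of n i m] by (cases "?l = 0") (auto simp: add.commute)
  have "pdiff i (Poly_Mapping.single m a * Poly_Mapping.single n b) =
      Poly_Mapping.single (m + n - ?e) (of_nat ?k * (a * b))
      + Poly_Mapping.single (m + n - ?e) (of_nat ?l * (a * b))"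
    by (simp add: mult_single pdiff_single lookup_add distrib_right flip: single_add)
  then show ?thesis
    unfolding 1 2 by (simp add: mult_single pdiff_single ac_simps)
qed

lemma poly6_induct [case_names zero add]:
  assumes "P 0" "\<And>p m c. P p \<Longrightarrow> P (p + Poly_Mapping.single m c)"
  shows "P (p :: 'k::comm_ring_1 poly6)"
proof (induction p rule: Poly_Mapping.update_induct)
  case (update p m c)
  have "Poly_Mapping.update m c p = p + Poly_Mapping.single m c"
    using update(1)
    by (intro poly_mapping_eqI) (auto simp: lookup_update lookup_add lookup_single in_keys_iff)
  then show ?case using assms(2) update by simp
qed (rule assms)

lemma pdiff_mult: "pdiff i (p * q) = pdiff i p * q + p * pdiff i q"
proof (induction p rule: poly6_induct)
  case (add p m a)
  have "pdiff i (Poly_Mapping.single m a * q) =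
      pdiff i (Poly_Mapping.single m a) * q + Poly_Mapping.single m a * pdiff i q"
    by (induction q rule: poly6_induct)
      (simp_all add: pdiff_mult_single pdiff_add algebra_simps)
  with add show ?case by (simp add: pdiff_add algebra_simps)
qed simp

lemma poly_bracket_antisym: "poly_bracket g f = - poly_bracket f g"
  unfolding poly_bracket_def sum_negf[symmetric]
  by (intro sum.cong refl) (simp add: algebra_simps)

lemma poly_bracket_mult: "poly_bracket f (g * h) = poly_bracket f g * h + g * poly_bracket f h"
  unfolding poly_bracket_def sum_distrib_left sum_distrib_right sum.distrib[symmetric]
  by (intro sum.cong refl) (simp add: pdiff_mult algebra_simps)

lemma poly_bracket_Var: "poly_bracket (Var j) (Var i) = gen_bracket j i - gen_bracket i j"
  by (cases i; cases j) (simp_all add: poly_bracket_def pdiff_Var UNIV_var)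

end

(* Write f = X4 X6 - (2/3) X5^3 and g = X3 X5 - (3/2) X4.  The two relations read f X2 = ... and
   g X1 = ... with right-hand sides free of X2 and of X1, so inverting f and g eliminates X1 and X2.
   Deleting derivations turns the remaining variables into T3, ..., T6 with {Ti, Tj} = q_ij Ti Tj,
   f = T4 T6 and g = T3 T5, and the quotient algebra embeds into the Laurent polynomials in the Ti.
   There a Poisson derivation is, degree by degree, Hamiltonian, up to logarithmic Hamiltonian
   derivations of T3, ..., T6.  Poles of the Hamiltonian x and the logarithmic terms are then removed
   along T6, T5, f and g in turn: if {t, y} is invertible modulo t for some y in the algebra, then
   {x, y} has a pole of larger order along t than x.  Along f this works with y = X2 when beta is
   nonzero, since {f, X2} = 6 beta - 6 f X2; along g with y = X1 when alpha is nonzero, since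
   {g, X1} = 2 alpha - 2 g X1.  If beta = 0, then f divides g^3; if alpha = 0, then g is a unit.  In
   these two cases one logarithmic term survives, and it is a multiple of the weight derivation. *)

theory Submission
  imports Defs "HOL-Computational_Algebra.Fraction_Field"
begin

section \<open>Polynomials in six variables\<close>

text \<open>The obstacle is to divide by f and g without knowing that the ideal is prime. Evaluation
  in the Laurent polynomials kills the ideal; that it kills nothing else means that powers of f and
  g can be cancelled modulo the ideal. For f this is easy: f is prime and is cancelled against the
  single polynomial Omega2 - beta. For g both relations matter. On g = 0 they become X2 X5 - X3^2 +
  2 alpha = 0 and (2/3)(X2 X5 - X3^2)(X3 X6 - X5^2) = beta, and these have no common factor exactly
  because alpha and beta are not both zero. The matrix of the q_ij is invertible, so the logarithmic
  derivations of the torus are all Hamiltonian. Their basis is taken from f, g, T5, T6, one for each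
  divisor along which poles can occur. That 1/t is not already regular, which kills a logarithmic
  term, is tested at explicit points over the ground field. The surviving derivations are
  logarithmic Hamiltonians too: on the torus \<open>Theta2\<close> is {g, -}/g, and
  \<open>Theta1\<close> is one third of the same expression for g^3/f.\<close>

fun var_rank :: "var \<Rightarrow> nat" where
  "var_rank V1 = 1" | "var_rank V2 = 2" | "var_rank V3 = 3"
| "var_rank V4 = 4" | "var_rank V5 = 5" | "var_rank V6 = 6"

lemma var_rank_inj: "var_rank i = var_rank j \<longleftrightarrow> i = j"
  by (cases i; cases j) simp_all

text \<open>An order on the indices orders the exponent vectors, which makes the polynomial ring
  over a domain a domain; fractions of polynomials are formed below.\<close>

instantiation var :: linorder
begin

definition less_eq_var :: "var \<Rightarrow> var \<Rightarrow> bool" where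
  "i \<le> j \<longleftrightarrow> var_rank i \<le> var_rank j"

definition less_var :: "var \<Rightarrow> var \<Rightarrow> bool" where
  "i < j \<longleftrightarrow> var_rank i < var_rank j"

instance
  by standard (auto simp: less_eq_var_def less_var_def simp flip: var_rank_inj)

end

lemma Const_add: "Const (a + b) = Const a + Const b"
  by (simp add: Const_def single_add)

lemma Const_mult: "Const (a * b) = Const a * Const b"
  by (simp add: Const_def mult_single)

lemma Const_0 [simp]: "Const 0 = 0"
  by (simp add: Const_def)

lemma Const_1 [simp]: "Const 1 = 1"
  by (simp add: Const_def)

lemma Const_numeral [simp]: "Const (numeral n) = numeral n"
  by (simp add: Const_def)

lemma Const_minus: "Const (- a) = - Const a"
  by (simp add: Const_def single_uminus)

lemma Const_eq_0_iff [simp]: "Const c = 0 \<longleftrightarrow> c = 0"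
  by (metis Const_0 Const_def lookup_single_eq lookup_zero)

lemma pm_induct [case_names zero add]:
  assumes "P 0" "\<And>p m c. P p \<Longrightarrow> P (p + Poly_Mapping.single m c)"
  shows "P (p :: 'm \<Rightarrow>\<^sub>0 'k::comm_monoid_add)"
proof (induction p rule: Poly_Mapping.update_induct)
  case (update p m c)
  have "Poly_Mapping.update m c p = p + Poly_Mapping.single m c"
    using update(1)
    by (intro poly_mapping_eqI) (auto simp: lookup_update lookup_add lookup_single in_keys_iff)
  then show ?case using assms(2) update by simp
qed (rule assms)

lemma single_as_prod:
  fixes c :: "'k::comm_ring_1"
  shows "Poly_Mapping.single m c = Const c * (\<Prod>i\<in>UNIV. Var i ^ Poly_Mapping.lookup m i)"
proof -
  have pow: "Var i ^ n = Poly_Mapping.single (Poly_Mapping.single i n) (1::'k)" for i n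
    by (induction n) (simp_all add: Var_def mult_single flip: single_add)
  have "(\<Prod>i\<in>S. Var i ^ Poly_Mapping.lookup m i) =
      Poly_Mapping.single (\<Sum>i\<in>S. Poly_Mapping.single i (Poly_Mapping.lookup m i)) (1::'k)"
    if "finite S" for S
    using that by (induction S) (simp_all add: pow mult_single)
  moreover have "(\<Sum>i\<in>UNIV. Poly_Mapping.single i (Poly_Mapping.lookup m i)) = m"
    by (intro poly_mapping_eqI) (simp add: lookup_sum lookup_single when_def)
  ultimately show ?thesis by (simp add: Const_def mult_single)
qed

lemma poly6_gen_induct [case_names Const Var add mult]:
  fixes p :: "'k::comm_ring_1 poly6"
  assumes "\<And>c. P (Const c)" "\<And>i. P (Var i)"
    "\<And>p q. P p \<Longrightarrow> P q \<Longrightarrow> P (p + q)" "\<And>p q. P p \<Longrightarrow> P q \<Longrightarrow> P (p * q)"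
  shows "P p"
proof -
  have 1: "P 1" and 0: "P 0" using assms(1)[of 1] assms(1)[of 0] by auto
  have pow: "P (q ^ n)" if "P q" for q n
    using that 1 by (induction n) (auto intro: assms)
  have "P (\<Prod>i\<in>S. Var i ^ Poly_Mapping.lookup m i)" if "finite S" for S m
    using that 1 by (induction S) (auto intro!: assms pow)
  then have "P (Poly_Mapping.single m c)" for m c
    unfolding single_as_prod by (intro assms) simp
  then show ?thesis
    by (induction p rule: pm_induct) (auto intro: assms 0)
qed

section \<open>Ring maps, evaluation, and derivations along a ring map\<close>

definition ring_map :: "('a::comm_ring_1 \<Rightarrow> 'b::comm_ring_1) \<Rightarrow> bool" where
  "ring_map h \<longleftrightarrow> h 1 = 1 \<and> (\<forall>a b. h (a + b) = h a + h b) \<and> (\<forall>a b. h (a * b) = h a * h b)"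

lemma ring_mapI:
  "h 1 = 1 \<Longrightarrow> (\<And>a b. h (a + b) = h a + h b) \<Longrightarrow> (\<And>a b. h (a * b) = h a * h b) \<Longrightarrow> ring_map h"
  by (simp add: ring_map_def)

lemma
  assumes "ring_map h"
  shows ring_map_1: "h 1 = 1"
    and ring_map_add: "h (a + b) = h a + h b"
    and ring_map_mult: "h (a * b) = h a * h b"
    and ring_map_0: "h 0 = 0"
    and ring_map_minus: "h (- a) = - h a"
    and ring_map_diff: "h (a - b) = h a - h b"
    and ring_map_power: "h (a ^ n) = h a ^ n"
    and ring_map_of_nat: "h (of_nat n) = of_nat n"
    and ring_map_numeral: "h (numeral w) = numeral w"
proof -
  show 1: "h 1 = 1" and a: "h (a + b) = h a + h b" and m: "h (a * b) = h a * h b" for a b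
    using assms by (auto simp: ring_map_def)
  show 0: "h 0 = 0" using a[of 0 0] by simp
  show mi: "h (- a) = - h a" for a using a[of a "- a"] 0 by (simp add: eq_neg_iff_add_eq_0 add.commute)
  show "h (a - b) = h a - h b" for a b using a[of a "- b"] mi by simp
  show "h (a ^ n) = h a ^ n" by (induction n) (simp_all add: 1 m)
  show n: "h (of_nat n) = of_nat n" for n by (induction n) (simp_all add: 0 1 a)
  show "h (numeral w) = numeral w" using n[of "numeral w"] by simp
qed

lemmas ring_map_simps =
  ring_map_1 ring_map_add ring_map_mult ring_map_0 ring_map_minus ring_map_diff ring_map_power
  ring_map_numeral

lemma ring_map_id: "ring_map (\<lambda>x. x)"
  by (simp add: ring_map_def)

lemma ring_map_comp: "ring_map g \<Longrightarrow> ring_map h \<Longrightarrow> ring_map (\<lambda>x. g (h x))"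
  by (simp add: ring_map_def)

lemma ring_map_Const: "ring_map Const"
  by (simp add: ring_map_def Const_add Const_mult)

definition mon_map :: "('m::comm_monoid_add \<Rightarrow> 'b::comm_ring_1) \<Rightarrow> bool" where
  "mon_map u \<longleftrightarrow> u 0 = 1 \<and> (\<forall>m n. u (m + n) = u m * u n)"

text \<open>The exponents range over an arbitrary type, so that one construction evaluates both
  polynomials and Laurent polynomials.\<close>

definition mev :: "('k::comm_ring_1 \<Rightarrow> 'b::comm_ring_1) \<Rightarrow> ('m \<Rightarrow> 'b) \<Rightarrow> ('m \<Rightarrow>\<^sub>0 'k) \<Rightarrow> 'b" where
  "mev h u p = (\<Sum>m\<in>Poly_Mapping.keys p. h (Poly_Mapping.lookup p m) * u m)"

lemma mev_superset:
  assumes "ring_map h" "finite S" "Poly_Mapping.keys p \<subseteq> S"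
  shows "mev h u p = (\<Sum>m\<in>S. h (Poly_Mapping.lookup p m) * u m)"
  unfolding mev_def using assms
  by (intro sum.mono_neutral_left) (auto simp: in_keys_iff ring_map_0)

lemma mev_single: "ring_map h \<Longrightarrow> mev h u (Poly_Mapping.single m c) = h c * u m"
  by (subst mev_superset[of _ "{m}"]) auto

lemma mev_add:
  assumes "ring_map h"
  shows "mev h u (p + q) = mev h u p + mev h u q"
proof -
  let ?S = "Poly_Mapping.keys p \<union> Poly_Mapping.keys q"
  have "Poly_Mapping.keys (p + q) \<subseteq> ?S" by (rule Poly_Mapping.keys_add)
  then show ?thesis
    by (simp add: mev_superset[OF assms, of ?S] lookup_add ring_map_add[OF assms] distrib_right
        sum.distrib)
qed

lemma ring_map_mev:
  fixes h :: "'k::comm_ring_1 \<Rightarrow> 'b::comm_ring_1" and u :: "'m::comm_monoid_add \<Rightarrow> 'b"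
  assumes h: "ring_map h" and u: "mon_map u"
  shows "ring_map (mev h u)"
proof (rule ring_mapI)
  fix p q :: "'m \<Rightarrow>\<^sub>0 'k"
  have zero: "mev h u 0 = 0" by (simp add: mev_def)
  have "mev h u (Poly_Mapping.single m a * q) = mev h u (Poly_Mapping.single m a) * mev h u q" for m a
    using u by (induction q rule: pm_induct)
      (simp_all add: zero mev_add[OF h] mev_single[OF h] distrib_left mult_single mon_map_def
        ring_map_mult[OF h] ac_simps)
  then show "mev h u (p * q) = mev h u p * mev h u q"
    by (induction p rule: pm_induct) (simp_all add: zero mev_add[OF h] distrib_right)
  show "mev h u (p + q) = mev h u p + mev h u q" by (rule mev_add[OF h])
  have "mev h u (Poly_Mapping.single 0 1) = 1"
    unfolding mev_single[OF h] using u by (simp add: mon_map_def ring_map_1[OF h])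
  then show "mev h u 1 = 1" by simp
qed

definition ev :: "('k::comm_ring_1 \<Rightarrow> 'b::comm_ring_1) \<Rightarrow> (var \<Rightarrow> 'b) \<Rightarrow> 'k poly6 \<Rightarrow> 'b" where
  "ev h r = mev h (\<lambda>m. \<Prod>i\<in>UNIV. r i ^ Poly_Mapping.lookup m i)"

lemma ring_map_ev: "ring_map h \<Longrightarrow> ring_map (ev h r)"
  unfolding ev_def
  by (intro ring_map_mev) (simp_all add: mon_map_def lookup_add power_add prod.distrib)

lemma ev_Const: "ring_map h \<Longrightarrow> ev h r (Const c) = h c"
  by (simp add: Const_def ev_def mev_single)

lemma ev_Var:
  assumes "ring_map h"
  shows "ev h r (Var i) = r i"
proof -
  have "(\<Prod>j\<in>UNIV. r j ^ Poly_Mapping.lookup (Poly_Mapping.single i 1) j) =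
      (\<Prod>j\<in>UNIV. if j = i then r i else 1)"
    by (intro prod.cong) (auto simp: lookup_single when_def)
  then show ?thesis by (simp add: Var_def ev_def mev_single[OF assms] ring_map_1[OF assms])
qed

lemmas ev_simps = ev_Const ev_Var ring_map_simps[OF ring_map_ev]

lemma ring_map_eqI:
  fixes g h :: "'k::comm_ring_1 poly6 \<Rightarrow> 'b::comm_ring_1"
  assumes "ring_map g" "ring_map h" "\<And>c. g (Const c) = h (Const c)" "\<And>i. g (Var i) = h (Var i)"
  shows "g p = h p"
  by (induction p rule: poly6_gen_induct)
    (simp_all add: assms(3,4) ring_map_simps[OF assms(1)] ring_map_simps[OF assms(2)])

text \<open>A derivation of the polynomial ring with values in \<open>'b\<close>, regarded as a
  module through \<open>g\<close>. This covers a derivation of the torus preceded by the embedding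
  as well as a derivation of polynomials followed by it, so that the two kinds can be compared on
  generators.\<close>

definition der_along :: "('k::comm_ring_1 poly6 \<Rightarrow> 'b::comm_ring_1) \<Rightarrow> ('k poly6 \<Rightarrow> 'b) \<Rightarrow> bool" where
  "der_along g d \<longleftrightarrow> (\<forall>c. d (Const c) = 0) \<and> (\<forall>p q. d (p + q) = d p + d q) \<and>
     (\<forall>p q. d (p * q) = d p * g q + g p * d q)"

lemma der_alongI:
  "(\<And>c. d (Const c) = 0) \<Longrightarrow> (\<And>p q. d (p + q) = d p + d q) \<Longrightarrow>
    (\<And>p q. d (p * q) = d p * g q + g p * d q) \<Longrightarrow> der_along g d"
  by (simp add: der_along_def)

lemma
  assumes "der_along g d"
  shows der_along_Const: "d (Const c) = 0"
    and der_along_add: "d (p + q) = d p + d q"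
    and der_along_mult: "d (p * q) = d p * g q + g p * d q"
    and der_along_0: "d 0 = 0"
    and der_along_1: "d 1 = 0"
    and der_along_numeral: "d (numeral w) = 0"
    and der_along_minus: "d (- p) = - d p"
    and der_along_diff: "d (p - q) = d p - d q"
    and der_along_pow2: "d (p ^ 2) = 2 * g p * d p"
    and der_along_pow3: "d (p ^ 3) = d (p ^ 2 * p)"
proof -
  show c: "d (Const c) = 0" and a: "d (p + q) = d p + d q" 
    and m: "d (p * q) = d p * g q + g p * d q" for c p q
    using assms by (auto simp: der_along_def)
  show z: "d 0 = 0" using c[of 0] by simp
  show "d 1 = 0" using c[of 1] by simp
  show "d (numeral w) = 0" using c[of "numeral w"] by simp
  show mi: "d (- p) = - d p" for p using a[of p "- p"] z by (simp add: eq_neg_iff_add_eq_0 add.commute)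
  show "d (p - q) = d p - d q" using a[of p "- q"] mi by simp
  show "d (p ^ 2) = 2 * g p * d p" by (simp add: power2_eq_square m)
  show "d (p ^ 3) = d (p ^ 2 * p)" by (simp add: eval_nat_numeral mult.commute)
qed

lemmas der_along_simps = der_along_Const der_along_add der_along_mult der_along_0 der_along_1
  der_along_numeral der_along_minus der_along_diff der_along_pow2 der_along_pow3

lemma der_along_eqI:
  assumes "der_along g d" "der_along g e" "\<And>i. d (Var i) = e (Var i)"
  shows "d p = e p"
  by (induction p rule: poly6_gen_induct)
    (simp_all add: assms(3) der_along_simps[OF assms(1)] der_along_simps[OF assms(2)])

lemma pdiff_Const [simp]: "pdiff i (Const c) = 0"
  by (simp add: Const_def pdiff_single)

lemma der_along_bracket: "der_along (\<lambda>p. p) (poly_bracket f)"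
  by (intro der_alongI)
    (simp_all add: poly_bracket_mult, simp_all add: poly_bracket_def pdiff_add distrib_left
      distrib_right right_diff_distrib left_diff_distrib sum.distrib sum_subtractf algebra_simps)

section \<open>The ideal of relations\<close>

definition sub :: "var \<Rightarrow> 'k::comm_ring_1 poly6 \<Rightarrow> 'k poly6 \<Rightarrow> 'k poly6" where
  "sub i q = ev Const (Var(i := q))"

lemma ring_map_sub: "ring_map (sub i q)"
  by (simp add: sub_def ring_map_ev ring_map_Const)

lemma sub_Const: "sub i q (Const c) = Const c"
  by (simp add: sub_def ev_simps ring_map_Const)

lemma sub_Var: "sub i q (Var j) = (if j = i then q else Var j)"
  by (simp add: sub_def ev_simps ring_map_Const)

lemmas sub_simps = sub_Const sub_Var ring_map_simps[OF ring_map_sub]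

lemma sub_dvd_diff: "Var i - q dvd p - sub i q p"
proof (induction p rule: poly6_gen_induct)
  case (add p r)
  have "p + r - sub i q (p + r) = (p - sub i q p) + (r - sub i q r)" by (simp add: sub_simps)
  with add show ?case by (simp only: dvd_add)
next
  case (mult p r)
  have "p * r - sub i q (p * r) = (p - sub i q p) * r + sub i q p * (r - sub i q r)"
    by (simp add: sub_simps algebra_simps)
  with mult show ?case by (simp add: dvd_add dvd_mult dvd_mult2)
qed (auto simp: sub_simps)

definition kill :: "var set \<Rightarrow> 'k::comm_ring_1 poly6 \<Rightarrow> 'k poly6" where
  "kill S = ev Const (\<lambda>j. if j \<in> S then 0 else Var j)"

lemma ring_map_kill: "ring_map (kill S)"
  by (simp add: kill_def ring_map_ev ring_map_Const)

lemma kill_Const: "kill S (Const c) = Const c"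
  by (simp add: kill_def ev_simps ring_map_Const)

lemma kill_Var: "kill S (Var j) = (if j \<in> S then 0 else Var j)"
  by (simp add: kill_def ev_simps ring_map_Const)

lemmas kill_simps = kill_Const kill_Var ring_map_simps[OF ring_map_kill]

text \<open>One factor \<open>c\<close> turns an occurrence of Xi into \<open>d\<close>; hence the
  claim holds on generators and passes to sums and products, the exponents adding up.
  \<open>S\<close> may contain further variables that were eliminated before, so that the remainder
  of one division can be divided again by the next relation.\<close>

lemma pseudo_division:
  assumes "i \<in> S" "kill S c = c" "kill S d = d"
  shows "\<exists>n w r. c ^ n * kill (S - {i}) p = (c * Var i - d) * w + r \<and> kill S r = r"
proof (induction p rule: poly6_gen_induct)
  case (Const a)
  show ?case by (rule exI[of _ 0], rule exI[of _ 0]) (simp add: kill_simps)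
next
  case (Var j)
  show ?case
  proof (cases "j = i")
    case True
    then show ?thesis using assms
      by (intro exI[of _ "1::nat"] exI[of _ 1] exI[of _ d]) (simp add: kill_simps)
  next
    case False
    then show ?thesis
      by (intro exI[of _ "0::nat"] exI[of _ 0] exI[of _ "kill (S - {i}) (Var j)"])
        (simp add: kill_simps)
  qed
next
  case (add p q)
  then obtain n w r m v s where
    1: "c ^ n * kill (S - {i}) p = (c * Var i - d) * w + r" "kill S r = r"
    "c ^ m * kill (S - {i}) q = (c * Var i - d) * v + s" "kill S s = s" by blast
  have "c ^ (n + m) * kill (S - {i}) (p + q) =
      c ^ m * (c ^ n * kill (S - {i}) p) + c ^ n * (c ^ m * kill (S - {i}) q)"
    by (simp add: kill_simps power_add algebra_simps)
  also have "\<dots> = (c * Var i - d) * (c ^ m * w + c ^ n * v) + (c ^ m * r + c ^ n * s)"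
    unfolding 1 by (simp add: algebra_simps)
  finally have "c ^ (n + m) * kill (S - {i}) (p + q) =
      (c * Var i - d) * (c ^ m * w + c ^ n * v) + (c ^ m * r + c ^ n * s)" .
  moreover have "kill S (c ^ m * r + c ^ n * s) = c ^ m * r + c ^ n * s"
    using 1 assms by (simp add: kill_simps)
  ultimately show ?case by blast
next
  case (mult p q)
  then obtain n w r m v s where
    1: "c ^ n * kill (S - {i}) p = (c * Var i - d) * w + r" "kill S r = r"
    "c ^ m * kill (S - {i}) q = (c * Var i - d) * v + s" "kill S s = s" by blast
  let ?q = "c * Var i - d"
  have "c ^ (n + m) * kill (S - {i}) (p * q) =
      (c ^ n * kill (S - {i}) p) * (c ^ m * kill (S - {i}) q)"
    by (simp add: kill_simps power_add algebra_simps)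
  also have "\<dots> = ?q * (w * (?q * v + s) + r * v) + r * s"
    unfolding 1 by (simp add: algebra_simps)
  finally have "c ^ (n + m) * kill (S - {i}) (p * q) = ?q * (w * (?q * v + s) + r * v) + r * s" .
  moreover have "kill S (r * s) = r * s"
    using 1 by (simp add: kill_simps)
  ultimately show ?case by blast
qed

lemma Var_dvd_iff: "Var j dvd p \<longleftrightarrow> sub j 0 p = 0"
proof
  assume "Var j dvd p"
  then obtain q where "p = Var j * q" by (rule dvdE)
  then show "sub j 0 p = 0" by (simp add: sub_simps)
qed (use sub_dvd_diff[of j 0 p] in simp)

lemma prime_power_dvd_cancel:
  fixes f :: "'a::idom"
  assumes prime: "\<And>v e. f dvd v * e \<Longrightarrow> f dvd v \<or> f dvd e"
    and f: "f \<noteq> 0" "\<not> f dvd q" and dvd: "f ^ n dvd q * w"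
  shows "f ^ n dvd w"
  using dvd
proof (induction n arbitrary: w)
  case (Suc n)
  have "f dvd q * w" using Suc.prems unfolding power_Suc by (rule dvd_mult_left)
  then have "f dvd w" using prime f by blast
  then obtain v where v: "w = f * v" by (auto simp: dvd_def)
  have "f * f ^ n dvd f * (q * v)" using Suc.prems by (simp add: v ac_simps)
  then have "f ^ n dvd v" using Suc.IH[of v] f by simp
  then show ?case by (simp add: v)
qed simp

lemma Var_nonzero: "Var j \<noteq> (0 :: 'k::comm_ring_1 poly6)"
  by (metis Var_def lookup_single_eq lookup_zero zero_neq_one)

lemma Var_prime: "(Var j :: 'k::idom poly6) dvd v * e \<Longrightarrow> Var j dvd v \<or> Var j dvd e"
  by (simp add: Var_dvd_iff sub_simps)

text \<open>Modulo \<open>Xj Xi - d\<close> one can divide by \<open>Xj\<close>, so the quotient embeds into the fraction field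
  by \<open>Xi = d/Xj\<close>.\<close>

lemma linear_prime:
  fixes d :: "'k::idom poly6"
  assumes ij: "i \<noteq> j" and d: "kill {i} d = d" and dj: "sub j 0 d \<noteq> 0"
    and dvd: "Var j * Var i - d dvd v * e"
  shows "Var j * Var i - d dvd v \<or> Var j * Var i - d dvd e"
proof -
  let ?q = "Var j * Var i - d" and ?X = "Var j :: 'k poly6"
  define ch where "ch = ev (\<lambda>c::'k. Fract (Const c) 1)
    (\<lambda>l. if l = i then Fract d ?X else Fract (Var l) (1 :: 'k poly6))"
  have X: "?X \<noteq> 0" by (rule Var_nonzero)
  have h: "ring_map (\<lambda>c::'k. Fract (Const c) 1)" and hF: "ring_map (\<lambda>p::'k poly6. Fract p 1)"
    by (auto intro!: ring_mapI simp: Const_add Const_mult One_fract_def)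
  have ch: "ring_map ch" by (simp add: ch_def ring_map_ev h)
  note ch_simps = ring_map_simps[OF ch]
  have ch_free: "ch r = Fract r 1" if "kill {i} r = r" for r
  proof -
    have "ch (kill {i} p) = Fract (kill {i} p) 1" for p
      by (rule ring_map_eqI[OF ring_map_comp[OF ch ring_map_kill]
            ring_map_comp[OF hF ring_map_kill]])
        (auto simp: kill_simps ch_def ev_simps h Zero_fract_def ring_map_simps[OF ring_map_ev[OF h]])
    then show ?thesis using that by metis
  qed
  have chq: "ch ?q = 0"
  proof -
    have "ch (Var j) = Fract ?X 1" "ch (Var i) = Fract d ?X" "ch d = Fract d 1"
      using ij ch_free[OF d] by (simp_all add: ch_def ev_simps h)
    then show ?thesis using X by (simp add: ch_simps fract_collapse)
  qed
  \<comment> \<open>\<open>ch\<close> is injective on polynomials without Xi, so the remainder of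
    the pseudo-division is 0. The power of Xj is then cancelled: Xj does not divide
    \<open>?q\<close>, because \<open>d\<close> does not vanish at Xj = 0.\<close>
  have kernel: "?q dvd p" if "ch p = 0" for p
  proof -
    obtain n w r where 1: "?X ^ n * kill ({i} - {i}) p = ?q * w + r" "kill {i} r = r"
      using pseudo_division[of i "{i}" ?X d p] d ij by (auto simp: kill_simps)
    have k0: "kill {} p = p"
      by (rule ring_map_eqI[OF ring_map_kill ring_map_id]) (simp_all add: kill_simps)
    have "ch r = 0" using arg_cong[OF 1(1), of ch] chq that k0 by (simp add: ch_simps)
    then have "r = 0" using ch_free[OF 1(2)] by (simp add: eq_fract Zero_fract_def)
    then have 2: "?X ^ n * p = ?q * w" using 1 k0 by simp
    have "\<not> ?X dvd ?q" using dj ij by (simp add: Var_dvd_iff sub_simps)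
    moreover have "?X ^ n dvd ?q * w" unfolding 2[symmetric] by simp
    ultimately have "?X ^ n dvd w" using prime_power_dvd_cancel[OF Var_prime X] by blast
    then obtain w' where w': "w = ?X ^ n * w'" by (auto simp: dvd_def)
    have "?X ^ n * p = ?X ^ n * (?q * w')" unfolding 2 w' by (simp add: ac_simps)
    then have "p = ?q * w'" using X by simp
    then show ?thesis by simp
  qed
  obtain w where "v * e = ?q * w" using dvd by (rule dvdE)
  then have "ch v * ch e = ch ?q * ch w" by (metis ring_map_mult[OF ch])
  then have "ch v * ch e = 0" using chq by simp
  then show ?thesis using kernel by auto
qed

text \<open>The polynomial identities below are decided with \<open>Const (1/2)\<close> and
  \<open>Const (1/3)\<close> as two further indeterminates. These rules reduce the other fractions
  to them and supply their defining relations.\<close>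

lemma Const_3_2: "Const (3/2 :: 'k::field_char_0) = 3 * Const (1/2)"
  and Const_2_3: "Const (2/3 :: 'k::field_char_0) = 2 * Const (1/3)"
  and Const_1_2: "2 * Const (1/2 :: 'k::field_char_0) = 1"
  and Const_1_3: "3 * Const (1/3 :: 'k::field_char_0) = 1"
  by (simp_all flip: Const_numeral Const_mult Const_1)

section \<open>The relations as linear equations for X2 and X1\<close>

definition rel_f :: "'k::field_char_0 poly6" where
  "rel_f = X4 * X6 - Const (2/3) * X5 ^ 3"

definition rel_g :: "'k::field_char_0 poly6" where
  "rel_g = X3 * X5 - Const (3/2) * X4"

definition rel_h :: "'k::field_char_0 poly6" where
  "rel_h = Const (2/3) * X3 ^ 3 * X6 - 2 * X3 ^ 2 * X5 ^ 2 + 3 * X3 * X4 * X5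
     - Const (3/2) * X4 ^ 2"

lemma Omega1_alt: "Omega1 = rel_g * X1 - (Const (1/2) * X2 * X5 - Const (1/2) * X3 ^ 2)"
  by (simp add: Omega1_def rel_g_def algebra_simps)

lemma Omega2_alt: "Omega2 = rel_f * X2 - rel_h"
  by (simp add: Omega2_def rel_f_def rel_h_def algebra_simps)

definition rels :: "'k::field_char_0 \<Rightarrow> 'k \<Rightarrow> 'k poly6 set" where
  "rels \<alpha> \<beta> = {u * (Omega1 - Const \<alpha>) + v * (Omega2 - Const \<beta>) | u v. True}"

definition pt :: "(var \<Rightarrow> 'k::field_char_0) \<Rightarrow> 'k poly6 \<Rightarrow> 'k" where
  "pt r = ev (\<lambda>c. c) r"

lemma pt_Const: "pt r (Const c) = c"
  by (simp add: pt_def ev_simps ring_map_id)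

lemma pt_Var: "pt r (Var i) = r i"
  by (simp add: pt_def ev_simps ring_map_id)

lemma ring_map_pt: "ring_map (pt r)"
  by (simp add: pt_def ring_map_ev ring_map_id)

lemmas pt_simps = pt_Const pt_Var ring_map_simps[OF ring_map_pt]

lemma not_dvd_by_pt: "pt r p \<noteq> 0 \<Longrightarrow> pt r q = 0 \<Longrightarrow> \<not> q dvd p"
  by (auto simp: dvd_def pt_simps)

lemma rel_f_nonzero: "rel_f \<noteq> (0 :: 'k::field_char_0 poly6)"
proof
  assume "rel_f = (0 :: 'k poly6)"
  then have "pt (\<lambda>i. if i = V5 then 0 else 1) rel_f = (0 :: 'k)" by (simp add: pt_simps)
  then show False by (simp add: rel_f_def pt_simps)
qed

lemma rel_g_nonzero: "rel_g \<noteq> (0 :: 'k::field_char_0 poly6)"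
proof
  assume "rel_g = (0 :: 'k poly6)"
  then have "pt (\<lambda>i. if i = V4 then 0 else 1) rel_g = (0 :: 'k)" by (simp add: pt_simps)
  then show False by (simp add: rel_g_def pt_simps)
qed

lemma rel_f_prime:
  assumes "(rel_f :: 'k::field_char_0 poly6) dvd v * e"
  shows "rel_f dvd v \<or> rel_f dvd e"
proof -
  let ?d = "Const (2/3) * X5 ^ 3 :: 'k poly6"
  have "rel_f = X6 * X4 - ?d" by (simp add: rel_f_def mult.commute)
  moreover have "sub V6 0 ?d \<noteq> 0" by (simp add: sub_simps Var_nonzero)
  ultimately show ?thesis
    using linear_prime[of V4 V6 ?d v e] assms by (simp add: kill_simps)
qed

text \<open>The origin and the point with X4 = 1 and all other coordinates 0 lie on f = 0, and
  Omega2 takes the different values 0 and 3/2 there.\<close>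

lemma rel_f_not_dvd: "\<not> rel_f dvd Omega2 - Const \<beta>"
proof
  assume *: "rel_f dvd Omega2 - Const \<beta>"
  have "pt (\<lambda>_. 0) rel_f = (0::'a)" "pt ((\<lambda>_. 0)(V4 := 1)) rel_f = (0::'a)"
    by (simp_all add: rel_f_def pt_simps)
  then have "pt (\<lambda>_. 0) (Omega2 - Const \<beta>) = 0"
    "pt ((\<lambda>_. 0)(V4 := 1)) (Omega2 - Const \<beta>) = 0"
    using not_dvd_by_pt * by blast+
  then show False by (simp add: Omega2_def pt_simps)
qed

text \<open>Modulo g one may put X4 = (2/3) X3 X5. The relations then become -q/2 and w, and w is
  congruent to -(4/3) alpha (X3 X6 - X5^2) - beta modulo q. As q is prime and does not divide w,
  every relation between the two is a multiple of the trivial one, and the trivial one lifts to g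
  times an element of the ideal.\<close>

lemma rel_g_regular:
  fixes \<alpha> \<beta> :: "'k::field_char_0"
  assumes ab: "(\<alpha>, \<beta>) \<noteq> (0, 0)" and mem: "rel_g * p \<in> rels \<alpha> \<beta>"
  shows "p \<in> rels \<alpha> \<beta>"
proof -
  let ?t = "Const (2/3) * X3 * X5 :: 'k poly6"
  let ?e = "sub V4 ?t"
  let ?P1 = "Omega1 - Const \<alpha>" and ?P2 = "Omega2 - Const \<beta>"
  define q where "q = X5 * X2 - (X3 ^ 2 - 2 * Const \<alpha>)"
  define w where "w = Const (2/3) * (X2 * X5 - X3 ^ 2) * (X3 * X6 - X5 ^ 2) - Const \<beta>"
  obtain u v where uv: "rel_g * p = u * ?P1 + v * ?P2" using mem by (auto simp: rels_def)
  note C = Const_3_2 Const_2_3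
  have e1: "2 * ?e ?P1 = - q"
    unfolding q_def Omega1_def C using Const_1_2[where ?'k='k] Const_1_3[where ?'k='k]
    by (simp add: sub_simps) Groebner_Basis.algebra
  have e2: "?e ?P2 = w"
    unfolding w_def Omega2_def C using Const_1_2[where ?'k='k] Const_1_3[where ?'k='k]
    by (simp add: sub_simps) Groebner_Basis.algebra
  have eg: "?e rel_g = 0"
    unfolding rel_g_def C using Const_1_2[where ?'k='k] Const_1_3[where ?'k='k]
    by (simp add: sub_simps) Groebner_Basis.algebra
  have gdvd: "\<exists>s. r = ?e r + rel_g * s" for r
  proof -
    have "X4 - ?t dvd r - ?e r" by (rule sub_dvd_diff)
    then obtain s where "r - ?e r = (X4 - ?t) * s" by (rule dvdE)
    moreover have "X4 - ?t = rel_g * (- ((2::'k poly6) * Const (1/3)))"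
      unfolding rel_g_def C using Const_1_2[where ?'k='k] Const_1_3[where ?'k='k]
      by Groebner_Basis.algebra
    ultimately have "r = ?e r + rel_g * (- (2 * Const (1/3)) * s)"
      by Groebner_Basis.algebra
    then show ?thesis by blast
  qed
  have "?e (u * ?P1 + v * ?P2) = 0" unfolding uv[symmetric] using eg by (simp add: sub_simps)
  then have 0: "?e u * q = 2 * ?e v * w"
    using e1 e2 by (simp only: ring_map_simps[OF ring_map_sub]) Groebner_Basis.algebra
  then have "?e v * (2 * w) = q * ?e u" by (simp add: mult_ac)
  then have "q dvd ?e v * (2 * w)" by simp
  moreover have "\<not> q dvd 2 * w"
  proof
    assume d: "q dvd 2 * w"
    \<comment> \<open>On this line q vanishes and w = (4/3) alpha (1 - s) - beta; s = 1 and s = 0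
      would force both parameters to be 0.\<close>
    let ?r = "\<lambda>s. (\<lambda>_. 1)(V2 := 1 - 2 * \<alpha>, V6 := s)"
    have "pt (?r s) q = 0" for s by (simp add: q_def pt_simps)
    then have "pt (?r s) (2 * w) = 0" for s using not_dvd_by_pt d by blast
    from this[of 1] this[of 0] have "\<beta> = 0" "\<alpha> = 0"
      by (simp_all add: w_def pt_simps field_simps)
    then show False using ab by simp
  qed
  moreover have "q dvd a \<or> q dvd b" if "q dvd a * b" for a b
  proof -
    let ?d = "X3 ^ 2 - 2 * Const \<alpha>"
    have "sub V5 0 ?d \<noteq> 0"
    proof
      assume "sub V5 0 ?d = 0"
      then have "pt r (X3 ^ 2 - 2 * Const \<alpha>) = 0" for r by (simp add: sub_simps pt_simps)
      from this[of "\<lambda>_. 0"] this[of "\<lambda>_. 1"] show False by (simp add: pt_simps)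
    qed
    then show ?thesis
      using linear_prime[of V2 V5 ?d a b] that by (simp add: kill_simps q_def)
  qed
  ultimately have "q dvd ?e v" by blast
  then obtain v1 where v1: "?e v = q * v1" by (rule dvdE)
  have "q \<noteq> 0"
  proof
    assume "q = 0"
    then have "pt r q = 0" for r by (simp add: pt_simps)
    from this[of "\<lambda>_. 0"] this[of "(\<lambda>_. 0)(V3 := 1)"] show False by (simp add: q_def pt_simps)
  qed
  moreover have "q * ?e u = q * (2 * v1 * w)" using 0 v1 by (simp add: mult_ac)
  ultimately have u1: "?e u = 2 * v1 * w" by simp
  obtain su where su: "u = ?e u + rel_g * su" using gdvd by blast
  obtain sv where sv: "v = ?e v + rel_g * sv" using gdvd by blast
  obtain s2 where s2: "?P2 = w + rel_g * s2" using gdvd e2 by metis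
  have q: "q = 2 * rel_g * X1 - 2 * ?P1"
    unfolding q_def Omega1_alt using Const_1_2[where ?'k='k] by Groebner_Basis.algebra
  have uu: "u = 2 * v1 * w + rel_g * su" using su u1 by simp
  have vv: "v = q * v1 + rel_g * sv" using sv v1 by simp
  \<comment> \<open>By \<open>q\<close> and \<open>s2\<close>, the trivial part 2 v1 w P1 + q v1 P2
    equals g (2 X1 v1 P2 - 2 v1 s2 P1), so that a factor g splits off from the whole sum.\<close>
  have "rel_g * p = rel_g * ((su - 2 * v1 * s2) * ?P1 + (sv + 2 * X1 * v1) * ?P2)"
    unfolding uv using uu vv q s2 by Groebner_Basis.algebra
  then have "p = (su - 2 * v1 * s2) * ?P1 + (sv + 2 * X1 * v1) * ?P2"
    using rel_g_nonzero[where ?'k='k] by simp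
  then show ?thesis by (auto simp: rels_def)
qed

text \<open>Pseudo-division by both relations leaves a remainder in X3, ..., X6, where
  \<open>h\<close> is injective. The power of f is cancelled within the multiples of Omega2 - beta,
  where primality suffices; the power of g has to be cancelled modulo the whole ideal.\<close>

theorem kernel_rels:
  fixes \<alpha> \<beta> :: "'k::field_char_0" and h :: "'k poly6 \<Rightarrow> 'b::comm_ring_1"
  assumes ab: "(\<alpha>, \<beta>) \<noteq> (0, 0)" and h: "ring_map h"
    and h1: "h (Omega1 - Const \<alpha>) = 0" and h2: "h (Omega2 - Const \<beta>) = 0"
    and inj: "\<And>p. kill {V1, V2} p = p \<Longrightarrow> h p = 0 \<Longrightarrow> p = 0"
    and p: "h p = 0"
  shows "p \<in> rels \<alpha> \<beta>"
proof -
  let ?P1 = "Omega1 - Const \<alpha>" and ?P2 = "Omega2 - Const \<beta>"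
  let ?d1 = "Const (1/2) * X2 * X5 - Const (1/2) * X3 ^ 2 + Const \<alpha>"
  have P1: "rel_g * X1 - ?d1 = ?P1" by (simp add: Omega1_alt)
  have P2: "rel_f * X2 - (rel_h + Const \<beta>) = ?P2" by (simp add: Omega2_alt)
  have k0: "kill {} r = r" for r :: "'k poly6"
    by (rule ring_map_eqI[OF ring_map_kill ring_map_id]) (simp_all add: kill_simps)
  obtain n w r where 1: "rel_g ^ n * p = ?P1 * w + r" "kill {V1} r = r"
    using pseudo_division[of V1 "{V1}" rel_g ?d1 p] unfolding P1
    by (auto simp: kill_simps rel_g_def k0)
  have "kill ({V1, V2} - {V2}) r = r" using 1(2) by (simp add: insert_Diff_if)
  then obtain m v s where 2: "rel_f ^ m * r = ?P2 * v + s" "kill {V1, V2} s = s"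
    using pseudo_division[of V2 "{V1, V2}" rel_f "rel_h + Const \<beta>" r] unfolding P2
    by (auto simp: kill_simps rel_f_def rel_h_def)
  have "h r = 0" using arg_cong[OF 1(1), of h] h1 p by (simp only: ring_map_simps[OF h]) simp
  then have "h s = 0" using arg_cong[OF 2(1), of h] h2 by (simp only: ring_map_simps[OF h]) simp
  then have s: "s = 0" using inj 2 by blast
  then have "rel_f ^ m dvd ?P2 * v" using 2(1) by (metis add.right_neutral dvd_triv_left)
  then have "rel_f ^ m dvd v"
    using prime_power_dvd_cancel[OF rel_f_prime rel_f_nonzero rel_f_not_dvd] by blast
  then obtain v' where "v = rel_f ^ m * v'" by (rule dvdE)
  then have "rel_f ^ m * r = rel_f ^ m * (?P2 * v')" using 2(1) s by (simp add: ac_simps)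
  then have "r = ?P2 * v'" using rel_f_nonzero[where ?'k='k] by simp
  then have "rel_g ^ n * p \<in> rels \<alpha> \<beta>" using 1(1) by (auto simp: rels_def mult.commute)
  then show ?thesis
  proof (induction n)
    case (Suc n)
    then show ?case using rel_g_regular[OF ab] by (simp add: mult.assoc)
  qed simp
qed

section \<open>The Poisson torus\<close>

datatype tvar = T3 | T4 | T5 | T6

lemma UNIV_tvar: "(UNIV :: tvar set) = {T3, T4, T5, T6}"
  using tvar.exhaust by auto

instance tvar :: finite
  by standard (simp add: UNIV_tvar)

fun tvar_rank :: "tvar \<Rightarrow> nat" where
  "tvar_rank T3 = 3" | "tvar_rank T4 = 4" | "tvar_rank T5 = 5" | "tvar_rank T6 = 6"

lemma tvar_rank_inj: "tvar_rank i = tvar_rank j \<longleftrightarrow> i = j"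
  by (cases i; cases j) simp_all

instantiation tvar :: linorder
begin

definition less_eq_tvar :: "tvar \<Rightarrow> tvar \<Rightarrow> bool" where
  "i \<le> j \<longleftrightarrow> tvar_rank i \<le> tvar_rank j"

definition less_tvar :: "tvar \<Rightarrow> tvar \<Rightarrow> bool" where
  "i < j \<longleftrightarrow> tvar_rank i < tvar_rank j"

instance
  by standard (auto simp: less_eq_tvar_def less_tvar_def simp flip: tvar_rank_inj)

end

type_synonym 'k laurent = "(tvar \<Rightarrow>\<^sub>0 int) \<Rightarrow>\<^sub>0 'k"

definition sc :: "'k::comm_ring_1 \<Rightarrow> 'k laurent" where
  "sc c = Poly_Mapping.single 0 c"

definition tm :: "tvar \<Rightarrow> 'k::comm_ring_1 laurent" where
  "tm i = Poly_Mapping.single (Poly_Mapping.single i 1) 1"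

definition ti :: "tvar \<Rightarrow> 'k::comm_ring_1 laurent" where
  "ti i = Poly_Mapping.single (Poly_Mapping.single i (-1)) 1"

lemma ring_map_sc: "ring_map sc"
  by (simp add: ring_map_def sc_def single_add mult_single)

lemmas sc_simps = ring_map_simps[OF ring_map_sc]

lemma tm_ti: "tm i * ti i = 1"
  by (simp add: tm_def ti_def mult_single flip: single_add)

lemma laurent_gen_induct [case_names sc tm ti add mult]:
  fixes a :: "'k::comm_ring_1 laurent"
  assumes "\<And>c. P (sc c)" "\<And>i. P (tm i)" "\<And>i. P (ti i)"
    "\<And>p q. P p \<Longrightarrow> P q \<Longrightarrow> P (p + q)" "\<And>p q. P p \<Longrightarrow> P q \<Longrightarrow> P (p * q)"
  shows "P a"
proof -
  have 1: "P 1" and 0: "P 0" using assms(1)[of 1] assms(1)[of 0] by (auto simp: sc_simps)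
  have pow: "P (q ^ n)" if "P q" for q n
    using that 1 by (induction n) (auto intro: assms)
  have tpow: "tm i ^ n = Poly_Mapping.single (Poly_Mapping.single i (int n)) (1::'k)"
    "ti i ^ n = Poly_Mapping.single (Poly_Mapping.single i (- int n)) (1::'k)" for i n
    by (induction n) (simp_all add: tm_def ti_def mult_single flip: single_add)
  have mon: "P (Poly_Mapping.single (Poly_Mapping.single i z) 1)" for i z
  proof (cases "z \<ge> 0")
    case True
    then have "Poly_Mapping.single (Poly_Mapping.single i z) 1 = (tm i ^ nat z :: 'k laurent)"
      by (simp add: tpow)
    then show ?thesis using pow assms by simp
  next
    case False
    then have "Poly_Mapping.single (Poly_Mapping.single i z) 1 = (ti i ^ nat (- z) :: 'k laurent)"
      by (simp add: tpow)
    then show ?thesis using pow assms by simp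
  qed
  have "P (Poly_Mapping.single (\<Sum>i\<in>S. Poly_Mapping.single i (Poly_Mapping.lookup m i)) 1)"
    if "finite S" for S m
    using that
  proof (induction S)
    case (insert i S)
    then show ?case
      using assms(5)[OF mon[of i "Poly_Mapping.lookup m i"] insert(3)]
      by (simp add: mult_single)
  qed (use 1 in simp)
  moreover have "(\<Sum>i\<in>UNIV. Poly_Mapping.single i (Poly_Mapping.lookup m i)) = m"
    for m :: "tvar \<Rightarrow>\<^sub>0 int"
    by (intro poly_mapping_eqI) (simp add: lookup_sum lookup_single when_def)
  ultimately have mon1: "P (Poly_Mapping.single m 1)" for m by (metis finite)
  have "P (Poly_Mapping.single m c)" for m c
    using assms(5)[OF assms(1)[of c] mon1[of m]] by (simp add: sc_def mult_single)
  then show ?thesis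
    by (induction a rule: pm_induct) (auto intro: assms 0)
qed

section \<open>Derivations of the torus and its bracket\<close>

definition is_der :: "('k::comm_ring_1 laurent \<Rightarrow> 'k laurent) \<Rightarrow> bool" where
  "is_der d \<longleftrightarrow> (\<forall>c. d (sc c) = 0) \<and> (\<forall>a b. d (a + b) = d a + d b) \<and>
     (\<forall>a b. d (a * b) = d a * b + a * d b)"

lemma is_derI:
  "(\<And>c. d (sc c) = 0) \<Longrightarrow> (\<And>a b. d (a + b) = d a + d b) \<Longrightarrow>
    (\<And>a b. d (a * b) = d a * b + a * d b) \<Longrightarrow> is_der d"
  by (simp add: is_der_def)

lemma
  assumes "is_der d"
  shows is_der_sc: "d (sc c) = 0"
    and is_der_add: "d (a + b) = d a + d b"
    and is_der_mult: "d (a * b) = d a * b + a * d b"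
    and is_der_0: "d 0 = 0"
    and is_der_1: "d 1 = 0"
    and is_der_numeral: "d (numeral w) = 0"
    and is_der_minus: "d (- a) = - d a"
    and is_der_diff: "d (a - b) = d a - d b"
    and is_der_pow2: "d (a ^ 2) = 2 * a * d a"
    and is_der_pow3: "d (a ^ 3) = d (a ^ 2 * a)"
    and is_der_ti: "d (ti i) = - (ti i ^ 2 * d (tm i))"
proof -
  show c: "d (sc c) = 0" and a: "d (a + b) = d a + d b"
    and m: "d (a * b) = d a * b + a * d b" for c a b
    using assms by (auto simp: is_der_def)
  show z: "d 0 = 0" using c[of 0] by (simp add: sc_simps)
  show o: "d 1 = 0" using c[of 1] by (simp add: sc_simps)
  show "d (numeral w) = 0" using c[of "numeral w"] by (simp add: sc_simps)
  show mi: "d (- a) = - d a" for a using a[of a "- a"] z by (simp add: eq_neg_iff_add_eq_0 add.commute)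
  show "d (a - b) = d a - d b" using a[of a "- b"] mi by simp
  show "d (a ^ 2) = 2 * a * d a" by (simp add: power2_eq_square m)
  show "d (a ^ 3) = d (a ^ 2 * a)" by (simp add: eval_nat_numeral mult.commute)
  have 1: "d (tm i) * ti i + tm i * d (ti i) = 0"
    using m[of "tm i" "ti i"] o by (simp add: tm_ti)
  have "d (ti i) = (tm i * ti i) * d (ti i)" by (simp add: tm_ti)
  also have "\<dots> = ti i * (tm i * d (ti i))" by (simp add: ac_simps)
  also have "tm i * d (ti i) = - (d (tm i) * ti i)"
    using 1 by (simp add: eq_neg_iff_add_eq_0 add.commute)
  finally show "d (ti i) = - (ti i ^ 2 * d (tm i))"
    by (simp add: power2_eq_square ac_simps)
qed

lemmas is_der_simps = is_der_sc is_der_add is_der_mult is_der_0 is_der_1 is_der_numeral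
  is_der_minus is_der_diff is_der_pow2 is_der_pow3

lemma is_der_eqI:
  assumes "is_der d" "is_der e" "\<And>i. d (tm i) = e (tm i)"
  shows "d a = e a"
  by (induction a rule: laurent_gen_induct)
    (simp_all add: assms(3) is_der_simps[OF assms(1)] is_der_simps[OF assms(2)]
      is_der_ti[OF assms(1)] is_der_ti[OF assms(2)])

text \<open>The Euler derivation Ti d/dTi.\<close>

definition theta :: "tvar \<Rightarrow> 'k::comm_ring_1 laurent \<Rightarrow> 'k laurent" where
  "theta i = Poly_Mapping.mapp (\<lambda>m c. of_int (Poly_Mapping.lookup m i) * c)"

lemma lookup_theta:
  "Poly_Mapping.lookup (theta i a) m = of_int (Poly_Mapping.lookup m i) * Poly_Mapping.lookup a m"
  by (simp add: theta_def lookup_mapp when_def in_keys_iff)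

lemma theta_add: "theta i (a + b) = theta i a + theta i b"
  by (intro poly_mapping_eqI) (simp add: lookup_theta lookup_add distrib_left)

lemma theta_single:
  "theta i (Poly_Mapping.single m c) =
    Poly_Mapping.single m (of_int (Poly_Mapping.lookup m i) * c)"
  by (intro poly_mapping_eqI) (simp add: lookup_theta lookup_single when_def)

lemma is_der_theta: "is_der (theta i)"
proof (rule is_derI)
  show "theta i (sc c) = 0" for c by (simp add: sc_def theta_single)
  show add: "theta i (a + b) = theta i a + theta i b" for a b by (rule theta_add)
  have zero: "theta i 0 = 0" using add[of 0 0] by simp
  have s: "theta i (Poly_Mapping.single m c * b) =
      theta i (Poly_Mapping.single m c) * b + Poly_Mapping.single m c * theta i b" for m c b
    by (induction b rule: pm_induct)
      (simp_all add: zero add theta_single mult_single lookup_add single_add algebra_simps)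
  show "theta i (a * b) = theta i a * b + a * theta i b" for a b
    by (induction a rule: pm_induct) (simp_all add: zero add s distrib_left distrib_right)
qed

lemma theta_tm: "theta i (tm j) = (if i = j then tm j else 0)"
  by (simp add: tm_def theta_single lookup_single)

lemma theta_commute: "theta i (theta j a) = theta j (theta i a)"
  by (intro poly_mapping_eqI) (simp add: lookup_theta ac_simps)

lemmas theta_simps = is_der_simps[OF is_der_theta]

text \<open>\<open>br a (tm i) = tm i * lder i a\<close>; see \<open>br_tm\<close>.\<close>

fun lder :: "tvar \<Rightarrow> 'k::comm_ring_1 laurent \<Rightarrow> 'k laurent" where
  "lder T3 a = - 3 * theta T4 a - theta T5 a"
| "lder T4 a = 3 * theta T3 a - 3 * theta T5 a - 3 * theta T6 a"
| "lder T5 a = theta T3 a + 3 * theta T4 a - 3 * theta T6 a"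
| "lder T6 a = 3 * theta T4 a + 3 * theta T5 a"

definition br :: "'k::comm_ring_1 laurent \<Rightarrow> 'k laurent \<Rightarrow> 'k laurent" where
  "br a b = lder T3 a * theta T3 b + lder T4 a * theta T4 b + lder T5 a * theta T5 b
     + lder T6 a * theta T6 b"

lemma is_der_lder: "is_der (lder i)"
  by (cases i; rule is_derI) (simp_all add: theta_simps algebra_simps)

lemma is_der_br: "is_der (br a)"
  by (rule is_derI) (simp_all add: br_def theta_simps algebra_simps)

lemma br_antisym: "br b a = - br a b"
  by (simp add: br_def algebra_simps)

lemma is_der_br_left: "is_der (\<lambda>a. br a b)"
proof -
  have "is_der (\<lambda>a. - br b a)"
    by (rule is_derI) (simp_all add: is_der_simps[OF is_der_br])
  also have "(\<lambda>a. - br b a) = (\<lambda>a. br a b)"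
    by (rule ext) (rule br_antisym[symmetric])
  finally show ?thesis .
qed

lemmas br_simps = is_der_simps[OF is_der_br]
lemmas br_left_simps = is_der_simps[OF is_der_br_left]

lemma br_tm: "br a (tm i) = tm i * lder i a"
  by (cases i) (simp_all add: br_def theta_tm)

lemma theta_br: "theta i (br a b) = br (theta i a) b + br a (theta i b)"
proof -
  have "theta i (lder j a) = lder j (theta i a)" for j and a :: "'a laurent"
    by (cases j) (simp_all add: theta_simps theta_commute[of i])
  then show ?thesis
    by (simp only: br_def theta_simps) (simp add: theta_commute[of i] algebra_simps)
qed

fun lwt :: "tvar \<Rightarrow> (tvar \<Rightarrow>\<^sub>0 int) \<Rightarrow> int" where
  "lwt T3 m = - 3 * Poly_Mapping.lookup m T4 - Poly_Mapping.lookup m T5"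
| "lwt T4 m = 3 * Poly_Mapping.lookup m T3 - 3 * Poly_Mapping.lookup m T5
     - 3 * Poly_Mapping.lookup m T6"
| "lwt T5 m = Poly_Mapping.lookup m T3 + 3 * Poly_Mapping.lookup m T4
     - 3 * Poly_Mapping.lookup m T6"
| "lwt T6 m = 3 * Poly_Mapping.lookup m T4 + 3 * Poly_Mapping.lookup m T5"

lemma lookup_numeral_mult:
  "Poly_Mapping.lookup (numeral w * a :: 'k::comm_ring_1 laurent) m =
    numeral w * Poly_Mapping.lookup a m"
proof -
  have "Poly_Mapping.lookup (of_nat n * a) m = of_nat n * Poly_Mapping.lookup a m" for n
    by (induction n) (simp_all add: lookup_add distrib_right)
  from this[of "numeral w"] show ?thesis by simp
qed

lemma lookup_lder:
  "Poly_Mapping.lookup (lder i a) m = of_int (lwt i m) * Poly_Mapping.lookup a m"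
  by (cases i)
    (simp_all add: lookup_add lookup_minus lookup_numeral_mult lookup_theta,
      simp_all add: algebra_simps)

text \<open>The matrix of the q_ij is invertible: a monomial of nonzero degree fails to commute with
  some Ti.\<close>

lemma lwt_nondegenerate:
  assumes "\<And>i. lwt i m = 0"
  shows "m = 0"
proof (rule poly_mapping_eqI)
  fix i
  from assms[of T3] assms[of T4] assms[of T5] assms[of T6]
  show "Poly_Mapping.lookup m i = Poly_Mapping.lookup 0 i"
    by (cases i) simp_all
qed

text \<open>In degree m the condition says that the vector of coefficients of the \<open>e i\<close>
  is proportional to the vector of the \<open>lwt i m\<close>. For nonzero m the latter does not
  vanish, and the ratio is the coefficient of \<open>x\<close>. In degree 0 the condition is empty,
  which leaves the constants.\<close>

lemma compatible_family:
  fixes e :: "tvar \<Rightarrow> 'k::field_char_0 laurent"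
  assumes compat: "\<And>i j. lder j (e i) = lder i (e j)"
  obtains x where "\<And>i. e i = lder i x + sc (Poly_Mapping.lookup (e i) 0)"
proof -
  \<comment> \<open>For nonzero m, any index with nonzero weight yields the same ratio, by
    compatibility.\<close>
  define j where "j m = (SOME i. lwt i m \<noteq> 0)" for m
  have j: "lwt (j m) m \<noteq> 0" if "m \<noteq> 0" for m
    using that lwt_nondegenerate[of m] unfolding j_def by (metis (mono_tags, lifting) someI)
  define S where "S = (\<Union>i\<in>UNIV. Poly_Mapping.keys (e i)) - {0}"
  define x where "x = (\<Sum>m\<in>S. Poly_Mapping.single m
    (Poly_Mapping.lookup (e (j m)) m / of_int (lwt (j m) m)))"
  have S: "finite S" by (simp add: S_def)
  have "e i = lder i x + sc (Poly_Mapping.lookup (e i) 0)" for i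
  proof (rule poly_mapping_eqI)
    fix m
    have lx: "Poly_Mapping.lookup x m =
        (if m \<in> S then Poly_Mapping.lookup (e (j m)) m / of_int (lwt (j m) m) else 0)"
      using S by (simp add: x_def lookup_sum lookup_single when_def)
    show "Poly_Mapping.lookup (e i) m =
        Poly_Mapping.lookup (lder i x + sc (Poly_Mapping.lookup (e i) 0)) m"
    proof (cases "m = 0")
      case True
      then have "lwt i m = 0" by (cases i) simp_all
      then show ?thesis using True by (simp add: lookup_add lookup_lder sc_def)
    next
      case False
      have c: "of_int (lwt (j m) m) * Poly_Mapping.lookup (e i) m =
          of_int (lwt i m) * Poly_Mapping.lookup (e (j m)) m"
        using arg_cong[OF compat[of "j m" i], of "\<lambda>a. Poly_Mapping.lookup a m"]
        by (simp add: lookup_lder)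
      have "Poly_Mapping.lookup (e i) m = of_int (lwt i m) * Poly_Mapping.lookup x m"
      proof (cases "m \<in> S")
        case True
        then show ?thesis using c j[OF False] by (simp add: lx field_simps)
      next
        case F: False
        then have "Poly_Mapping.lookup (e i) m = 0"
          using False by (auto simp: S_def in_keys_iff)
        then show ?thesis using F by (simp add: lx)
      qed
      then show ?thesis using False by (simp add: lookup_add lookup_lder sc_def lookup_single)
    qed
  qed
  then show thesis using that by blast
qed

section \<open>Embedding the quotient into the torus\<close>

text \<open>\<open>xt3\<close> and \<open>xt4\<close> solve T3 = g / X5 and T4 = f / X6 for X3 and
  X4. These quotients, X3 - (3/2) X4 / X5 and X4 - (2/3) X5^3 / X6, are the coordinates that
  deleting derivations produces.\<close>

definition xt3 :: "'k::field_char_0 laurent" where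
  "xt3 = tm T3 + sc (3/2) * tm T4 * ti T5 + tm T5 ^ 2 * ti T6"

definition xt4 :: "'k::field_char_0 laurent" where
  "xt4 = tm T4 + sc (2/3) * tm T5 ^ 3 * ti T6"

text \<open>The second relation solved for X2, and then, in \<open>xt1\<close>, the first one for
  X1: f and g have become the monomials T4 T6 and T3 T5, which are units.\<close>

definition xt2 :: "'k::field_char_0 \<Rightarrow> 'k laurent" where
  "xt2 \<beta> = ti T4 * ti T6 * (sc \<beta> + sc (2/3) * xt3 ^ 3 * tm T6 - 2 * xt3 ^ 2 * tm T5 ^ 2
     + 3 * xt3 * xt4 * tm T5 - sc (3/2) * xt4 ^ 2)"

definition xt1 :: "'k::field_char_0 \<Rightarrow> 'k \<Rightarrow> 'k laurent" where
  "xt1 \<alpha> \<beta> = ti T3 * ti T5 *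
     (sc \<alpha> + sc (1/2) * xt2 \<beta> * tm T5 - sc (1/2) * xt3 ^ 2)"

fun xt :: "'k::field_char_0 \<Rightarrow> 'k \<Rightarrow> var \<Rightarrow> 'k laurent" where
  "xt \<alpha> \<beta> V1 = xt1 \<alpha> \<beta>" | "xt \<alpha> \<beta> V2 = xt2 \<beta>" | "xt \<alpha> \<beta> V3 = xt3"
| "xt \<alpha> \<beta> V4 = xt4" | "xt \<alpha> \<beta> V5 = tm T5" | "xt \<alpha> \<beta> V6 = tm T6"

definition emb :: "'k::field_char_0 \<Rightarrow> 'k \<Rightarrow> 'k poly6 \<Rightarrow> 'k laurent" where
  "emb \<alpha> \<beta> = ev sc (xt \<alpha> \<beta>)"

lemma ring_map_emb: "ring_map (emb \<alpha> \<beta>)"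
  by (simp add: emb_def ring_map_ev ring_map_sc)

lemma emb_Const: "emb \<alpha> \<beta> (Const c) = sc c"
  by (simp add: emb_def ev_simps ring_map_sc)

lemma emb_Var: "emb \<alpha> \<beta> (Var i) = xt \<alpha> \<beta> i"
  by (simp add: emb_def ev_simps ring_map_sc)

lemmas emb_simps = emb_Const emb_Var ring_map_simps[OF ring_map_emb]

lemma sc_3_2: "sc (3/2 :: 'k::field_char_0) = 3 * sc (1/2)"
  and sc_2_3: "sc (2/3 :: 'k::field_char_0) = 2 * sc (1/3)"
  and sc_1_2: "2 * sc (1/2 :: 'k::field_char_0) = 1"
  and sc_1_3: "3 * sc (1/3 :: 'k::field_char_0) = 1"
  by (simp_all flip: sc_simps)

lemma emb_rel_f: "emb \<alpha> \<beta> rel_f = tm T4 * tm T6"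
proof -
  have "emb \<alpha> \<beta> rel_f = tm T4 * tm T6 + sc (2/3) * tm T5 ^ 3 * (tm T6 * ti T6 - 1)"
    by (simp add: rel_f_def emb_simps xt4_def algebra_simps)
  then show ?thesis by (simp add: tm_ti)
qed

lemma emb_rel_g: "emb \<alpha> \<beta> rel_g = (tm T3 * tm T5 :: 'k::field_char_0 laurent)"
proof -
  have "sc (3/2) * sc (2/3) = (1 :: 'k laurent)" by (simp flip: sc_simps)
  moreover have "emb \<alpha> \<beta> rel_g = tm T3 * tm T5 + sc (3/2) * tm T4 * (tm T5 * ti T5 - 1)
      + tm T5 ^ 3 * ti T6 * (1 - sc (3/2) * sc (2/3))"
    by (simp add: rel_g_def emb_simps xt4_def xt3_def eval_nat_numeral algebra_simps)
  ultimately show ?thesis by (simp add: tm_ti)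
qed

lemma emb_Omega1: "emb \<alpha> \<beta> Omega1 = sc \<alpha>"
proof -
  have "emb \<alpha> \<beta> Omega1 = (tm T3 * ti T3) * (tm T5 * ti T5) *
      (sc \<alpha> + sc (1/2) * xt2 \<beta> * tm T5 - sc (1/2) * xt3 ^ 2)
      - (sc (1/2) * xt2 \<beta> * tm T5 - sc (1/2) * xt3 ^ 2)"
    unfolding Omega1_alt ring_map_simps[OF ring_map_emb] emb_rel_g
    by (simp add: emb_simps xt1_def mult_ac)
  then show ?thesis by (simp add: tm_ti)
qed

lemma emb_Omega2: "emb \<alpha> \<beta> Omega2 = sc \<beta>"
proof -
  have "emb \<alpha> \<beta> Omega2 = (tm T4 * ti T4) * (tm T6 * ti T6) * (sc \<beta> + emb \<alpha> \<beta> rel_h)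
      - emb \<alpha> \<beta> rel_h"
    unfolding Omega2_alt ring_map_simps[OF ring_map_emb] emb_rel_f
    by (simp add: emb_simps xt2_def rel_h_def mult_ac add_diff_eq)
  then show ?thesis by (simp add: tm_ti)
qed

text \<open>Substituting g / X5, f / X6, X5, X6 for the Ti is a ring map from the torus to the
  rational functions, since none of the four is 0, and it undoes the embedding on X3, ...,
  X6.\<close>

lemma emb_free_inj:
  assumes free: "kill {V1, V2} p = p" and p: "emb \<alpha> \<beta> p = 0"
  shows "p = (0 :: 'k::field_char_0 poly6)"
proof -
  define F where "F = (\<lambda>p :: 'k poly6. Fract p 1)"
  define r where "r = (\<lambda>i. case i of T3 \<Rightarrow> F rel_g / F X5 | T4 \<Rightarrow> F rel_f / F X6
    | T5 \<Rightarrow> F X5 | T6 \<Rightarrow> F X6)"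
  define M where "M = mev (\<lambda>c. F (Const c))
    (\<lambda>m. \<Prod>i\<in>UNIV. r i powi Poly_Mapping.lookup m i)"
  have F: "ring_map F"
    by (auto intro!: ring_mapI simp: F_def One_fract_def)
  have F0: "F a = 0 \<longleftrightarrow> a = 0" for a
    by (simp add: F_def eq_fract Zero_fract_def)
  note F_simps = ring_map_simps[OF F]
  have h: "ring_map (\<lambda>c. F (Const c))" by (rule ring_map_comp[OF F ring_map_Const])
  have r0: "r i \<noteq> 0" for i
    by (cases i) (simp_all add: r_def F0 Var_nonzero rel_f_nonzero rel_g_nonzero)
  have M: "ring_map M"
    unfolding M_def using r0
    by (intro ring_map_mev[OF h]) (simp add: mon_map_def lookup_add power_int_add prod.distrib)
  have prod1: "(\<Prod>j\<in>UNIV. r j powi Poly_Mapping.lookup (Poly_Mapping.single i z) j) = r i powi z"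
    for i z
  proof -
    have "(\<Prod>j\<in>UNIV. r j powi Poly_Mapping.lookup (Poly_Mapping.single i z) j) =
        (\<Prod>j\<in>UNIV. if j = i then r i powi z else 1)"
      by (intro prod.cong) (auto simp: lookup_single when_def)
    then show ?thesis by simp
  qed
  have Mtm: "M (tm i) = r i" and Mti: "M (ti i) = inverse (r i)" for i
    unfolding M_def tm_def ti_def mev_single[OF h] prod1
    by (simp_all add: F_simps power_int_minus)
  have Msc: "M (sc c) = F (Const c)" for c
    by (simp add: M_def sc_def mev_single[OF h])
  note M_simps = ring_map_simps[OF M] Mtm Mti Msc
  have X: "F X5 \<noteq> 0" "F X6 \<noteq> 0" by (simp_all add: F0 Var_nonzero)
  have c: "F (Const (3/2)) * F (Const (2/3)) = 1"
    by (simp flip: ring_map_mult[OF F] Const_mult) (simp add: ring_map_1[OF F])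
  have M4: "M xt4 = F X4"
    using X by (simp add: xt4_def M_simps r_def rel_f_def F_simps field_simps)
  have "M xt3 = F rel_g / F X5 + F (Const (3/2)) * (F rel_f / F X6) / F X5 + F X5 ^ 2 / F X6"
    using X by (simp add: xt3_def M_simps r_def field_simps)
  also have "\<dots> = F X3 + F X5 ^ 2 / F X6 * (1 - F (Const (3/2)) * F (Const (2/3)))"
    using X by (simp add: rel_g_def rel_f_def F_simps eval_nat_numeral field_simps)
  finally have M3: "M xt3 = F X3" using c by simp
  have "M (emb \<alpha> \<beta> (kill {V1, V2} p)) = F (kill {V1, V2} p)"
  proof (rule ring_map_eqI[OF ring_map_comp[OF M ring_map_comp[OF ring_map_emb ring_map_kill]]
          ring_map_comp[OF F ring_map_kill]])
    fix i
    show "M (emb \<alpha> \<beta> (kill {V1, V2} (Var i))) = F (kill {V1, V2} (Var i))"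
      by (cases i) (simp_all add: kill_simps emb_simps M_simps F_simps M3 M4 r_def)
  qed (simp add: kill_simps emb_simps M_simps)
  then have "F p = 0" using free p by (simp add: M_simps)
  then show ?thesis by (simp add: F0)
qed

theorem emb_eq_0_iff:
  assumes ab: "(\<alpha>, \<beta>) \<noteq> (0, 0)"
  shows "emb \<alpha> \<beta> p = 0 \<longleftrightarrow> p \<in> rels \<alpha> \<beta>"
proof
  assume "emb \<alpha> \<beta> p = 0"
  then show "p \<in> rels \<alpha> \<beta>"
    by (intro kernel_rels[OF ab ring_map_emb _ _ emb_free_inj])
      (simp_all add: emb_simps emb_Omega1 emb_Omega2)
next
  assume "p \<in> rels \<alpha> \<beta>"
  then show "emb \<alpha> \<beta> p = 0"
    by (auto simp: rels_def emb_simps emb_Omega1 emb_Omega2)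
qed

definition R0 :: "'k::field_char_0 \<Rightarrow> 'k \<Rightarrow> 'k laurent set" where
  "R0 \<alpha> \<beta> = range (emb \<alpha> \<beta>)"

lemma emb_in_R0 [simp]: "emb \<alpha> \<beta> p \<in> R0 \<alpha> \<beta>"
  by (simp add: R0_def)

text \<open>Differentiating f X2 = Omega2 + h and g X1 = Omega1 + (1/2)(X2 X5 - X3^2) gives the
  values on X2 and X1, as f and g are sent to units. The values on Omega1 and Omega2 are prescribed
  separately because the derivations start from the polynomial ring, before the relations are
  imposed.\<close>

lemma der_along_emb_eqI:
  assumes d: "der_along (emb \<alpha> \<beta>) d" and e: "der_along (emb \<alpha> \<beta>) e"
    and var: "d X3 = e X3" "d X4 = e X4" "d X5 = e X5" "d X6 = e X6"
    and Om: "d Omega1 = e Omega1" "d Omega2 = e Omega2"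
  shows "d p = e p"
proof (rule der_along_eqI[OF d e])
  note ds = der_along_simps[OF d] and es = der_along_simps[OF e]
  have fgh: "d rel_f = e rel_f" "d rel_g = e rel_g" "d rel_h = e rel_h"
    by (simp_all add: rel_f_def rel_g_def rel_h_def ds es var)
  have cancel: "a = b" if "tm i * tm j * a = tm i * tm j * b" for i j and a b :: "'a laurent"
  proof -
    have "ti i * ti j * (tm i * tm j * a) = ti i * ti j * (tm i * tm j * b)" using that by simp
    moreover have "ti i * ti j * (tm i * tm j * c) = (tm i * ti i) * (tm j * ti j) * c"
      for c :: "'a laurent" by (simp add: ac_simps)
    ultimately show ?thesis by (simp add: tm_ti)
  qed
  have "emb \<alpha> \<beta> rel_f * d X2 = emb \<alpha> \<beta> rel_f * e X2"
    using Om(2) fgh by (simp add: Omega2_alt ds es)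
  then have 2: "d X2 = e X2" unfolding emb_rel_f by (rule cancel)
  have "emb \<alpha> \<beta> rel_g * d X1 = emb \<alpha> \<beta> rel_g * e X1"
    using Om(1) fgh 2 var by (simp add: Omega1_alt ds es)
  then have 1: "d X1 = e X1" unfolding emb_rel_g by (rule cancel)
  show "d (Var i) = e (Var i)" for i by (cases i) (simp_all add: 1 2 var)
qed

section \<open>The embedding respects the brackets\<close>

lemma der_along_bracket_left: "der_along (\<lambda>p. p) (\<lambda>p. poly_bracket p f)"
proof -
  have "der_along (\<lambda>p. p) (\<lambda>p. - poly_bracket f p)"
    by (rule der_alongI) (simp_all add: der_along_simps[OF der_along_bracket])
  also have "(\<lambda>p. - poly_bracket f p) = (\<lambda>p. poly_bracket p f)"
    by (rule ext) (rule poly_bracket_antisym[symmetric])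
  finally show ?thesis .
qed

lemmas poly_bracket_left_simps = der_along_simps[OF der_along_bracket_left]

lemma Omega1_central: "poly_bracket Omega1 p = (0 :: 'k::field_char_0 poly6)"
proof (rule der_along_eqI[OF der_along_bracket])
  show "der_along (\<lambda>p. p) (\<lambda>p. 0)" by (rule der_alongI) simp_all
  show "poly_bracket Omega1 (Var i) = (0 :: 'k poly6)" for i
    unfolding Omega1_def Const_3_2 using Const_1_2[where ?'k='k]
    by (induct i; simp add: poly_bracket_left_simps poly_bracket_Var)
      (Groebner_Basis.algebra+)
qed

lemma Omega2_central: "poly_bracket Omega2 p = (0 :: 'k::field_char_0 poly6)"
proof (rule der_along_eqI[OF der_along_bracket])
  show "der_along (\<lambda>p. p) (\<lambda>p. 0)" by (rule der_alongI) simp_all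
  show "poly_bracket Omega2 (Var i) = (0 :: 'k poly6)" for i
    unfolding Omega2_def Const_3_2 Const_2_3 using Const_1_2[where ?'k='k] Const_1_3[where ?'k='k]
    by (induct i; simp add: poly_bracket_left_simps poly_bracket_Var)
      (Groebner_Basis.algebra+)
qed

lemma der_along_emb_comp:
  "der_along (\<lambda>p. p) d \<Longrightarrow> der_along (emb \<alpha> \<beta>) (\<lambda>p. emb \<alpha> \<beta> (d p))"
  by (rule der_alongI) (simp_all add: der_along_simps emb_simps)

lemma der_along_comp_emb:
  "is_der d \<Longrightarrow> der_along (emb \<alpha> \<beta>) (\<lambda>p. d (emb \<alpha> \<beta> p))"
  by (rule der_alongI) (simp_all add: is_der_simps emb_simps)

lemma br_xt34: "br xt4 xt3 = - 3 * xt3 * (xt4 :: 'k::field_char_0 laurent)"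
  "br (tm T5) xt3 = - xt3 * tm T5 - 3 * (xt4 :: 'k laurent)"
  "br (tm T5) xt4 = - 3 * xt4 * (tm T5 :: 'k laurent)"
  "br (tm T6) xt3 = - 6 * (tm T5 :: 'k laurent) ^ 2"
  "br (tm T6) xt4 = - 3 * xt4 * tm T6 - 4 * (tm T5 :: 'k laurent) ^ 3"
  "br (tm T6) (tm T5) = - 3 * tm T5 * (tm T6 :: 'k laurent)"
proof -
  note r = tm_ti[of T5, where ?'a='k] tm_ti[of T6, where ?'a='k]
    sc_1_2[where ?'k='k] sc_1_3[where ?'k='k]
  note simps = br_def theta_simps is_der_ti[OF is_der_theta] theta_tm xt3_def xt4_def sc_3_2 sc_2_3
  show "br xt4 xt3 = - 3 * xt3 * (xt4 :: 'k laurent)"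
    using r by (simp add: simps) Groebner_Basis.algebra
  show "br (tm T5) xt3 = - xt3 * tm T5 - 3 * (xt4 :: 'k laurent)"
    using r by (simp add: simps) Groebner_Basis.algebra
  show "br (tm T5) xt4 = - 3 * xt4 * (tm T5 :: 'k laurent)"
    using r by (simp add: simps) Groebner_Basis.algebra
  show "br (tm T6) xt3 = - 6 * (tm T5 :: 'k laurent) ^ 2"
    using r by (simp add: simps) Groebner_Basis.algebra
  show "br (tm T6) xt4 = - 3 * xt4 * tm T6 - 4 * (tm T5 :: 'k laurent) ^ 3"
    using r by (simp add: simps) Groebner_Basis.algebra
  show "br (tm T6) (tm T5) = - 3 * tm T5 * (tm T6 :: 'k laurent)"
    by (simp add: simps)
qed

text \<open>Both sides are biderivations along the embedding and agree on pairs from X3, ..., X6. As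
  Omega1 and Omega2 are central, \<open>der_along_emb_eqI\<close> extends the agreement first in the
  left and then in the right argument. The images of X1 and X2 are never bracketed
  explicitly.\<close>

lemma emb_bracket: "emb \<alpha> \<beta> (poly_bracket p q) = br (emb \<alpha> \<beta> p) (emb \<alpha> \<beta> q)"
proof -
  let ?E = "emb \<alpha> \<beta>"
  have l: "der_along ?E (\<lambda>p. ?E (poly_bracket p q))" "der_along ?E (\<lambda>p. br (?E p) (?E q))"
    "der_along ?E (\<lambda>p. ?E (poly_bracket q p))" "der_along ?E (\<lambda>p. br (?E q) (?E p))" for q
    by (intro der_along_emb_comp der_along_bracket_left der_along_comp_emb[OF is_der_br_left]
        der_along_bracket der_along_comp_emb[OF is_der_br])+
  have Om: "?E (poly_bracket Omega1 q) = br (?E Omega1) (?E q)"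
    "?E (poly_bracket Omega2 q) = br (?E Omega2) (?E q)" for q
    by (simp_all add: Omega1_central Omega2_central emb_Omega1 emb_Omega2 br_left_simps emb_simps)
  have base: "?E (poly_bracket (Var i) (Var j)) = br (?E (Var i)) (?E (Var j))"
    if "i \<in> {V3, V4, V5, V6}" "j \<in> {V3, V4, V5, V6}" "var_rank i > var_rank j" for i j
    using that by (auto simp: poly_bracket_Var emb_simps br_xt34 mult_ac)
  have base': "?E (poly_bracket (Var i) (Var j)) = br (?E (Var i)) (?E (Var j))"
    if ij: "i \<in> {V3, V4, V5, V6}" "j \<in> {V3, V4, V5, V6}" for i j
  proof (cases "var_rank i" "var_rank j" rule: linorder_cases)
    case less
    have "?E (poly_bracket (Var i) (Var j)) = - ?E (poly_bracket (Var j) (Var i))"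
      by (subst poly_bracket_antisym) (simp add: emb_simps)
    also have "\<dots> = - br (?E (Var j)) (?E (Var i))"
      using base[OF ij(2,1) less] by simp
    finally show ?thesis by (metis br_antisym)
  next
    case equal
    then have "i = j" by (simp add: var_rank_inj)
    moreover have "br a a = 0" for a :: "'a laurent" by (simp add: br_def algebra_simps)
    ultimately show ?thesis by (simp add: poly_bracket_Var emb_simps)
  qed (use base ij in blast)
  have step: "?E (poly_bracket p (Var j)) = br (?E p) (?E (Var j))"
    if "j \<in> {V3, V4, V5, V6}" for p j
    by (rule der_along_emb_eqI[OF l(1,2)]) (use base' that Om in auto)
  have Om': "?E (poly_bracket q Omega1) = br (?E q) (?E Omega1)"
    "?E (poly_bracket q Omega2) = br (?E q) (?E Omega2)" for q
    using Om[of q] unfolding poly_bracket_antisym[of q] br_antisym[of "?E q"]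
    by (simp_all add: emb_simps)
  show ?thesis
    by (rule der_along_emb_eqI[OF l(3,4)[of p]]) (use step Om' in auto)
qed

lemma br_in_R0: "a \<in> R0 \<alpha> \<beta> \<Longrightarrow> b \<in> R0 \<alpha> \<beta> \<Longrightarrow> br a b \<in> R0 \<alpha> \<beta>"
  by (auto simp: R0_def simp flip: emb_bracket)

section \<open>Derivations of the embedded quotient\<close>

definition pder_on :: "'k::field_char_0 laurent set \<Rightarrow> ('k laurent \<Rightarrow> 'k laurent) \<Rightarrow> bool" where
  "pder_on R D \<longleftrightarrow> (\<forall>a\<in>R. D a \<in> R) \<and> (\<forall>a\<in>R. \<forall>b\<in>R. D (a + b) = D a + D b) \<and>
     (\<forall>c. \<forall>a\<in>R. D (sc c * a) = sc c * D a) \<and>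
     (\<forall>a\<in>R. \<forall>b\<in>R. D (a * b) = D a * b + a * D b) \<and>
     (\<forall>a\<in>R. \<forall>b\<in>R. D (br a b) = br (D a) b + br a (D b))"

lemma der_along_pder:
  assumes "pder_on (R0 \<alpha> \<beta>) D"
  shows "der_along (emb \<alpha> \<beta>) (\<lambda>p. D (emb \<alpha> \<beta> p))"
proof (rule der_alongI)
  show add: "D (emb \<alpha> \<beta> (p + q)) = D (emb \<alpha> \<beta> p) + D (emb \<alpha> \<beta> q)"
    and mult: "D (emb \<alpha> \<beta> (p * q)) = D (emb \<alpha> \<beta> p) * emb \<alpha> \<beta> q + emb \<alpha> \<beta> p * D (emb \<alpha> \<beta> q)"
    for p q using assms by (simp_all add: pder_on_def emb_simps)
  have "D (emb \<alpha> \<beta> 1) = 0" using mult[of 1 1] by (simp add: emb_simps)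
  moreover have "D (sc c * emb \<alpha> \<beta> 1) = sc c * D (emb \<alpha> \<beta> 1)" for c
    using assms by (simp add: pder_on_def)
  ultimately show "D (emb \<alpha> \<beta> (Const c)) = 0" for c by (simp add: emb_simps)
qed

lemma R0_generators:
  "tm T5 \<in> R0 \<alpha> \<beta>" "tm T6 \<in> R0 \<alpha> \<beta>" "xt3 \<in> R0 \<alpha> \<beta>" "xt4 \<in> R0 \<alpha> \<beta>" "xt \<alpha> \<beta> i \<in> R0 \<alpha> \<beta>"
  using emb_in_R0[of \<alpha> \<beta> X5] emb_in_R0[of \<alpha> \<beta> X6] emb_in_R0[of \<alpha> \<beta> X3] emb_in_R0[of \<alpha> \<beta> X4]
    emb_in_R0[of \<alpha> \<beta> "Var i"]
  by (simp_all add: emb_simps)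

lemma is_der_zeroI:
  assumes d: "is_der d" and 0: "d (tm T5) = 0" "d (tm T6) = 0" "d xt3 = 0" "d xt4 = 0"
  shows "d a = 0"
proof -
  note ds = is_der_simps[OF d] is_der_ti[OF d]
  have 4: "d (tm T4) = 0" using 0 by (simp add: xt4_def ds)
  have 3: "d (tm T3) = 0" using 0 4 by (simp add: xt3_def ds)
  have "is_der (\<lambda>a. 0)" by (rule is_derI) simp_all
  from is_der_eqI[OF d this] show ?thesis using 0 3 4 by (metis tvar.exhaust)
qed

lemma is_der_theta_sum:
  "is_der (\<lambda>a. e3 * theta T3 a + e4 * theta T4 a + e5 * theta T5 a + e6 * theta T6 a)"
  by (rule is_derI) (simp_all add: theta_simps algebra_simps)

text \<open>A derivation of the torus is a combination of Euler derivations whose coefficients are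
  read off from the Ti. Here only the values on X3, ..., X6 are at hand; but X4 is T4 plus a term in
  T5, T6, and X3 is T3 plus a term in T4, T5, T6, so the system for the coefficients is
  triangular.\<close>

lemma pder_extends:
  assumes D: "pder_on (R0 \<alpha> \<beta>) D"
  obtains e where "\<And>a. a \<in> R0 \<alpha> \<beta> \<Longrightarrow>
    D a = e T3 * theta T3 a + e T4 * theta T4 a + e T5 * theta T5 a + e T6 * theta T6 a"
proof -
  define e5 where "e5 = ti T5 * D (tm T5)"
  define e6 where "e6 = ti T6 * D (tm T6)"
  define r4 where "r4 = sc (2/3) * tm T5 ^ 3 * (ti T6 :: 'a laurent)"
  define r3 where "r3 = sc (3/2) * tm T4 * ti T5 + tm T5 ^ 2 * (ti T6 :: 'a laurent)"
  define e4 where "e4 = ti T4 * (D xt4 - (e5 * theta T5 r4 + e6 * theta T6 r4))"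
  define e3 where
    "e3 = ti T3 * (D xt3 - (e4 * theta T4 r3 + e5 * theta T5 r3 + e6 * theta T6 r3))"
  define E where
    "E a = e3 * theta T3 a + e4 * theta T4 a + e5 * theta T5 a + e6 * theta T6 a" for a
  have E: "is_der E" unfolding E_def by (rule is_der_theta_sum)
  note dt = is_der_ti[OF is_der_theta]
  have ti_tm: "ti i * a * tm i = a" for i and a :: "'a laurent"
    using tm_ti[of i] by (metis mult.commute mult.left_neutral mult.assoc)
  have 5: "E (tm T5) = D (tm T5)" "E (tm T6) = D (tm T6)"
    by (simp_all add: E_def theta_tm e5_def e6_def ti_tm)
  have x4: "xt4 = tm T4 + r4" and x3: "xt3 = tm T3 + r3"
    by (simp_all add: xt4_def xt3_def r4_def r3_def add.assoc)
  have "theta T3 r4 = 0" "theta T4 r4 = 0" "theta T3 r3 = 0"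
    by (simp_all add: r3_def r4_def theta_simps dt theta_tm)
  then have 34: "E xt4 = D xt4" "E xt3 = D xt3"
    by (simp_all only: E_def x4 x3 theta_simps theta_tm e4_def e3_def)
      (simp_all add: ti_tm)
  have "E (emb \<alpha> \<beta> p) = D (emb \<alpha> \<beta> p)" for p
  proof (rule der_along_emb_eqI[OF der_along_comp_emb[OF E] der_along_pder[OF D]])
    have "D (sc c) = 0" for c
      using der_along_Const[OF der_along_pder[OF D], of c] by (simp add: emb_simps)
    then show "E (emb \<alpha> \<beta> Omega1) = D (emb \<alpha> \<beta> Omega1)"
      "E (emb \<alpha> \<beta> Omega2) = D (emb \<alpha> \<beta> Omega2)"
      by (simp_all add: emb_Omega1 emb_Omega2 is_der_sc[OF E])
  qed (simp_all add: emb_simps 5 34)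
  then have *: "D a = E a" if "a \<in> R0 \<alpha> \<beta>" for a
    using that by (auto simp: R0_def)
  show thesis
    by (rule that[of "\<lambda>i. case i of T3 \<Rightarrow> e3 | T4 \<Rightarrow> e4 | T5 \<Rightarrow> e5 | T6 \<Rightarrow> e6"])
      (simp add: *, simp add: E_def)
qed

text \<open>The failure of \<open>E\<close> to respect the bracket is a derivation in each argument.
  It vanishes on the subring and therefore, one argument at a time, on the torus. At Ti and Tj it
  is, up to sign, Ti Tj times the difference of the two sides.\<close>

lemma pder_compatible:
  assumes D: "pder_on (R0 \<alpha> \<beta>) D"
    and e: "\<And>a. a \<in> R0 \<alpha> \<beta> \<Longrightarrow>
      D a = e T3 * theta T3 a + e T4 * theta T4 a + e T5 * theta T5 a + e T6 * theta T6 a"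
  shows "lder j (e i) = lder i (e j)"
proof -
  define E where
    "E a = e T3 * theta T3 a + e T4 * theta T4 a + e T5 * theta T5 a + e T6 * theta T6 a" for a
  have E: "is_der E" unfolding E_def by (rule is_der_theta_sum)
  note Es = is_der_simps[OF E]
  have DE: "D a = E a" if "a \<in> R0 \<alpha> \<beta>" for a using e that by (simp add: E_def)
  let ?d = "\<lambda>a b. E (br a b) - br (E a) b - br a (E b)"
  have d1: "is_der (\<lambda>a. ?d a b)" for b
    by (rule is_derI) (simp_all add: Es br_left_simps algebra_simps)
  have d2: "is_der (?d a)" for a
    by (rule is_derI) (simp_all add: Es br_simps algebra_simps)
  have 0: "?d a b = 0" if "a \<in> R0 \<alpha> \<beta>" "b \<in> R0 \<alpha> \<beta>" for a b
  proof -
    have "D (br a b) = br (D a) b + br a (D b)" using D that by (simp add: pder_on_def)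
    then show ?thesis using that br_in_R0[OF that] by (simp add: DE)
  qed
  have 1: "?d a b = 0" if "b \<in> R0 \<alpha> \<beta>" for a b
    by (rule is_der_zeroI[OF d1]; use that in \<open>rule 0[OF R0_generators(1)] 0[OF R0_generators(2)]
        0[OF R0_generators(3)] 0[OF R0_generators(4)]\<close>)
  have 2: "?d a b = 0" for a b
    by (rule is_der_zeroI[OF d2]) (rule 1, rule R0_generators)+
  have Etm: "E (tm l) = e l * tm l" for l by (cases l) (simp_all add: E_def theta_tm)
  have El: "E (lder j (tm i)) = e i * lder j (tm i)"
    by (cases i; cases j) (simp_all add: theta_tm Es Etm)
  have lm: "lder j (e i * tm i) = lder j (e i) * tm i + e i * lder j (tm i)"
    by (rule is_der_mult[OF is_der_lder])
  have "tm j * (e i * lder j (tm i)) =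
      br (e i * tm i) (tm j) + (br (tm i) (e j) * tm j) "
    using 2[of "tm i" "tm j"] by (simp add: br_tm Es Etm El br_simps algebra_simps)
  also have "br (tm i) (e j) = - (tm i * lder i (e j))"
    by (subst br_antisym) (simp add: br_tm)
  finally have "tm j * tm i * lder j (e i) = tm j * tm i * lder i (e j)"
    unfolding br_tm lm by Groebner_Basis.algebra
  then have "ti i * ti j * (tm j * tm i * lder j (e i)) = ti i * ti j * (tm j * tm i * lder i (e j))"
    by simp
  moreover have "ti i * ti j * (tm j * tm i * c) = (tm i * ti i) * (tm j * ti j) * c" for c :: "'a laurent"
    by (simp add: ac_simps)
  ultimately show ?thesis by (simp add: tm_ti)
qed

text \<open>\<open>- lder i\<close> is the logarithmic Hamiltonian derivation of the coordinate \<open>tm i\<close>, and the four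
  derivations below are those of \<open>f = tm T4 * tm T6\<close>, \<open>g = tm T3 * tm T5\<close>, \<open>tm T5\<close> and \<open>tm T6\<close>.\<close>

theorem pder_torus_form:
  assumes D: "pder_on (R0 \<alpha> \<beta>) D"
  obtains x \<rho> \<mu> \<nu> \<kappa> where "\<And>a. a \<in> R0 \<alpha> \<beta> \<Longrightarrow>
    D a = br x a - sc \<rho> * (lder T4 a + lder T6 a) - sc \<mu> * (lder T3 a + lder T5 a)
      - sc \<nu> * lder T5 a - sc \<kappa> * lder T6 a"
proof -
  obtain e where e: "\<And>a. a \<in> R0 \<alpha> \<beta> \<Longrightarrow>
      D a = e T3 * theta T3 a + e T4 * theta T4 a + e T5 * theta T5 a + e T6 * theta T6 a"
    using pder_extends[OF D] by blast
  obtain x where x: "\<And>i. e i = lder i x + sc (Poly_Mapping.lookup (e i) 0)"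
    using compatible_family[of e] pder_compatible[OF D e] by blast
  define c where "c i = Poly_Mapping.lookup (e i) 0" for i
  \<comment> \<open>These four values invert the linear system \<open>sol\<close>. It is solvable
    because the exponents of f, g, T5, T6 form a basis and the matrix of the q_ij is
    invertible.\<close>
  define \<nu> where "\<nu> = (c T3 + c T5 - c T4) / 2"
  define \<mu> where "\<mu> = (c T3 + c T6) / 2 - \<nu>"
  define \<kappa> where "\<kappa> = (\<mu> - c T5) / 3"
  define \<rho> where "\<rho> = (- c T3 - \<mu> - \<nu>) / 3"
  have sol: "c T3 = - 3 * \<rho> - \<mu> - \<nu>" "c T4 = - 3 * \<rho> - 3 * \<nu> - 3 * \<kappa>" "c T5 = \<mu> - 3 * \<kappa>"
    "c T6 = 3 * \<rho> + 3 * \<mu> + 3 * \<nu>"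
    by (simp_all add: \<rho>_def \<mu>_def \<nu>_def \<kappa>_def field_simps)
  show thesis
  proof (rule that)
    fix a assume a: "a \<in> R0 \<alpha> \<beta>"
    have "D a = br x a + sc (c T3) * theta T3 a + sc (c T4) * theta T4 a
        + sc (c T5) * theta T5 a + sc (c T6) * theta T6 a"
      unfolding e[OF a] c_def br_def by (subst (1 2 3 4) x) (simp add: algebra_simps)
    also have "\<dots> = br x a - sc \<rho> * (lder T4 a + lder T6 a) - sc \<mu> * (lder T3 a + lder T5 a)
        - sc \<nu> * lder T5 a - sc \<kappa> * lder T6 a"
      unfolding sol by (simp add: sc_simps algebra_simps)
    finally show "D a = \<dots>" .
  qed
qed

section \<open>Removing poles\<close>

text \<open>For \<open>s\<close> invertible in the torus this is the localization R0[1/s], realized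
  as a subset of the Laurent polynomials.\<close>

definition loc :: "'k::field_char_0 \<Rightarrow> 'k \<Rightarrow> 'k laurent \<Rightarrow> 'k laurent set" where
  "loc \<alpha> \<beta> s = {y. \<exists>n. s ^ n * y \<in> R0 \<alpha> \<beta>}"

lemma R0_add: "a \<in> R0 \<alpha> \<beta> \<Longrightarrow> b \<in> R0 \<alpha> \<beta> \<Longrightarrow> a + b \<in> R0 \<alpha> \<beta>"
  by (auto simp: R0_def simp flip: emb_simps)

lemma R0_mult: "a \<in> R0 \<alpha> \<beta> \<Longrightarrow> b \<in> R0 \<alpha> \<beta> \<Longrightarrow> a * b \<in> R0 \<alpha> \<beta>"
  by (auto simp: R0_def simp flip: emb_simps)

lemma R0_sc: "sc c \<in> R0 \<alpha> \<beta>"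
  using emb_in_R0[of \<alpha> \<beta> "Const c"] by (simp only: emb_simps)

lemma R0_power: "a \<in> R0 \<alpha> \<beta> \<Longrightarrow> a ^ n \<in> R0 \<alpha> \<beta>"
  using R0_sc[of 1 \<alpha> \<beta>] by (induction n) (simp_all add: R0_mult sc_simps)

lemma loc_mono: "a \<in> R0 \<alpha> \<beta> \<Longrightarrow> a \<in> loc \<alpha> \<beta> s"
  unfolding loc_def using power_0[of s] by (metis (mono_tags, lifting) mem_Collect_eq mult_1)

lemma loc_1: "loc \<alpha> \<beta> 1 = R0 \<alpha> \<beta>"
  by (simp add: loc_def)

definition br_subring :: "'k::field_char_0 \<Rightarrow> 'k \<Rightarrow> 'k laurent set \<Rightarrow> bool" where
  "br_subring \<alpha> \<beta> S \<longleftrightarrow> R0 \<alpha> \<beta> \<subseteq> S \<and> (\<forall>a\<in>S. \<forall>b\<in>S. a + b \<in> S \<and> a * b \<in> S) \<and>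
     (\<forall>a\<in>S. \<forall>b\<in>R0 \<alpha> \<beta>. br a b \<in> S)"

text \<open>Closure under brackets is the quotient rule s^(n+1) {a, b} = s {s^n a, b} - n s^n a {s,
  b}.\<close>

lemma br_subring_loc:
  assumes s: "s \<in> R0 \<alpha> \<beta>" and unit: "s * s' = 1"
  shows "br_subring \<alpha> \<beta> (loc \<alpha> \<beta> s)"
  unfolding br_subring_def
proof (intro conjI ballI subsetI)
  fix a b assume "a \<in> loc \<alpha> \<beta> s" "b \<in> loc \<alpha> \<beta> s"
  then obtain n m where nm: "s ^ n * a \<in> R0 \<alpha> \<beta>" "s ^ m * b \<in> R0 \<alpha> \<beta>" by (auto simp: loc_def)
  have "s ^ (n + m) * (a + b) = s ^ m * (s ^ n * a) + s ^ n * (s ^ m * b)"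
    by (simp add: power_add algebra_simps)
  then have "s ^ (n + m) * (a + b) \<in> R0 \<alpha> \<beta>"
    by (simp only:) (intro R0_add R0_mult R0_power nm s)
  then show "a + b \<in> loc \<alpha> \<beta> s" unfolding loc_def by blast
  have "s ^ (n + m) * (a * b) = (s ^ n * a) * (s ^ m * b)"
    by (simp add: power_add algebra_simps)
  then have "s ^ (n + m) * (a * b) \<in> R0 \<alpha> \<beta>"
    by (simp only:) (intro R0_mult nm)
  then show "a * b \<in> loc \<alpha> \<beta> s" unfolding loc_def by blast
next
  fix a b assume "a \<in> loc \<alpha> \<beta> s" and b: "b \<in> R0 \<alpha> \<beta>"
  then obtain n where n: "s ^ n * a \<in> R0 \<alpha> \<beta>" by (auto simp: loc_def)
  have pow: "s * br (s ^ n) b = of_nat n * s ^ n * br s b" for n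
    by (induction n) (simp_all add: br_left_simps algebra_simps)
  have "s ^ (n + 1) * br a b = s * br (s ^ n * a) b - (s * br (s ^ n) b) * a"
    by (simp add: br_left_simps algebra_simps)
  also have "\<dots> = s * br (s ^ n * a) b + sc (- of_nat n) * ((s ^ n * a) * br s b)"
    unfolding pow by (simp add: sc_simps ring_map_of_nat[OF ring_map_sc] algebra_simps)
  also have "\<dots> \<in> R0 \<alpha> \<beta>"
    by (intro R0_add R0_mult br_in_R0 R0_sc n s b)
  finally show "br a b \<in> loc \<alpha> \<beta> s" unfolding loc_def by blast
qed (rule loc_mono)

lemma loc_inverse:
  assumes "a \<in> R0 \<alpha> \<beta>" "a * b = s" "s * s' = 1" "b * b' = 1"
  shows "b' \<in> loc \<alpha> \<beta> s"
proof -
  have "s ^ 1 * b' = a" using assms by (metis mult.assoc mult.right_neutral power_one_right)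
  then show ?thesis unfolding loc_def using assms(1) by blast
qed

lemma loc_mult: "y \<in> loc \<alpha> \<beta> (s * t) \<Longrightarrow> \<exists>n. t ^ n * y \<in> loc \<alpha> \<beta> s"
  by (auto simp: loc_def power_mult_distrib mult.assoc)

text \<open>If 1/p lay in R0[1/q], a power of q would be a multiple of p modulo the relations; a
  point satisfying the relations with p = 0 and q nonzero refutes this.\<close>

lemma not_in_loc:
  assumes ab: "(\<alpha>, \<beta>) \<noteq> (0, 0)" and t: "emb \<alpha> \<beta> p * t' = 1"
    and r: "pt r Omega1 = \<alpha>" "pt r Omega2 = \<beta>" "pt r p = 0" "pt r q \<noteq> 0"
  shows "t' \<notin> loc \<alpha> \<beta> (emb \<alpha> \<beta> q)"
proof
  assume "t' \<in> loc \<alpha> \<beta> (emb \<alpha> \<beta> q)"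
  then obtain n u where "emb \<alpha> \<beta> q ^ n * t' = emb \<alpha> \<beta> u" by (auto simp: loc_def R0_def)
  then have "emb \<alpha> \<beta> q ^ n * (emb \<alpha> \<beta> p * t') = emb \<alpha> \<beta> u * emb \<alpha> \<beta> p" by (simp add: ac_simps)
  then have "emb \<alpha> \<beta> (q ^ n - u * p) = 0" unfolding t by (simp add: emb_simps)
  then have "q ^ n - u * p \<in> rels \<alpha> \<beta>" using emb_eq_0_iff[OF ab] by blast
  then obtain a b where "q ^ n - u * p = a * (Omega1 - Const \<alpha>) + b * (Omega2 - Const \<beta>)"
    by (auto simp: rels_def)
  from arg_cong[OF this, of "pt r"] show False using r by (simp add: pt_simps)
qed

text \<open>If \<open>x\<close> had a pole of order \<open>k > 0\<close> along \<open>t = 0\<close>, then \<open>br x y\<close> would have one of order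
  \<open>k + 1\<close>, because \<open>br t y\<close> is invertible modulo \<open>t\<close>; and a logarithmic term in \<open>t\<close> would
  contribute a pole of order \<open>1\<close>.\<close>

lemma pole_removal:
  fixes t :: "'k::field_char_0 laurent"
  assumes S: "br_subring \<alpha> \<beta> S" and t: "t \<in> R0 \<alpha> \<beta>" "t * t' = 1" and y: "y \<in> R0 \<alpha> \<beta>"
    and unit: "br t y * w + t * z = 1" "w \<in> S" "z \<in> S"
    and reg: "br x y + sc c * (t' * br t y) \<in> S"
    and x: "t ^ n * x \<in> S"
  shows "x \<in> S" and "t' \<notin> S \<Longrightarrow> c = 0"
proof -
  have R: "a \<in> S" if "a \<in> R0 \<alpha> \<beta>" for a using S that by (auto simp: br_subring_def)
  have add: "a + b \<in> S" and mult: "a * b \<in> S" if "a \<in> S" "b \<in> S" for a b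
    using S that by (auto simp: br_subring_def)
  have scS: "sc a \<in> S" for a by (rule R[OF R0_sc])
  have minus: "- a \<in> S" if "a \<in> S" for a
    using mult[OF scS[of "- 1"] that] by (simp add: sc_simps)
  have diff: "a - b \<in> S" if "a \<in> S" "b \<in> S" for a b using add[OF that(1) minus[OF that(2)]] by simp
  have pow: "t ^ k \<in> S" for k by (intro R R0_power t)
  have br: "br a y \<in> S" if "a \<in> S" for a using S y that by (auto simp: br_subring_def)
  let ?v = "br t y" and ?s = "br x y + sc c * (t' * br t y)"
  have bp: "br (t ^ Suc k) y = of_nat (Suc k) * t ^ k * ?v" for k
    by (induction k) (simp_all add: br_left_simps algebra_simps)
  have "t ^ n * x \<in> S \<longrightarrow> x \<in> S"
  proof (induction n)
    case (Suc k)
    have "x \<in> S" if a: "t ^ Suc k * x \<in> S"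
    proof -
      define tk where "tk = t ^ k"
      have tk: "t ^ Suc k = t * tk" by (simp add: tk_def)
      let ?a = "t * tk * x"
      \<comment> \<open>The factor k + 1 from differentiating t^(k+1) is invertible in
        characteristic zero.\<close>
      define N where "N = (of_nat (Suc k) :: 'k laurent)"
      have N: "N * sc (inverse (of_nat (Suc k))) = 1"
      proof -
        have "N = sc (of_nat (Suc k))" by (simp only: N_def ring_map_of_nat[OF ring_map_sc])
        then show ?thesis by (simp del: of_nat_Suc flip: sc_simps(1,3))
      qed
      have 1: "br ?a y = N * tk * ?v * x + t * tk * br x y"
        unfolding tk[symmetric] by (simp only: br_left_simps bp N_def tk_def)
      \<comment> \<open>With a = t^(k+1) x this reads (k+1) a {t, y} = t u, where u is in
        \<open>S\<close>: the factor t^(k+1) in front of the regular expression absorbs the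
        denominator of the logarithmic term. Since {t, y} is a unit modulo t, a is t times an
        element of \<open>S\<close>, and the pole order drops.\<close>
      have b: "N * (?a * ?v) = t * (br ?a y - t * tk * ?s + sc c * (tk * ?v))"
        unfolding 1 using t(2) by Groebner_Basis.algebra
      define u where "u = br ?a y - t * tk * ?s + sc c * (tk * ?v)"
      have aS: "?a \<in> S" and tkS: "t * tk \<in> S" "tk \<in> S"
        using a pow[of "Suc k"] pow[of k] by (simp_all only: tk) (simp add: tk_def)
      have uS: "u \<in> S" unfolding u_def
        by (intro add diff mult[OF tkS(1)] mult[OF scS] mult[OF tkS(2)] br aS reg
            R[OF br_in_R0[OF t(1) y]])
      have "?a = t * (sc (inverse (of_nat (Suc k))) * u * w + ?a * z)"
        using b[folded u_def] N unit(1) by Groebner_Basis.algebra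
      then have "tk * x = t' * t * (sc (inverse (of_nat (Suc k))) * u * w + ?a * z)"
        using t(2) by Groebner_Basis.algebra
      also have "t' * t = 1" using t(2) by (simp add: mult.commute)
      also have "1 * (sc (inverse (of_nat (Suc k))) * u * w + ?a * z) \<in> S"
        by (intro add mult R[OF R0_sc[of 1], unfolded sc_simps] scS uS aS unit)
      finally show ?thesis using Suc unfolding tk_def by blast
    qed
    then show ?case by blast
  qed simp
  then show xS: "x \<in> S" using x by blast
  show "c = 0" if t': "t' \<notin> S"
  proof (rule ccontr)
    assume c: "c \<noteq> 0"
    have 1: "sc (inverse c) * sc c = 1" using c by (simp flip: sc_simps)
    \<comment> \<open>Once x is regular, the logarithmic term c {t, y} / t is regular by itself, and
      {t, y} w = 1 - t z turns it into 1/t.\<close>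
    define u where "u = ?s - br x y"
    have "u \<in> S" unfolding u_def by (intro diff reg br xS)
    moreover have "t' = sc (inverse c) * u * w + z"
      using unit(1) t(2) 1 unfolding u_def by Groebner_Basis.algebra
    ultimately have "t' \<in> S" using unit by (metis add mult scS)
    then show False using t' by blast
  qed
qed

text \<open>Inverting f, g, T5 and T6 already gives the whole torus, because T4 = f / T6 and T3 = g
  / T5. Hence poles can occur along these four only.\<close>

lemma laurent_loc:
  fixes a :: "'k::field_char_0 laurent"
  shows "a \<in> loc \<alpha> \<beta> ((tm T4 * tm T6) * (tm T3 * tm T5) * tm T5 * tm T6)"
proof -
  let ?f = "tm T4 * tm T6 :: 'k laurent" and ?g = "tm T3 * tm T5 :: 'k laurent"
  let ?s = "?f * ?g * tm T5 * tm T6"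
  have f: "?f \<in> R0 \<alpha> \<beta>" and g: "?g \<in> R0 \<alpha> \<beta>"
    by (simp_all flip: emb_rel_f[of \<alpha> \<beta>] emb_rel_g[of \<alpha> \<beta>])
  have "?s * (ti T4 * ti T6 * (ti T3 * ti T5) * ti T5 * ti T6) =
      (tm T4 * ti T4) * (tm T6 * ti T6) ^ 2 * (tm T3 * ti T3) * (tm T5 * ti T5) ^ 2"
    by (simp add: power2_eq_square ac_simps)
  then have unit: "?s * (ti T4 * ti T6 * (ti T3 * ti T5) * ti T5 * ti T6) = 1"
    by (simp add: tm_ti)
  have s: "?s \<in> R0 \<alpha> \<beta>" by (intro R0_mult f g R0_generators)
  have "br_subring \<alpha> \<beta> (loc \<alpha> \<beta> ?s)" by (rule br_subring_loc[OF s unit])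
  then have add: "a + b \<in> loc \<alpha> \<beta> ?s" and mult: "a * b \<in> loc \<alpha> \<beta> ?s"
    if "a \<in> loc \<alpha> \<beta> ?s" "b \<in> loc \<alpha> \<beta> ?s" for a b
    using that by (auto simp: br_subring_def)
  note gens = R0_generators[of \<alpha> \<beta>]
  have i6: "ti T6 \<in> loc \<alpha> \<beta> ?s"
    by (rule loc_inverse[OF _ _ unit tm_ti, of "?f * ?g * tm T5"]) (intro R0_mult f g gens, simp)
  have i5: "ti T5 \<in> loc \<alpha> \<beta> ?s"
    by (rule loc_inverse[OF _ _ unit tm_ti, of "?f * ?g * tm T6"])
      (intro R0_mult f g gens, simp add: ac_simps)
  have iff: "ti T4 * ti T6 \<in> loc \<alpha> \<beta> ?s"
    by (rule loc_inverse[OF _ _ unit, of "?g * tm T5 * tm T6" _ _ ?f])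
      (intro R0_mult f g gens, simp add: ac_simps,
        simp add: tm_ti mult.assoc mult.left_commute[of "tm T6"])
  have ig: "ti T3 * ti T5 \<in> loc \<alpha> \<beta> ?s"
    by (rule loc_inverse[OF _ _ unit, of "?f * tm T5 * tm T6" _ _ ?g])
      (intro R0_mult f g gens, simp add: ac_simps,
        simp add: tm_ti mult.assoc mult.left_commute[of "tm T5"])
  have c: "ti i * tm i = (1 :: 'k laurent)" for i
    using tm_ti[of i] by (simp add: mult.commute)
  have "ti T4 = (ti T4 * ti T6) * (tm T6 :: 'k laurent)"
    "ti T3 = (ti T3 * ti T5) * (tm T5 :: 'k laurent)"
    "tm T4 = ?f * ti T6" "tm T3 = ?g * ti T5"
    using c by (simp_all add: mult.assoc tm_ti)
  then have "ti T4 \<in> loc \<alpha> \<beta> ?s" "ti T3 \<in> loc \<alpha> \<beta> ?s" "tm T4 \<in> loc \<alpha> \<beta> ?s" "tm T3 \<in> loc \<alpha> \<beta> ?s"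
    using mult i5 i6 iff ig f g gens by (metis loc_mono)+
  then have "ti i \<in> loc \<alpha> \<beta> ?s" "tm i \<in> loc \<alpha> \<beta> ?s" for i
    using i5 i6 gens by (cases i; simp add: loc_mono)+
  then show ?thesis
    by (induction a rule: laurent_gen_induct) (simp_all add: loc_mono R0_sc add mult)
qed

section \<open>Logarithmic terms, and poles along T6 and T5\<close>

lemma br_tm_left: "br (tm i) a = - (tm i * lder i a)"
  by (subst br_antisym) (simp add: br_tm)

lemma log_monomial:
  "(ti i * ti j) * br (tm i * tm j) a = - (lder i a + lder j a)"
proof -
  have "(ti i * ti j) * br (tm i * tm j) a =
      - ((tm i * ti i) * (tm j * ti j) * (lder i a + lder j a))"
    by (simp add: br_left_simps br_tm_left algebra_simps)
  then show ?thesis by (simp add: tm_ti)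
qed

lemma log_tm: "ti i * br (tm i) a = - lder i a"
proof -
  have "ti i * br (tm i) a = - ((tm i * ti i) * lder i a)"
    by (simp add: br_tm_left algebra_simps)
  then show ?thesis by (simp add: tm_ti)
qed

lemma inverse_pair: "(tm i * tm j) * (ti i * ti j) = (1 :: 'k::comm_ring_1 laurent)"
proof -
  have "(tm i * tm j) * (ti i * ti j) = (tm i * ti i) * (tm j * ti j :: 'k laurent)"
    by (simp add: ac_simps)
  then show ?thesis by (simp add: tm_ti)
qed

lemma inverse_mult: "a * a' = 1 \<Longrightarrow> b * b' = 1 \<Longrightarrow> (a * b) * (a' * b') = (1::'a::comm_ring_1)"
  by (metis mult.assoc mult.left_commute mult_1_right)

text \<open>Points are found by choosing X3, ..., X6 and solving the two relations for X2 and X1;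
  \<open>g\<close> names the value of the coefficient of X1.\<close>

lemma relation_point:
  assumes "g = r V3 * r V5 - 3/2 * r V4"
    "g * r V1 = \<alpha> + 1/2 * r V2 * r V5 - 1/2 * r V3 ^ 2"
    "r V2 * (r V4 * r V6 - 2/3 * r V5 ^ 3) = \<beta> + 2/3 * r V3 ^ 3 * r V6
      - 2 * r V3 ^ 2 * r V5 ^ 2 + 3 * r V3 * r V4 * r V5 - 3/2 * r V4 ^ 2"
  shows "pt r Omega1 = \<alpha>" "pt r Omega2 = \<beta>"
proof -
  have "pt r rel_g = g" by (simp add: rel_g_def pt_simps assms(1))
  then show "pt r Omega1 = \<alpha>" by (simp add: Omega1_alt pt_simps assms(2))
  show "pt r Omega2 = \<beta>"
    using assms(3) by (simp add: Omega2_alt rel_f_def rel_h_def pt_simps algebra_simps)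
qed

text \<open>X3 is the test element for both poles. {X6, X3} = -6 X5^2 is a unit as long as X5 is
  inverted, so T6 is treated before T5.\<close>

lemma pder_inner_away_from_fg:
  fixes \<alpha> \<beta> :: "'k::field_char_0"
  assumes ab: "(\<alpha>, \<beta>) \<noteq> (0, 0)" and D: "pder_on (R0 \<alpha> \<beta>) D"
  obtains x \<rho> \<mu> where "x \<in> loc \<alpha> \<beta> ((tm T4 * tm T6) * (tm T3 * tm T5))"
    "\<And>a. a \<in> R0 \<alpha> \<beta> \<Longrightarrow>
      D a = br x a - sc \<rho> * (lder T4 a + lder T6 a) - sc \<mu> * (lder T3 a + lder T5 a)"
proof -
  let ?f = "tm T4 * tm T6 :: 'k laurent" and ?g = "tm T3 * tm T5 :: 'k laurent"
  let ?f' = "ti T4 * ti T6 :: 'k laurent" and ?g' = "ti T3 * ti T5 :: 'k laurent"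
  have f: "?f \<in> R0 \<alpha> \<beta>" and g: "?g \<in> R0 \<alpha> \<beta>"
    by (simp_all flip: emb_rel_f[of \<alpha> \<beta>] emb_rel_g[of \<alpha> \<beta>])
  note gens = R0_generators[of \<alpha> \<beta>]
  have ff': "?f * ?f' = 1" and gg': "?g * ?g' = 1" by (rule inverse_pair)+
  note fg' = inverse_mult[OF ff' gg']
  note fg5' = inverse_mult[OF fg' tm_ti[of T5]]
  obtain x \<rho> \<mu> \<nu> \<kappa> where Dx: "\<And>a. a \<in> R0 \<alpha> \<beta> \<Longrightarrow>
      D a = br x a - sc \<rho> * (lder T4 a + lder T6 a) - sc \<mu> * (lder T3 a + lder T5 a)
        - sc \<nu> * lder T5 a - sc \<kappa> * lder T6 a"
    using pder_torus_form[OF D] by blast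
  have D3: "D xt3 \<in> R0 \<alpha> \<beta>" using D gens by (simp add: pder_on_def)
  have fg: "?f * ?g \<in> R0 \<alpha> \<beta>" and fg5: "?f * ?g * tm T5 \<in> R0 \<alpha> \<beta>"
    by (intro R0_mult f g gens)+

  define S where "S = loc \<alpha> \<beta> (?f * ?g * tm T5)"
  have S: "br_subring \<alpha> \<beta> S" unfolding S_def by (rule br_subring_loc[OF fg5 fg5'])
  have R: "a \<in> S" if "a \<in> R0 \<alpha> \<beta>" for a using S that by (auto simp: br_subring_def)
  have add: "a + b \<in> S" and mult: "a * b \<in> S" if "a \<in> S" "b \<in> S" for a b
    using S that by (auto simp: br_subring_def)
  have i5: "ti T5 \<in> S" unfolding S_def
    by (rule loc_inverse[OF fg _ fg5' tm_ti]) simp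
  have iff: "?f' \<in> S" unfolding S_def
    by (rule loc_inverse[OF R0_mult[OF g gens(1)] _ fg5' ff']) (simp add: ac_simps)
  have ig: "?g' \<in> S" unfolding S_def
    by (rule loc_inverse[OF R0_mult[OF f gens(1)] _ fg5' gg']) (simp add: ac_simps)
  \<comment> \<open>\<open>D xt3\<close> is regular, and the logarithmic terms of f, g and T5 are
    regular where these are inverted; only the term of T6 stays on the left.\<close>
  have "br x xt3 + sc \<kappa> * (ti T6 * br (tm T6) xt3) =
      D xt3 + sc (- \<rho>) * (?f' * br ?f xt3) + sc (- \<mu>) * (?g' * br ?g xt3)
        + sc (- \<nu>) * (ti T5 * br (tm T5) xt3)"
    unfolding log_tm log_monomial Dx[OF gens(3)] by (simp add: sc_simps algebra_simps)
  also have "\<dots> \<in> S"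
    by (intro add mult iff ig i5 R[OF D3] R[OF R0_sc] R[OF br_in_R0] f g gens)
  finally have reg: "br x xt3 + sc \<kappa> * (ti T6 * br (tm T6) xt3) \<in> S" .
  have sixth: "sc (1/6) * 6 = (1 :: 'k laurent)" by (simp flip: sc_simps)
  have unit: "br (tm T6) xt3 * (sc (- (1/6)) * (ti T5 * ti T5)) + tm T6 * 0 = (1 :: 'k laurent)"
    unfolding br_xt34 sc_simps using tm_ti[of T5, where ?'a='k] sixth
    by Groebner_Basis.algebra
  obtain n where n: "tm T6 ^ n * x \<in> S"
    unfolding S_def using laurent_loc loc_mult by blast
  have wS: "sc (- (1/6)) * (ti T5 * ti T5) \<in> S" and 0: "0 \<in> S"
    using R[OF R0_sc[of 0]] by (auto intro: mult[OF R[OF R0_sc] mult[OF i5 i5]] simp: sc_simps(4))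
  note P = pole_removal[OF S gens(2) tm_ti gens(3) unit wS 0 reg n]
  have "ti T6 \<notin> S"
  proof -
    \<comment> \<open>A point on X6 = 0 where X5, f and g do not vanish: X3 = X5 = 1 and X4 = 0 give
      g = 1 and f = -2/3, and the relations then determine X2 and X1.\<close>
    let ?r = "\<lambda>i. case i of V1 \<Rightarrow> \<alpha> - 3/4 * (\<beta> - 2) - 1/2 | V2 \<Rightarrow> - (3/2) * (\<beta> - 2) | V3 \<Rightarrow> 1
      | V4 \<Rightarrow> 0 | V5 \<Rightarrow> 1 | V6 \<Rightarrow> 0"
    have p: "pt ?r Omega1 = \<alpha>" "pt ?r Omega2 = \<beta>"
      by (rule relation_point[of 1]; simp add: field_simps)+
    have e: "?f * ?g * tm T5 = emb \<alpha> \<beta> (rel_f * rel_g * X5)"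
      by (simp add: emb_simps emb_rel_f emb_rel_g)
    show ?thesis
      unfolding S_def e
      by (rule not_in_loc[OF ab _ p, of X6])
        (simp_all add: emb_simps tm_ti pt_simps rel_f_def rel_g_def)
  qed
  then have \<kappa>: "\<kappa> = 0" and xS: "x \<in> loc \<alpha> \<beta> (?f * ?g * tm T5)" using P by (auto simp: S_def)

  define S' where "S' = loc \<alpha> \<beta> (?f * ?g)"
  have S': "br_subring \<alpha> \<beta> S'" unfolding S'_def by (rule br_subring_loc[OF fg fg'])
  have R': "a \<in> S'" if "a \<in> R0 \<alpha> \<beta>" for a using S' that by (auto simp: br_subring_def)
  have add': "a + b \<in> S'" and mult': "a * b \<in> S'" if "a \<in> S'" "b \<in> S'" for a b
    using S' that by (auto simp: br_subring_def)
  have iff': "?f' \<in> S'" unfolding S'_def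
    by (rule loc_inverse[OF g _ fg' ff']) (simp add: ac_simps)
  have ig': "?g' \<in> S'" unfolding S'_def
    by (rule loc_inverse[OF f _ fg' gg']) (simp add: ac_simps)
  have "br x xt3 + sc \<nu> * (ti T5 * br (tm T5) xt3) =
      D xt3 + sc (- \<rho>) * (?f' * br ?f xt3) + sc (- \<mu>) * (?g' * br ?g xt3)"
    unfolding log_tm log_monomial Dx[OF gens(3)] \<kappa> by (simp add: sc_simps algebra_simps)
  also have "\<dots> \<in> S'"
    by (intro add' mult' iff' ig' R'[OF D3] R'[OF R0_sc] R'[OF br_in_R0] f g gens)
  finally have reg': "br x xt3 + sc \<nu> * (ti T5 * br (tm T5) xt3) \<in> S'" .
  have x46: "xt4 * tm T6 = ?f + sc (2/3) * tm T5 ^ 3"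
    using emb_rel_f[of \<alpha> \<beta>] by (simp add: rel_f_def emb_simps algebra_simps)
  \<comment> \<open>{X5, X3} = -X3 X5 - 3 X4, and X4 X6 = f + (2/3) X5^3 shows that X4 is invertible
    modulo X5 once f is inverted.\<close>
  have unit': "br (tm T5) xt3 * (sc (1/3) * tm T6 * (- 1 * ?f'))
      + tm T5 * ((sc (1/3) * xt3 * tm T6 + sc (2/3) * tm T5 ^ 2) * (- 1 * ?f')) = 1"
    unfolding br_xt34 sc_2_3 using x46[unfolded sc_2_3] ff' sc_1_3[where ?'k='k]
    by Groebner_Basis.algebra
  have m1: "- 1 \<in> R0 \<alpha> \<beta>" using R0_sc[of "- 1"] by (simp add: sc_simps)
  have w': "sc (1/3) * tm T6 * (- 1 * ?f') \<in> S'"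
    "(sc (1/3) * xt3 * tm T6 + sc (2/3) * tm T5 ^ 2) * (- 1 * ?f') \<in> S'"
    by (intro add' mult' iff' R' R0_sc R0_power m1 gens)+
  obtain n' where n': "tm T5 ^ n' * x \<in> S'"
    unfolding S'_def using xS loc_mult by blast
  note P' = pole_removal[OF S' gens(1) tm_ti gens(3) unit' w' reg' n']
  have "ti T5 \<notin> S'"
  proof -
    \<comment> \<open>A point on X5 = 0 with f = 1 and g = -3/2; X2 and X1 again follow from the
      relations.\<close>
    let ?r = "\<lambda>i. case i of V1 \<Rightarrow> - (2/3) * \<alpha> | V2 \<Rightarrow> \<beta> - 3/2 | V3 \<Rightarrow> 0
      | V4 \<Rightarrow> 1 | V5 \<Rightarrow> 0 | V6 \<Rightarrow> 1"
    have p: "pt ?r Omega1 = \<alpha>" "pt ?r Omega2 = \<beta>"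
      by (rule relation_point[of "- 3/2"]; simp add: field_simps)+
    have e: "?f * ?g = emb \<alpha> \<beta> (rel_f * rel_g)"
      by (simp add: emb_simps emb_rel_f emb_rel_g)
    show ?thesis
      unfolding S'_def e
      by (rule not_in_loc[OF ab _ p, of X5])
        (simp_all add: emb_simps tm_ti pt_simps rel_f_def rel_g_def)
  qed
  then have \<nu>: "\<nu> = 0" and xS': "x \<in> loc \<alpha> \<beta> (?f * ?g)" using P' by (auto simp: S'_def)
  show thesis
    by (rule that[OF xS', of \<rho> \<mu>]) (simp add: Dx \<kappa> \<nu> sc_simps)
qed

section \<open>Poles along f and g\<close>

lemma loc_subset:
  assumes a: "a \<in> R0 \<alpha> \<beta>" and s: "s * a = sc c * t ^ k" and c: "c \<noteq> 0"
  shows "loc \<alpha> \<beta> s \<subseteq> loc \<alpha> \<beta> t"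
proof
  fix x assume "x \<in> loc \<alpha> \<beta> s"
  then obtain n where n: "s ^ n * x \<in> R0 \<alpha> \<beta>" by (auto simp: loc_def)
  have "sc (inverse c ^ n) * (a ^ n * (s ^ n * x)) \<in> R0 \<alpha> \<beta>"
    by (rule R0_mult[OF R0_sc R0_mult[OF R0_power[OF a] n]])
  also have "sc (inverse c ^ n) * (a ^ n * (s ^ n * x)) = sc (inverse c ^ n) * ((s * a) ^ n * x)"
    by (simp add: power_mult_distrib ac_simps)
  also have "\<dots> = sc (inverse c ^ n * c ^ n) * (t ^ (k * n) * x)"
    unfolding s by (simp add: power_mult_distrib power_mult sc_simps ac_simps)
  also have "inverse c ^ n * c ^ n = 1" using c by (simp flip: power_mult_distrib)
  finally have "t ^ (k * n) * x \<in> R0 \<alpha> \<beta>" by (simp add: sc_simps)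
  then show "x \<in> loc \<alpha> \<beta> t" unfolding loc_def by blast
qed

text \<open>Replace X4 X6 by f + (2/3) X5^3 in X4 Omega2: the terms without a factor f add up to the
  perfect cube -(4/9) g^3.\<close>

lemma rel_g_cube:
  "rel_g ^ 3 * 4 = 9 * rel_f * (X2 * X4 - Const (2/3) * X3 ^ 3)
     - 9 * Omega2 * (X4 :: 'k::field_char_0 poly6)"
  unfolding rel_g_def rel_f_def Omega2_def Const_3_2 Const_2_3
  using Const_1_2[where ?'k='k] Const_1_3[where ?'k='k] by Groebner_Basis.algebra

text \<open>At g = 0, that is X4 = (2/3) X3 X5, Omega1 becomes -(1/2)(X2 X5 - X3^2) and Omega2
  becomes (2/3)(X2 X5 - X3^2)(X3 X6 - X5^2). The right-hand side is the combination in which these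
  cancel, so g divides it; for alpha = 0 it is the constant (3/2) beta.\<close>

lemma rel_g_unit:
  "rel_g * (rel_g + X3 * X5 - X2 * X6 + 2 * X1 * (X3 * X6 - X5 ^ 2)) =
     Const (3/2) * Omega2 + 2 * Omega1 * (X3 * X6 - X5 ^ 2 :: 'k::field_char_0 poly6)"
  unfolding rel_g_def Omega1_def Omega2_def Const_3_2 Const_2_3
  using Const_1_2[where ?'k='k] Const_1_3[where ?'k='k] by Groebner_Basis.algebra

lemma loc_fg_subset:
  "loc \<alpha> 0 ((tm T4 * tm T6) * (tm T3 * tm T5)) \<subseteq> loc \<alpha> 0 (tm T3 * tm T5 :: 'k::field_char_0 laurent)"
proof (rule loc_subset)
  let ?F = "X2 * X4 - Const (2/3) * X3 ^ 3 :: 'k poly6"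
  show "emb \<alpha> 0 ?F \<in> R0 \<alpha> 0" by simp
  have "emb \<alpha> 0 (rel_g ^ 3 * 4) = emb \<alpha> 0 (9 * rel_f * ?F - 9 * Omega2 * X4)"
    unfolding rel_g_cube by simp
  then have cube: "(tm T3 * tm T5) ^ 3 * 4 = 9 * (tm T4 * tm T6) * emb \<alpha> 0 ?F"
    by (simp only: ring_map_simps[OF ring_map_emb] emb_rel_f emb_rel_g emb_Omega2 sc_simps) simp
  have n: "sc (1/9) * 9 = (1 :: 'k laurent)" "sc (4/9) = (sc (1/9) * 4 :: 'k laurent)"
    by (simp_all flip: sc_simps)
  have "tm T4 * tm T6 * (tm T3 * tm T5) * emb \<alpha> 0 ?F =
      (sc (1/9) * 9) * (tm T4 * tm T6 * emb \<alpha> 0 ?F) * (tm T3 * tm T5)"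
    unfolding n by (simp add: ac_simps)
  also have "\<dots> = sc (1/9) * (9 * (tm T4 * tm T6) * emb \<alpha> 0 ?F) * (tm T3 * tm T5)"
    by (simp only: mult.assoc)
  also have "\<dots> = sc (4/9) * (tm T3 * tm T5) ^ 4"
    unfolding cube[symmetric] n(2) by (simp add: eval_nat_numeral ac_simps)
  finally show "(tm T4 * tm T6) * (tm T3 * tm T5) * emb \<alpha> 0 ?F = sc (4/9) * (tm T3 * tm T5) ^ 4" .
qed simp

lemma loc_g_subset:
  assumes "\<beta> \<noteq> 0"
  shows "loc 0 \<beta> (tm T3 * tm T5 :: 'k::field_char_0 laurent) \<subseteq> R0 0 \<beta>"
proof -
  let ?u = "rel_g + X3 * X5 - X2 * X6 + 2 * X1 * (X3 * X6 - X5 ^ 2) :: 'k poly6"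
  have "emb 0 \<beta> rel_g * emb 0 \<beta> ?u =
      emb 0 \<beta> (Const (3/2) * Omega2 + 2 * Omega1 * (X3 * X6 - X5 ^ 2))"
    unfolding rel_g_unit[symmetric] by (simp only: ring_map_simps[OF ring_map_emb])
  also have "\<dots> = sc (3/2 * \<beta>) * 1 ^ 1"
    by (simp only: ring_map_simps[OF ring_map_emb] emb_Const emb_Omega1 emb_Omega2)
      (simp add: ring_map_0[OF ring_map_sc] ring_map_mult[OF ring_map_sc, symmetric])
  finally show ?thesis
    unfolding emb_rel_g loc_1[symmetric] by (rule loc_subset[rotated]) (use assms in simp_all)
qed

lemma bracket_f_X2: "poly_bracket rel_f X2 = - 6 * (rel_h :: 'k::field_char_0 poly6)"
  unfolding rel_f_def rel_h_def Const_3_2 Const_2_3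
  using Const_1_2[where ?'k='k] Const_1_3[where ?'k='k]
  by (simp add: poly_bracket_left_simps poly_bracket_Var) Groebner_Basis.algebra

lemma bracket_g_X1: "poly_bracket rel_g X1 = X3 ^ 2 - X2 * (X5 :: 'k::field_char_0 poly6)"
  unfolding rel_g_def Const_3_2
  using Const_1_2[where ?'k='k] Const_1_3[where ?'k='k]
  by (simp add: poly_bracket_left_simps poly_bracket_Var) Groebner_Basis.algebra

text \<open>The argument runs over R0[1/g], where the logarithmic term of g is regular and only the
  one of f remains.\<close>

lemma no_pole_along_f:
  fixes \<alpha> \<beta> :: "'k::field_char_0"
  assumes \<beta>: "\<beta> \<noteq> 0" and D: "pder_on (R0 \<alpha> \<beta>) D"
    and x: "x \<in> loc \<alpha> \<beta> ((tm T4 * tm T6) * (tm T3 * tm T5))"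
    and Dx: "\<And>a. a \<in> R0 \<alpha> \<beta> \<Longrightarrow>
      D a = br x a - sc \<rho> * (lder T4 a + lder T6 a) - sc \<mu> * (lder T3 a + lder T5 a)"
  shows "x \<in> loc \<alpha> \<beta> (tm T3 * tm T5)" and "\<rho> = 0"
proof -
  let ?f = "tm T4 * tm T6 :: 'k laurent" and ?g = "tm T3 * tm T5 :: 'k laurent"
  let ?f' = "ti T4 * ti T6 :: 'k laurent" and ?g' = "ti T3 * ti T5 :: 'k laurent"
  have f: "?f \<in> R0 \<alpha> \<beta>" and g: "?g \<in> R0 \<alpha> \<beta>"
    by (simp_all flip: emb_rel_f[of \<alpha> \<beta>] emb_rel_g[of \<alpha> \<beta>])
  have X2: "xt2 \<beta> \<in> R0 \<alpha> \<beta>" using R0_generators(5)[of \<alpha> \<beta> V2] by simp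
  define S where "S = loc \<alpha> \<beta> ?g"
  have S: "br_subring \<alpha> \<beta> S" unfolding S_def by (rule br_subring_loc[OF g inverse_pair])
  have R: "a \<in> S" if "a \<in> R0 \<alpha> \<beta>" for a using S that by (auto simp: br_subring_def)
  have add: "a + b \<in> S" and mult: "a * b \<in> S" if "a \<in> S" "b \<in> S" for a b
    using S that by (auto simp: br_subring_def)
  have ig: "?g' \<in> S" unfolding S_def
    by (rule loc_inverse[OF _ _ inverse_pair inverse_pair, of 1])
      (use R0_sc[of 1] in \<open>simp_all add: sc_simps\<close>)
  have D2: "D (xt2 \<beta>) \<in> R0 \<alpha> \<beta>" using D X2 by (simp add: pder_on_def)
  have "br x (xt2 \<beta>) + sc \<rho> * (?f' * br ?f (xt2 \<beta>)) =
      D (xt2 \<beta>) + sc (- \<mu>) * (?g' * br ?g (xt2 \<beta>))"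
    unfolding log_monomial Dx[OF X2] by (simp add: sc_simps algebra_simps)
  also have "\<dots> \<in> S"
    by (intro add mult ig R[OF D2] R[OF R0_sc] R[OF br_in_R0] g X2)
  finally have reg: "br x (xt2 \<beta>) + sc \<rho> * (?f' * br ?f (xt2 \<beta>)) \<in> S" .
  have h: "emb \<alpha> \<beta> rel_h = ?f * xt2 \<beta> - sc \<beta>"
    using emb_Omega2[of \<alpha> \<beta>]
    by (simp add: Omega2_alt ring_map_simps[OF ring_map_emb] emb_rel_f emb_Var algebra_simps)
  have v: "br ?f (xt2 \<beta>) = 6 * sc \<beta> - 6 * ?f * xt2 \<beta>"
    using emb_bracket[of \<alpha> \<beta> rel_f X2]
    by (simp add: bracket_f_X2 ring_map_simps[OF ring_map_emb] emb_rel_f emb_Var h algebra_simps)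
  have i: "sc (inverse (6 * \<beta>)) * (6 * sc \<beta>) = 1" using \<beta> by (simp flip: sc_simps)
  have unit: "br ?f (xt2 \<beta>) * sc (inverse (6 * \<beta>))
      + ?f * (sc 6 * xt2 \<beta> * sc (inverse (6 * \<beta>))) = 1"
    unfolding v ring_map_numeral[OF ring_map_sc] using i by Groebner_Basis.algebra
  obtain n where n: "?f ^ n * x \<in> S"
    unfolding S_def using x loc_mult[of x \<alpha> \<beta> ?g ?f] by (auto simp: mult.commute)
  have z: "sc 6 * xt2 \<beta> * sc (inverse (6 * \<beta>)) \<in> S" by (intro mult R R0_sc X2)
  note P = pole_removal[OF S f inverse_pair X2 unit R[OF R0_sc] z reg n]
  have "?f' \<notin> S"
  proof -
    \<comment> \<open>A point with f = 0 and g = 1. By \<open>rel_g_cube\<close>, f = 0 forces 4 g^3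
      = -9 beta X4, which fixes X4. With X5 = 1, the equations f = 0 and g = 1 fix X6 and X3. X2 can
      be chosen as 0, and the first relation gives X1.\<close>
    let ?r = "\<lambda>i. case i of V1 \<Rightarrow> \<alpha> - 1/2 * (1 - 2 / (3 * \<beta>)) ^ 2 | V2 \<Rightarrow> 0
      | V3 \<Rightarrow> 1 - 2 / (3 * \<beta>) | V4 \<Rightarrow> - 4 / (9 * \<beta>) | V5 \<Rightarrow> 1 | V6 \<Rightarrow> - 3/2 * \<beta>"
    have p: "pt ?r Omega1 = \<alpha>" "pt ?r Omega2 = \<beta>"
      using \<beta> by (rule_tac [!] relation_point[of 1]; simp add: field_simps power2_eq_square power3_eq_cube)+
    have ab: "(\<alpha>, \<beta>) \<noteq> (0, 0)" using \<beta> by simp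
    have t: "emb \<alpha> \<beta> rel_f * ?f' = 1" unfolding emb_rel_f by (rule inverse_pair)
    show ?thesis
      unfolding S_def emb_rel_g[of \<alpha> \<beta>, symmetric]
      by (rule not_in_loc[OF ab t p])
        (use \<beta> in \<open>simp_all add: pt_simps rel_f_def rel_g_def field_simps\<close>)
  qed
  then show "\<rho> = 0" using P by blast
  show "x \<in> loc \<alpha> \<beta> (tm T3 * tm T5)" using P by (simp add: S_def)
qed

text \<open>Only regularity of the value at X1 is assumed, so that the lemma also applies after a
  multiple of a weight derivation has been subtracted.\<close>

lemma no_pole_along_g:
  fixes \<alpha> \<beta> :: "'k::field_char_0"
  assumes \<alpha>: "\<alpha> \<noteq> 0" and x: "x \<in> loc \<alpha> \<beta> (tm T3 * tm T5)"
    and reg: "br x (xt1 \<alpha> \<beta>) - sc \<mu> * (lder T3 (xt1 \<alpha> \<beta>) + lder T5 (xt1 \<alpha> \<beta>)) \<in> R0 \<alpha> \<beta>"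
  shows "x \<in> R0 \<alpha> \<beta>" and "\<mu> = 0"
proof -
  let ?g = "tm T3 * tm T5 :: 'k laurent" and ?g' = "ti T3 * ti T5 :: 'k laurent"
  have g: "?g \<in> R0 \<alpha> \<beta>" by (simp flip: emb_rel_g[of \<alpha> \<beta>])
  have X1: "xt1 \<alpha> \<beta> \<in> R0 \<alpha> \<beta>" using R0_generators(5)[of \<alpha> \<beta> V1] by simp
  have S: "br_subring \<alpha> \<beta> (R0 \<alpha> \<beta>)"
    using br_subring_loc[of 1 \<alpha> \<beta> 1] R0_sc[of 1 \<alpha> \<beta>] by (simp add: loc_1 sc_simps)
  have reg': "br x (xt1 \<alpha> \<beta>) + sc \<mu> * (?g' * br ?g (xt1 \<alpha> \<beta>)) \<in> R0 \<alpha> \<beta>"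
    using reg unfolding log_monomial by (simp only: mult_minus_right add_uminus_conv_diff)
  have h: "sc \<alpha> = ?g * xt1 \<alpha> \<beta> - (sc (1/2) * xt2 \<beta> * tm T5 - sc (1/2) * xt3 ^ 2)"
    using emb_Omega1[of \<alpha> \<beta>]
    by (simp only: Omega1_alt ring_map_simps[OF ring_map_emb] emb_rel_g emb_Var emb_Const xt.simps)
  have v: "br ?g (xt1 \<alpha> \<beta>) = xt3 ^ 2 - xt2 \<beta> * tm T5"
    using emb_bracket[of \<alpha> \<beta> rel_g X1]
    by (simp add: bracket_g_X1 ring_map_simps[OF ring_map_emb] emb_rel_g emb_Var)
  have i: "sc (inverse (2 * \<alpha>)) * (2 * sc \<alpha>) = 1" using \<alpha> by (simp flip: sc_simps)
  have unit: "br ?g (xt1 \<alpha> \<beta>) * sc (inverse (2 * \<alpha>))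
      + ?g * (sc 2 * xt1 \<alpha> \<beta> * sc (inverse (2 * \<alpha>))) = 1"
    unfolding v ring_map_numeral[OF ring_map_sc] using i h sc_1_2[where ?'k='k]
    by Groebner_Basis.algebra
  obtain n where n: "?g ^ n * x \<in> R0 \<alpha> \<beta>" using x by (auto simp: loc_def)
  have z: "sc 2 * xt1 \<alpha> \<beta> * sc (inverse (2 * \<alpha>)) \<in> R0 \<alpha> \<beta>" by (intro R0_mult R0_sc X1)
  note P = pole_removal[OF S g inverse_pair X1 unit R0_sc z reg' n]
  have "?g' \<notin> R0 \<alpha> \<beta>"
  proof -
    \<comment> \<open>A point with g = 0: X3 = X5 = 1 gives X4 = 2/3, X1 is free, the first relation
      gives X2 = 1 - 2 alpha, and the second reads -(4/3) alpha (X6 - 1) = beta.\<close>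
    let ?r = "\<lambda>i. case i of V1 \<Rightarrow> 0 | V2 \<Rightarrow> 1 - 2 * \<alpha> | V3 \<Rightarrow> 1 | V4 \<Rightarrow> 2/3 | V5 \<Rightarrow> 1
      | V6 \<Rightarrow> 1 - 3 * \<beta> / (4 * \<alpha>)"
    have p: "pt ?r Omega1 = \<alpha>" "pt ?r Omega2 = \<beta>"
      using \<alpha> by (rule_tac [!] relation_point[of 0]; simp add: field_simps)+
    have ab: "(\<alpha>, \<beta>) \<noteq> (0, 0)" using \<alpha> by simp
    have t: "emb \<alpha> \<beta> rel_g * ?g' = 1" unfolding emb_rel_g by (rule inverse_pair)
    have "?g' \<notin> loc \<alpha> \<beta> (emb \<alpha> \<beta> 1)"
      by (rule not_in_loc[OF ab t p]) (simp_all add: pt_simps rel_g_def)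
    then show ?thesis by (simp add: ring_map_1[OF ring_map_emb] loc_1)
  qed
  then show "\<mu> = 0" using P by blast
  show "x \<in> R0 \<alpha> \<beta>" using P by blast
qed

section \<open>Weight derivations\<close>

fun wt1 :: "var \<Rightarrow> 'k::comm_ring_1" where
  "wt1 V1 = - 1" | "wt1 V2 = - 1" | "wt1 V3 = 0" | "wt1 V4 = 1" | "wt1 V5 = 1" | "wt1 V6 = 2"

fun wt2 :: "var \<Rightarrow> 'k::comm_ring_1" where
  "wt2 V1 = - 2" | "wt2 V2 = - 3" | "wt2 V3 = - 1" | "wt2 V4 = 0" | "wt2 V5 = 1" | "wt2 V6 = 3"

text \<open>Each Ti receives the weight of Xi; the correction terms in \<open>xt3\<close> and
  \<open>xt4\<close> are homogeneous of the same weight. The same holds for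
  \<open>Theta2\<close>.\<close>

definition Theta1 :: "'k::comm_ring_1 laurent \<Rightarrow> 'k laurent" where
  "Theta1 a = theta T4 a + theta T5 a + 2 * theta T6 a"

definition Theta2 :: "'k::comm_ring_1 laurent \<Rightarrow> 'k laurent" where
  "Theta2 a = - theta T3 a + theta T5 a + 3 * theta T6 a"

lemma is_der_Theta1: "is_der Theta1"
  unfolding Theta1_def by (rule is_derI) (simp_all add: theta_simps algebra_simps)

lemma is_der_Theta2: "is_der Theta2"
  unfolding Theta2_def by (rule is_derI) (simp_all add: theta_simps algebra_simps)

lemma Theta1_br: "Theta1 (br a b) = br (Theta1 a) b + br a (Theta1 b)"
  by (simp add: Theta1_def theta_br br_simps br_left_simps algebra_simps)

lemma Theta2_br: "Theta2 (br a b) = br (Theta2 a) b + br a (Theta2 b)"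
  by (simp add: Theta2_def theta_br br_simps br_left_simps algebra_simps)

definition wder :: "(var \<Rightarrow> 'k::comm_ring_1) \<Rightarrow> 'k poly6 \<Rightarrow> 'k poly6" where
  "wder w p = (\<Sum>i\<in>UNIV. Const (w i) * Var i * pdiff i p)"

lemma der_along_wder: "der_along (\<lambda>p. p) (wder w)"
  unfolding wder_def
  by (rule der_alongI)
    (simp_all add: pdiff_add pdiff_mult distrib_left sum.distrib sum_distrib_left
      sum_distrib_right ac_simps)

lemma wder_Var: "wder w (Var j) = Const (w j) * Var j"
proof -
  have "wder w (Var j) = (\<Sum>i\<in>UNIV. if i = j then Const (w j) * Var j else 0)"
    unfolding wder_def by (intro sum.cong) (auto simp: pdiff_Var)
  then show ?thesis by simp
qed

text \<open>On the subring \<open>T\<close> is the weight derivation of polynomials followed by the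
  embedding, so it preserves the subring. The conditions on Omega1 and Omega2 are stated after
  embedding because a nonzero weight is harmless for the one whose parameter is 0.\<close>

lemma pder_weight:
  fixes T :: "'k::field_char_0 laurent \<Rightarrow> 'k laurent"
  assumes T: "is_der T" and br: "\<And>a b. T (br a b) = br (T a) b + br a (T b)"
    and gens: "T xt3 = sc (w V3) * xt3" "T xt4 = sc (w V4) * xt4"
      "T (tm T5) = sc (w V5) * tm T5" "T (tm T6) = sc (w V6) * tm T6"
    and Om: "emb \<alpha> \<beta> (wder w Omega1) = 0" "emb \<alpha> \<beta> (wder w Omega2) = 0"
  shows "pder_on (R0 \<alpha> \<beta>) T" and "T (xt \<alpha> \<beta> i) = sc (w i) * xt \<alpha> \<beta> i"
proof -
  have eq: "T (emb \<alpha> \<beta> p) = emb \<alpha> \<beta> (wder w p)" for p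
    by (rule der_along_emb_eqI[OF der_along_comp_emb[OF T] der_along_emb_comp[OF der_along_wder]])
      (simp_all add: gens Om emb_Omega1 emb_Omega2 is_der_simps[OF T] wder_Var emb_simps)
  show "pder_on (R0 \<alpha> \<beta>) T"
    by (auto simp: pder_on_def is_der_simps[OF T] br R0_def eq)
  show "T (xt \<alpha> \<beta> i) = sc (w i) * xt \<alpha> \<beta> i"
    using eq[of "Var i"] by (simp add: emb_simps wder_Var)
qed

lemma Theta1_weight:
  "pder_on (R0 \<alpha> 0) Theta1"
  "Theta1 (xt \<alpha> 0 i) = sc (wt1 i) * (xt \<alpha> 0 i :: 'k::field_char_0 laurent)"
proof -
  have W1: "wder wt1 Omega1 = (0 :: 'k poly6)"
    by (simp add: Omega1_def der_along_simps[OF der_along_wder] wder_Var Const_minus algebra_simps)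
  have W2: "wder wt1 Omega2 = 2 * (Omega2 :: 'k poly6)"
    by (simp add: Omega2_def der_along_simps[OF der_along_wder] wder_Var Const_minus) Groebner_Basis.algebra
  have g: "Theta1 xt3 = sc (wt1 V3) * (xt3 :: 'k laurent)"
    "Theta1 xt4 = sc (wt1 V4) * (xt4 :: 'k laurent)"
    "Theta1 (tm T5) = sc (wt1 V5) * (tm T5 :: 'k laurent)"
    "Theta1 (tm T6) = sc (wt1 V6) * (tm T6 :: 'k laurent)"
    using tm_ti[of T5, where ?'a='k] tm_ti[of T6, where ?'a='k]
    by (simp_all add: Theta1_def xt3_def xt4_def theta_simps theta_tm is_der_ti[OF is_der_theta] sc_simps)
      (Groebner_Basis.algebra+)
  note P = pder_weight[OF is_der_Theta1 Theta1_br g, of \<alpha> 0]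
  show "pder_on (R0 \<alpha> 0) Theta1"
    "Theta1 (xt \<alpha> 0 i) = sc (wt1 i) * (xt \<alpha> 0 i :: 'k::field_char_0 laurent)"
    by (rule P; simp add: W1 W2 emb_simps emb_Omega2 sc_simps)+
qed

lemma Theta2_weight:
  "pder_on (R0 0 \<beta>) Theta2"
  "Theta2 (xt 0 \<beta> i) = sc (wt2 i) * (xt 0 \<beta> i :: 'k::field_char_0 laurent)"
proof -
  have W1: "wder wt2 Omega1 = - 2 * (Omega1 :: 'k poly6)"
    by (simp add: Omega1_def der_along_simps[OF der_along_wder] wder_Var Const_minus) Groebner_Basis.algebra
  have W2: "wder wt2 Omega2 = (0 :: 'k poly6)"
    by (simp add: Omega2_def der_along_simps[OF der_along_wder] wder_Var Const_minus) Groebner_Basis.algebra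
  have g: "Theta2 xt3 = sc (wt2 V3) * (xt3 :: 'k laurent)"
    "Theta2 xt4 = sc (wt2 V4) * (xt4 :: 'k laurent)"
    "Theta2 (tm T5) = sc (wt2 V5) * (tm T5 :: 'k laurent)"
    "Theta2 (tm T6) = sc (wt2 V6) * (tm T6 :: 'k laurent)"
    using tm_ti[of T5, where ?'a='k] tm_ti[of T6, where ?'a='k]
    by (simp_all add: Theta2_def xt3_def xt4_def theta_simps theta_tm is_der_ti[OF is_der_theta] sc_simps)
      (Groebner_Basis.algebra+)
  note P = pder_weight[OF is_der_Theta2 Theta2_br g, of 0 \<beta>]
  show "pder_on (R0 0 \<beta>) Theta2"
    "Theta2 (xt 0 \<beta> i) = sc (wt2 i) * (xt 0 \<beta> i :: 'k::field_char_0 laurent)"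
    by (rule P; simp add: W1 W2 emb_simps emb_Omega1 sc_simps)+
qed

text \<open>{x, T6} / T6 is \<open>lder T6 x\<close>, which has no constant term, whereas the weight
  derivation contributes the constant d. Comparing constant terms recovers the scalar.\<close>

lemma weight_not_inner:
  fixes T :: "'k::field_char_0 laurent \<Rightarrow> 'k laurent"
  assumes "T (tm T6) = sc d * tm T6" "d \<noteq> 0"
    and "br x (tm T6) + sc c * T (tm T6) = br x' (tm T6) + sc c' * T (tm T6)"
  shows "c = c'"
proof -
  have "tm T6 * (lder T6 x + sc (c * d)) = tm T6 * (lder T6 x' + sc (c' * d))"
    using assms(1,3) by (simp only: br_tm sc_simps) Groebner_Basis.algebra
  then have "ti T6 * (tm T6 * (lder T6 x + sc (c * d))) = ti T6 * (tm T6 * (lder T6 x' + sc (c' * d)))"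
    by simp
  moreover have "ti T6 * (tm T6 * a) = a" for a :: "'k laurent"
    using tm_ti[of T6, where ?'a='k] by (metis mult.commute mult.left_commute mult.right_neutral)
  ultimately have "lder T6 x + sc (c * d) = lder T6 x' + sc (c' * d)" by simp
  then have "Poly_Mapping.lookup (lder T6 x + sc (c * d)) 0 =
      Poly_Mapping.lookup (lder T6 x' + sc (c' * d)) 0" by simp
  then show ?thesis using assms(2) by (simp add: lookup_add lookup_lder sc_def del: lder.simps)
qed

theorem pder_inner:
  fixes \<alpha> \<beta> :: "'k::field_char_0"
  assumes \<alpha>: "\<alpha> \<noteq> 0" and \<beta>: "\<beta> \<noteq> 0" and D: "pder_on (R0 \<alpha> \<beta>) D"
  shows "\<exists>x\<in>R0 \<alpha> \<beta>. \<forall>a\<in>R0 \<alpha> \<beta>. D a = br x a"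
proof -
  have ab: "(\<alpha>, \<beta>) \<noteq> (0, 0)" using \<alpha> by simp
  obtain x \<rho> \<mu> where x: "x \<in> loc \<alpha> \<beta> ((tm T4 * tm T6) * (tm T3 * tm T5))"
    and Dx: "\<And>a. a \<in> R0 \<alpha> \<beta> \<Longrightarrow>
      D a = br x a - sc \<rho> * (lder T4 a + lder T6 a) - sc \<mu> * (lder T3 a + lder T5 a)"
    using pder_inner_away_from_fg[OF ab D] by blast
  have F: "x \<in> loc \<alpha> \<beta> (tm T3 * tm T5)" "\<rho> = 0"
    using no_pole_along_f[OF \<beta> D x, of \<rho> \<mu>] Dx by blast+
  have X1: "xt1 \<alpha> \<beta> \<in> R0 \<alpha> \<beta>" using R0_generators(5)[of \<alpha> \<beta> V1] by simp
  have "D (xt1 \<alpha> \<beta>) \<in> R0 \<alpha> \<beta>" using D X1 by (simp add: pder_on_def)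
  then have "br x (xt1 \<alpha> \<beta>) - sc \<mu> * (lder T3 (xt1 \<alpha> \<beta>) + lder T5 (xt1 \<alpha> \<beta>)) \<in> R0 \<alpha> \<beta>"
    unfolding Dx[OF X1] F(2) by (simp add: sc_simps)
  note G = no_pole_along_g[OF \<alpha> F(1) this]
  show ?thesis
    by (rule bexI[OF _ G(1)]) (simp add: Dx F(2) G(2) sc_simps)
qed

theorem pder_inner_Theta1:
  fixes \<alpha> :: "'k::field_char_0"
  assumes \<alpha>: "\<alpha> \<noteq> 0" and D: "pder_on (R0 \<alpha> 0) D"
  shows "\<exists>x\<in>R0 \<alpha> 0. \<exists>c. \<forall>a\<in>R0 \<alpha> 0. D a = br x a + sc c * Theta1 a"
proof -
  have ab: "(\<alpha>, 0) \<noteq> (0, 0 :: 'k)" using \<alpha> by simp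
  obtain x \<rho> \<mu> where x: "x \<in> loc \<alpha> 0 ((tm T4 * tm T6) * (tm T3 * tm T5))"
    and Dx: "\<And>a. a \<in> R0 \<alpha> 0 \<Longrightarrow>
      D a = br x a - sc \<rho> * (lder T4 a + lder T6 a) - sc \<mu> * (lder T3 a + lder T5 a)"
    using pder_inner_away_from_fg[OF ab D] by blast
  have xg: "x \<in> loc \<alpha> 0 (tm T3 * tm T5)" using x loc_fg_subset by blast
  \<comment> \<open>\<open>Theta1\<close> is one third of \<open>lder T4\<close> +
    \<open>lder T6\<close> minus \<open>lder T3\<close> + \<open>lder T5\<close>; this trades the
    logarithmic term of f for \<open>Theta1\<close> and a term of g.\<close>
  have Dx': "D a = br x a - sc (\<mu> + 3 * \<rho>) * (lder T3 a + lder T5 a) + sc (- 3 * \<rho>) * Theta1 a"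
    if "a \<in> R0 \<alpha> 0" for a
    unfolding Dx[OF that] by (simp add: Theta1_def sc_simps algebra_simps)
  have X1: "xt1 \<alpha> 0 \<in> R0 \<alpha> 0" using R0_generators(5)[of \<alpha> 0 V1] by simp
  have "D (xt1 \<alpha> 0) + sc (3 * \<rho>) * Theta1 (xt1 \<alpha> 0) \<in> R0 \<alpha> 0"
    using D Theta1_weight(1)[of \<alpha>] X1 by (intro R0_add R0_mult R0_sc) (simp_all add: pder_on_def)
  then have "br x (xt1 \<alpha> 0) - sc (\<mu> + 3 * \<rho>) * (lder T3 (xt1 \<alpha> 0) + lder T5 (xt1 \<alpha> 0)) \<in> R0 \<alpha> 0"
    unfolding Dx'[OF X1] by (simp add: sc_simps)
  note G = no_pole_along_g[OF \<alpha> xg this]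
  have "D a = br x a + sc (- 3 * \<rho>) * Theta1 a" if "a \<in> R0 \<alpha> 0" for a
    unfolding Dx'[OF that] G(2) by (simp add: ring_map_0[OF ring_map_sc])
  then show ?thesis using G(1) by blast
qed

theorem pder_inner_Theta2:
  fixes \<beta> :: "'k::field_char_0"
  assumes \<beta>: "\<beta> \<noteq> 0" and D: "pder_on (R0 0 \<beta>) D"
  shows "\<exists>x\<in>R0 0 \<beta>. \<exists>c. \<forall>a\<in>R0 0 \<beta>. D a = br x a + sc c * Theta2 a"
proof -
  have ab: "(0, \<beta>) \<noteq> (0 :: 'k, 0)" using \<beta> by simp
  obtain x \<rho> \<mu> where x: "x \<in> loc 0 \<beta> ((tm T4 * tm T6) * (tm T3 * tm T5))"
    and Dx: "\<And>a. a \<in> R0 0 \<beta> \<Longrightarrow>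
      D a = br x a - sc \<rho> * (lder T4 a + lder T6 a) - sc \<mu> * (lder T3 a + lder T5 a)"
    using pder_inner_away_from_fg[OF ab D] by blast
  have F: "x \<in> loc 0 \<beta> (tm T3 * tm T5)" "\<rho> = 0"
    using no_pole_along_f[OF \<beta> D x, of \<rho> \<mu>] Dx by blast+
  have "x \<in> R0 0 \<beta>" using F(1) loc_g_subset[OF \<beta>] by blast
  \<comment> \<open>\<open>Theta2\<close> is minus the sum of \<open>lder T3\<close> and
    \<open>lder T5\<close>, the logarithmic Hamiltonian derivation of g.\<close>
  moreover have "D a = br x a + sc \<mu> * Theta2 a" if "a \<in> R0 0 \<beta>" for a
    unfolding Dx[OF that] F(2) by (simp add: Theta2_def sc_simps algebra_simps)
  ultimately show ?thesis by blast
qed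

section \<open>Transport to the quotient algebra\<close>

lemma ring_poly_alg: "ring (poly_alg :: ('k::comm_ring_1, 'k poly6) poisson_algebra)"
proof (rule ringI)
  show "abelian_group (poly_alg :: ('k, 'k poly6) poisson_algebra)"
    by (rule abelian_groupI) (auto simp: poly_alg_def ac_simps intro: exI[of _ "- _"] left_minus)
  show "Group.monoid (poly_alg :: ('k, 'k poly6) poisson_algebra)"
    by (rule monoidI) (auto simp: poly_alg_def ac_simps)
qed (auto simp: poly_alg_def algebra_simps)

lemma a_inv_poly_alg: "\<ominus>\<^bsub>poly_alg\<^esub> p = - (p :: 'k::comm_ring_1 poly6)"
proof -
  interpret ring "poly_alg :: ('k, 'k poly6) poisson_algebra" by (rule ring_poly_alg)
  show ?thesis by (rule minus_equality) (simp_all add: poly_alg_def)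
qed

lemma A_ideal_rels: "A_ideal \<alpha> \<beta> = rels \<alpha> (\<beta> :: 'k::field_char_0)"
proof -
  let ?P = "poly_alg :: ('k, 'k poly6) poisson_algebra"
  let ?G = "{Omega1 - Const \<alpha>, Omega2 - Const \<beta>}"
  interpret ring ?P by (rule ring_poly_alg)
  have "ideal (rels \<alpha> \<beta>) ?P"
  proof (rule idealI[OF ring_poly_alg])
    show "subgroup (rels \<alpha> \<beta>) (add_monoid ?P)"
    proof (rule add.subgroupI)
      show "rels \<alpha> \<beta> \<noteq> {}" by (auto simp: rels_def)
      show "\<ominus>\<^bsub>?P\<^esub> a \<in> rels \<alpha> \<beta>" if "a \<in> rels \<alpha> \<beta>" for a
      proof -
        from that obtain u v where "a = u * (Omega1 - Const \<alpha>) + v * (Omega2 - Const \<beta>)"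
          by (auto simp: rels_def)
        then have "- a = (- u) * (Omega1 - Const \<alpha>) + (- v) * (Omega2 - Const \<beta>)" by simp
        then show ?thesis unfolding a_inv_poly_alg rels_def by blast
      qed
      show "a \<oplus>\<^bsub>?P\<^esub> b \<in> rels \<alpha> \<beta>" if "a \<in> rels \<alpha> \<beta>" "b \<in> rels \<alpha> \<beta>" for a b
      proof -
        from that obtain u v u' v' where "a = u * (Omega1 - Const \<alpha>) + v * (Omega2 - Const \<beta>)"
          "b = u' * (Omega1 - Const \<alpha>) + v' * (Omega2 - Const \<beta>)"
          by (auto simp: rels_def)
        then have "a + b = (u + u') * (Omega1 - Const \<alpha>) + (v + v') * (Omega2 - Const \<beta>)"
          by (simp add: distrib_right)
        then show ?thesis unfolding rels_def poly_alg_def by (auto intro: exI)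
      qed
    qed (simp add: poly_alg_def)
    have l: "x * a \<in> rels \<alpha> \<beta>" if "a \<in> rels \<alpha> \<beta>" for a x
    proof -
      from that obtain u v where "a = u * (Omega1 - Const \<alpha>) + v * (Omega2 - Const \<beta>)"
        by (auto simp: rels_def)
      then have "x * a = (x * u) * (Omega1 - Const \<alpha>) + (x * v) * (Omega2 - Const \<beta>)"
        by (simp only: distrib_left mult.assoc)
      then show ?thesis unfolding rels_def by blast
    qed
    show "x \<otimes>\<^bsub>?P\<^esub> a \<in> rels \<alpha> \<beta>" "a \<otimes>\<^bsub>?P\<^esub> x \<in> rels \<alpha> \<beta>" if "a \<in> rels \<alpha> \<beta>" for a x
      using l[OF that, of x] by (simp_all add: poly_alg_def mult.commute)
  qed
  moreover have "?G \<subseteq> rels \<alpha> \<beta>"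
  proof -
    have "Omega1 - Const \<alpha> = 1 * (Omega1 - Const \<alpha>) + 0 * (Omega2 - Const \<beta>)"
      "Omega2 - Const \<beta> = 0 * (Omega1 - Const \<alpha>) + 1 * (Omega2 - Const \<beta>)" by simp_all
    then show ?thesis unfolding rels_def by blast
  qed
  ultimately have "A_ideal \<alpha> \<beta> \<subseteq> rels \<alpha> \<beta>"
    unfolding A_ideal_def genideal_def by blast
  moreover have "rels \<alpha> \<beta> \<subseteq> I" if I: "ideal I ?P" "?G \<subseteq> I" for I
  proof -
    interpret I: ideal I ?P by (rule I)
    have "u * a \<in> I" if "a \<in> I" for u a using I.I_l_closed[OF that, of u] by (simp add: poly_alg_def)
    moreover have "a + b \<in> I" if "a \<in> I" "b \<in> I" for a b
      using I.a_closed[OF that] by (simp add: poly_alg_def)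
    ultimately show ?thesis using I(2) by (auto simp: rels_def)
  qed
  then have "rels \<alpha> \<beta> \<subseteq> A_ideal \<alpha> \<beta>"
    unfolding A_ideal_def genideal_def by blast
  ultimately show ?thesis by blast
qed

locale relations =
  fixes \<alpha> \<beta> :: "'k::field_char_0"
  assumes ab: "(\<alpha>, \<beta>) \<noteq> (0, 0)"
begin

abbreviation A where "A \<equiv> A_alg \<alpha> \<beta>"
abbreviation R where "R \<equiv> R0 \<alpha> \<beta>"

text \<open>The elements of the quotient algebra are the fibres of \<open>emb \<alpha> \<beta>\<close> over its image.\<close>

definition fib :: "'k laurent \<Rightarrow> 'k poly6 set" where
  "fib y = {p. emb \<alpha> \<beta> p = y}"

definition val :: "'k poly6 set \<Rightarrow> 'k laurent" where
  "val C = emb \<alpha> \<beta> (SOME p. p \<in> C)"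

text \<open>This is where the description of the kernel enters: congruence modulo the ideal is
  equality of the images in the torus.\<close>

lemma coset_fib: "A_ideal \<alpha> \<beta> +>\<^bsub>poly_alg\<^esub> p = fib (emb \<alpha> \<beta> p)"
proof -
  have "q \<in> fib (emb \<alpha> \<beta> p) \<longleftrightarrow> q - p \<in> rels \<alpha> \<beta>" for q
    using emb_eq_0_iff[OF ab, of "q - p"] by (simp add: fib_def emb_simps)
  moreover have "q \<in> A_ideal \<alpha> \<beta> +>\<^bsub>poly_alg\<^esub> p \<longleftrightarrow> q - p \<in> rels \<alpha> \<beta>" for q
  proof -
    have "q \<in> A_ideal \<alpha> \<beta> +>\<^bsub>poly_alg\<^esub> p \<longleftrightarrow> (\<exists>h\<in>rels \<alpha> \<beta>. q = h + p)"
      by (simp add: a_r_coset_def r_coset_def A_ideal_rels poly_alg_def)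
    also have "\<dots> \<longleftrightarrow> q - p \<in> rels \<alpha> \<beta>"
      by (metis add_diff_cancel_right' diff_add_cancel)
    finally show ?thesis .
  qed
  ultimately show ?thesis by blast
qed

lemma val_fib: "y \<in> R \<Longrightarrow> val (fib y) = y"
  unfolding val_def fib_def R0_def by (rule someI2_ex) auto

lemma carrier_A: "carrier A = fib ` R"
  by (auto simp: A_alg_def poisson_quotient_def FactRing_def A_RCOSETS_def RCOSETS_def
      a_r_coset_def[symmetric] coset_fib R0_def) (auto simp: poly_alg_def)

lemma fib_in [simp]: "y \<in> R \<Longrightarrow> fib y \<in> carrier A"
  by (simp add: carrier_A)

lemma fib_eq_iff: "y \<in> R \<Longrightarrow> z \<in> R \<Longrightarrow> fib y = fib z \<longleftrightarrow> y = z"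
  using val_fib by metis

lemma fib_val: "C \<in> carrier A \<Longrightarrow> fib (val C) = C" and val_in: "C \<in> carrier A \<Longrightarrow> val C \<in> R"
  by (auto simp: carrier_A val_fib)

lemma gen_fib: "gen \<alpha> \<beta> i = fib (xt \<alpha> \<beta> i)"
  by (simp add: gen_def coset_fib emb_simps)

lemma fib_nonempty: "y \<in> R \<Longrightarrow> \<exists>p. p \<in> fib y"
  by (auto simp: fib_def R0_def)

lemma zero_A: "\<zero>\<^bsub>A\<^esub> = fib 0"
proof -
  have "A_ideal \<alpha> \<beta> = fib 0"
    using emb_eq_0_iff[OF ab] by (auto simp: A_ideal_rels fib_def)
  then show ?thesis by (simp add: A_alg_def poisson_quotient_def FactRing_def)
qed

lemma add_A:
  assumes "a \<in> R" "b \<in> R"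
  shows "fib a \<oplus>\<^bsub>A\<^esub> fib b = fib (a + b)"
proof -
  have "fib a \<oplus>\<^bsub>A\<^esub> fib b = {p + q | p q. p \<in> fib a \<and> q \<in> fib b}"
    by (auto simp: A_alg_def poisson_quotient_def FactRing_def set_add_def set_mult_def poly_alg_def)
  also have "\<dots> = fib (a + b)"
  proof (intro Set.set_eqI iffI)
    fix r assume r: "r \<in> fib (a + b)"
    obtain p where p: "p \<in> fib a" using fib_nonempty[OF assms(1)] by blast
    then have "r - p \<in> fib b" using r by (simp add: fib_def emb_simps)
    then have "p + (r - p) \<in> {p + q | p q. p \<in> fib a \<and> q \<in> fib b}" using p by blast
    then show "r \<in> {p + q | p q. p \<in> fib a \<and> q \<in> fib b}" by simp
  qed (auto simp: fib_def emb_simps)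
  finally show ?thesis .
qed

text \<open>The union over representatives collapses: all of them yield the same fibre, and there is
  at least one.\<close>

lemma mult_A:
  assumes "a \<in> R" "b \<in> R"
  shows "fib a \<otimes>\<^bsub>A\<^esub> fib b = fib (a * b)"
proof -
  have "fib a \<otimes>\<^bsub>A\<^esub> fib b = (\<Union>p\<in>fib a. \<Union>q\<in>fib b. fib (emb \<alpha> \<beta> (p * q)))"
    by (simp add: A_alg_def poisson_quotient_def FactRing_def rcoset_mult_def coset_fib)
      (simp add: poly_alg_def)
  also have "\<dots> = (\<Union>p\<in>fib a. \<Union>q\<in>fib b. fib (a * b))"
    by (intro SUP_cong refl) (simp add: fib_def emb_simps)
  also have "\<dots> = fib (a * b)" using fib_nonempty assms by auto
  finally show ?thesis .
qed

lemma smult_A: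
  assumes "a \<in> R"
  shows "c \<odot>\<^bsub>A\<^esub> fib a = fib (sc c * a)"
proof -
  have "c \<odot>\<^bsub>A\<^esub> fib a = (\<Union>p\<in>fib a. fib (emb \<alpha> \<beta> (Const c * p)))"
    by (simp add: A_alg_def poisson_quotient_def quotient_smult_def coset_fib)
      (simp add: poly_alg_def)
  also have "\<dots> = (\<Union>p\<in>fib a. fib (sc c * a))"
    by (intro SUP_cong refl) (simp add: fib_def emb_simps)
  also have "\<dots> = fib (sc c * a)" using fib_nonempty assms by auto
  finally show ?thesis .
qed

lemma bracket_A:
  assumes "a \<in> R" "b \<in> R"
  shows "pbracket A (fib a) (fib b) = fib (br a b)"
proof -
  have "pbracket A (fib a) (fib b) = (\<Union>p\<in>fib a. \<Union>q\<in>fib b. fib (emb \<alpha> \<beta> (poly_bracket p q)))"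
    by (simp add: A_alg_def poisson_quotient_def coset_fib) (simp add: poly_alg_def)
  also have "\<dots> = (\<Union>p\<in>fib a. \<Union>q\<in>fib b. fib (br a b))"
    by (intro SUP_cong refl) (simp add: fib_def emb_bracket)
  also have "\<dots> = fib (br a b)" using fib_nonempty assms by auto
  finally show ?thesis .
qed

lemmas A_ops = add_A mult_A smult_A bracket_A
lemmas R_closed = R0_add R0_mult R0_sc br_in_R0

definition lift :: "('k laurent \<Rightarrow> 'k laurent) \<Rightarrow> 'k poly6 set \<Rightarrow> 'k poly6 set" where
  "lift T = (\<lambda>C\<in>carrier A. fib (T (val C)))"

lemma lift_fib: "a \<in> R \<Longrightarrow> lift T (fib a) = fib (T a)"
  by (simp add: lift_def val_fib)

lemma lift_eqI: "(\<And>a. a \<in> R \<Longrightarrow> T a = S a) \<Longrightarrow> lift T = lift S"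
  by (auto simp: lift_def val_in intro!: restrict_ext)

lemma eq_liftI:
  assumes "F \<in> extensional (carrier A)" "\<And>a. a \<in> R \<Longrightarrow> F (fib a) = fib (T a)"
  shows "F = lift T"
  by (rule extensionalityI[OF assms(1), of _ ])
    (use assms(2) in \<open>auto simp: lift_def carrier_A val_fib\<close>)

lemma ham_lift: "x \<in> R \<Longrightarrow> ham A (fib x) = lift (br x)"
  by (rule eq_liftI) (simp_all add: ham_def bracket_A)

lemma inner_lift: "inner_Der A = (\<lambda>x. lift (br x)) ` R"
  unfolding inner_Der_def carrier_A image_image by (intro image_cong refl ham_lift)

lemma poisson_derivation_lift:
  assumes T: "pder_on R T"
  shows "poisson_derivation A (lift T)"
proof -
  have TR: "T a \<in> R" if "a \<in> R" for a using T that by (simp add: pder_on_def)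
  have T_simps: "T (a + b) = T a + T b"
    "T (a * b) = T a * b + a * T b" "T (br a b) = br (T a) b + br a (T b)"
    if "a \<in> R" "b \<in> R" for a b using T that by (auto simp: pder_on_def)
  have sm: "T (sc c * a) = sc c * T a" if "a \<in> R" for a c
    using T that unfolding pder_on_def by blast
  have E: "lift T \<in> carrier A \<rightarrow>\<^sub>E carrier A" by (auto simp: lift_def val_in TR)
  have all: "(\<forall>C\<in>carrier A. P C) \<longleftrightarrow> (\<forall>a\<in>R. P (fib a))" for P
    by (simp add: carrier_A)
  show ?thesis
    unfolding poisson_derivation_def all
  proof (intro conjI allI ballI)
    show "lift T (c \<odot>\<^bsub>A\<^esub> fib a) = c \<odot>\<^bsub>A\<^esub> lift T (fib a)" if "a \<in> R" for a c
      using that by (simp add: lift_fib smult_A R_closed TR sm)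
  qed (simp_all add: E, simp_all add: lift_fib A_ops R_closed TR T_simps)
qed

lemma poisson_derivation_cases:
  assumes E: "poisson_derivation A E"
  obtains D where "pder_on R D" "E = lift D"
proof -
  define D where "D a = val (E (fib a))" for a
  have ER: "E (fib a) \<in> carrier A" if "a \<in> R" for a
    using E that by (auto simp: poisson_derivation_def)
  have DR: "D a \<in> R" if "a \<in> R" for a unfolding D_def using ER[OF that] by (rule val_in)
  have ED: "E (fib a) = fib (D a)" if "a \<in> R" for a
    using fib_val[OF ER[OF that]] by (simp add: D_def)
  have lift: "E = lift D"
  proof (rule eq_liftI)
    show "E \<in> extensional (carrier A)" using E by (simp add: poisson_derivation_def PiE_def)
  qed (rule ED)
  have eqI: "D c = d" if "c \<in> R" "d \<in> R" "E (fib c) = fib d" for c d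
    using that by (simp add: val_fib D_def)
  have "pder_on R D"
    unfolding pder_on_def
  proof (intro conjI ballI allI)
    fix a b c assume a: "a \<in> R"
    show "D a \<in> R" by (rule DR[OF a])
    have "E (c \<odot>\<^bsub>A\<^esub> fib a) = c \<odot>\<^bsub>A\<^esub> E (fib a)"
      using E a by (simp add: poisson_derivation_def)
    then show "D (sc c * a) = sc c * D a"
      using a DR[OF a] ED[OF a] by (intro eqI R_closed) (simp_all add: smult_A)
    assume b: "b \<in> R"
    note r = a b DR[OF a] DR[OF b]
    have "E (fib a \<oplus>\<^bsub>A\<^esub> fib b) = E (fib a) \<oplus>\<^bsub>A\<^esub> E (fib b)"
      "E (fib a \<otimes>\<^bsub>A\<^esub> fib b) = E (fib a) \<otimes>\<^bsub>A\<^esub> fib b \<oplus>\<^bsub>A\<^esub> fib a \<otimes>\<^bsub>A\<^esub> E (fib b)"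
      "E (pbracket A (fib a) (fib b)) =
        pbracket A (E (fib a)) (fib b) \<oplus>\<^bsub>A\<^esub> pbracket A (fib a) (E (fib b))"
      using E a b by (simp_all add: poisson_derivation_def)
    then have e: "E (fib (a + b)) = fib (D a + D b)"
      "E (fib (a * b)) = fib (D a * b + a * D b)"
      "E (fib (br a b)) = fib (br (D a) b + br a (D b))"
      unfolding ED[OF a] ED[OF b] by (simp_all add: A_ops R_closed r)
    show "D (a + b) = D a + D b" by (rule eqI[OF _ _ e(1)]) (intro R_closed r)+
    show "D (a * b) = D a * b + a * D b" by (rule eqI[OF _ _ e(2)]) (intro R_closed r)+
    show "D (br a b) = br (D a) b + br a (D b)" by (rule eqI[OF _ _ e(3)]) (intro R_closed r)+
  qed
  from that[OF this lift] show thesis .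
qed

lemma lift_eq_by_generators:
  assumes T: "pder_on R T" and S: "pder_on R S" and gens: "\<And>i. T (xt \<alpha> \<beta> i) = S (xt \<alpha> \<beta> i)"
  shows "lift T = lift S"
proof (rule lift_eqI)
  fix a assume "a \<in> R"
  then obtain p where a: "a = emb \<alpha> \<beta> p" by (auto simp: R0_def)
  show "T a = S a"
    unfolding a by (rule der_along_eqI[OF der_along_pder[OF T] der_along_pder[OF S]])
      (simp add: gens emb_simps)
qed

text \<open>\<open>P\<close> prescribes the values on the generators. Every Poisson derivation of
  the quotient is the lift of one of the subring, where these values determine it.\<close>

lemma the_lift:
  assumes T: "pder_on R T"
    and P: "\<And>E. P E \<longleftrightarrow> (\<forall>i. E (gen \<alpha> \<beta> i) = fib (T (xt \<alpha> \<beta> i)))"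
  shows "(THE E. poisson_derivation A E \<and> P E) = lift T"
proof (rule the_equality)
  show "poisson_derivation A (lift T) \<and> P (lift T)"
    using poisson_derivation_lift[OF T] by (simp add: P gen_fib lift_fib R0_generators)
  fix E assume E: "poisson_derivation A E \<and> P E"
  then obtain D where D: "pder_on R D" "E = lift D" using poisson_derivation_cases by blast
  have "T (xt \<alpha> \<beta> i) \<in> R" "D (xt \<alpha> \<beta> i) \<in> R" for i
    using T D(1) R0_generators(5)[of \<alpha> \<beta> i] unfolding pder_on_def by blast+
  moreover have "fib (D (xt \<alpha> \<beta> i)) = fib (T (xt \<alpha> \<beta> i))" for i
    using E unfolding D(2) P by (simp add: gen_fib lift_fib R0_generators)
  ultimately show "E = lift T"
    unfolding D(2) by (intro lift_eq_by_generators[OF D(1) T]) (simp add: fib_eq_iff)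
qed

section \<open>Classes modulo inner derivations\<close>

lemma add_Der:
  assumes "\<And>a. a \<in> R \<Longrightarrow> T a \<in> R" "\<And>a. a \<in> R \<Longrightarrow> S a \<in> R"
  shows "lift T \<oplus>\<^bsub>poisson_Der A\<^esub> lift S = lift (\<lambda>a. T a + S a)"
  by (rule eq_liftI) (simp_all add: poisson_Der_def lift_fib add_A assms)

lemma smult_Der:
  assumes "\<And>a. a \<in> R \<Longrightarrow> T a \<in> R"
  shows "c \<odot>\<^bsub>poisson_Der A\<^esub> lift T = lift (\<lambda>a. sc c * T a)"
  by (rule eq_liftI) (simp_all add: poisson_Der_def lift_fib smult_A assms)

lemma zero_Der: "\<zero>\<^bsub>poisson_Der A\<^esub> = lift (\<lambda>_. 0)"
  by (rule eq_liftI) (simp_all add: poisson_Der_def zero_A)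

definition cls :: "('k laurent \<Rightarrow> 'k laurent) \<Rightarrow> ('k poly6 set \<Rightarrow> 'k poly6 set) set" where
  "cls T = inner_Der A +>\<^bsub>poisson_Der A\<^esub> lift T"

lemma cls_alt:
  assumes "\<And>a. a \<in> R \<Longrightarrow> T a \<in> R"
  shows "cls T = {lift (\<lambda>a. br x a + T a) | x. x \<in> R}"
proof -
  have "cls T = (\<lambda>x. lift (br x) \<oplus>\<^bsub>poisson_Der A\<^esub> lift T) ` R"
    unfolding cls_def a_r_coset_def r_coset_def inner_lift by auto
  also have "\<dots> = (\<lambda>x. lift (\<lambda>a. br x a + T a)) ` R"
    by (intro image_cong refl add_Der br_in_R0 assms)
  finally show ?thesis by auto
qed

lemma cls_subset:
  assumes T: "\<And>a. a \<in> R \<Longrightarrow> T a \<in> R" and x: "x \<in> R"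
    and S: "\<And>a. a \<in> R \<Longrightarrow> S a = br x a + T a"
  shows "cls S \<subseteq> cls T"
proof
  have SR: "S a \<in> R" if "a \<in> R" for a
    unfolding S[OF that] by (intro R0_add br_in_R0 x that T)
  fix E assume "E \<in> cls S"
  then have "E \<in> {lift (\<lambda>a. br y a + S a) | y. y \<in> R}"
    by (subst (asm) cls_alt) (rule SR, assumption)
  then obtain y where y: "y \<in> R" "E = lift (\<lambda>a. br y a + S a)" by blast
  have "E = lift (\<lambda>a. br (y + x) a + T a)"
    unfolding y(2) by (rule lift_eqI) (simp add: S is_der_add[OF is_der_br_left])
  then have "E \<in> {lift (\<lambda>a. br x a + T a) | x. x \<in> R}" using R0_add[OF y(1) x] by blast
  then show "E \<in> cls T" by (subst cls_alt) (rule T, assumption)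
qed

lemma cls_eqI:
  assumes T: "\<And>a. a \<in> R \<Longrightarrow> T a \<in> R" and x: "x \<in> R"
    and S: "\<And>a. a \<in> R \<Longrightarrow> S a = br x a + T a"
  shows "cls S = cls T"
proof
  show "cls S \<subseteq> cls T" by (rule cls_subset[OF T x S])
  have m: "- x \<in> R" using R0_mult[OF R0_sc[of "- 1"] x] by (simp add: sc_simps)
  have SR: "S a \<in> R" if "a \<in> R" for a
    unfolding S[OF that] by (intro R0_add br_in_R0 x that T)
  show "cls T \<subseteq> cls S"
    by (rule cls_subset[OF SR m]) (simp_all add: S is_der_minus[OF is_der_br_left])
qed

lemma carrier_HP1: "carrier (HP1 A) = {cls T | T. pder_on R T}"
proof -
  have "carrier (HP1 A) = {inner_Der A +>\<^bsub>poisson_Der A\<^esub> E | E. poisson_derivation A E}"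
    by (auto simp: HP1_def quotient_module_def A_RCOSETS_def RCOSETS_def a_r_coset_def poisson_Der_def)
  also have "\<dots> = {cls T | T. pder_on R T}"
  proof -
    have "poisson_derivation A E \<longleftrightarrow> (\<exists>T. pder_on R T \<and> E = lift T)" for E
      using poisson_derivation_cases poisson_derivation_lift by blast
    then show ?thesis by (auto simp: cls_def)
  qed
  finally show ?thesis .
qed

text \<open>c times {x, -} is {c x, -}, so all scaled representatives lie in one class and the union
  over them collapses.\<close>

lemma smult_cls:
  assumes T: "\<And>a. a \<in> R \<Longrightarrow> T a \<in> R"
  shows "c \<odot>\<^bsub>HP1 A\<^esub> cls T = cls (\<lambda>a. sc c * T a)"
proof -
  have R: "br x a + T a \<in> R" "sc c * T a \<in> R" if "x \<in> R" "a \<in> R" for x a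
    using that T by (simp_all add: R_closed)
  have "c \<odot>\<^bsub>HP1 A\<^esub> cls T =
      (\<Union>E\<in>cls T. inner_Der A +>\<^bsub>poisson_Der A\<^esub> (c \<odot>\<^bsub>poisson_Der A\<^esub> E))"
    by (simp add: HP1_def quotient_module_def quotient_smult_def)
  also have "\<dots> = (\<Union>x\<in>R. inner_Der A +>\<^bsub>poisson_Der A\<^esub>
      (c \<odot>\<^bsub>poisson_Der A\<^esub> lift (\<lambda>a. br x a + T a)))"
  proof -
    have "cls T = (\<lambda>x. lift (\<lambda>a. br x a + T a)) ` R" by (subst cls_alt) (auto intro: T)
    then show ?thesis by simp
  qed
  also have "\<dots> = (\<Union>x\<in>R. cls (\<lambda>a. sc c * (br x a + T a)))"
  proof (intro SUP_cong refl)
    fix x assume x: "x \<in> R"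
    have "c \<odot>\<^bsub>poisson_Der A\<^esub> lift (\<lambda>a. br x a + T a) = lift (\<lambda>a. sc c * (br x a + T a))"
      by (rule smult_Der) (rule R(1)[OF x])
    then show "inner_Der A +>\<^bsub>poisson_Der A\<^esub> (c \<odot>\<^bsub>poisson_Der A\<^esub> lift (\<lambda>a. br x a + T a)) =
        cls (\<lambda>a. sc c * (br x a + T a))"
      by (simp only: cls_def)
  qed
  also have "\<dots> = (\<Union>x\<in>R. cls (\<lambda>a. sc c * T a))"
  proof (intro SUP_cong refl)
    fix x assume x: "x \<in> R"
    show "cls (\<lambda>a. sc c * (br x a + T a)) = cls (\<lambda>a. sc c * T a)"
      by (rule cls_eqI[of _ "sc c * x"])
        (use x T in \<open>simp_all add: R_closed br_left_simps algebra_simps\<close>)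
  qed
  also have "\<dots> = cls (\<lambda>a. sc c * T a)" using R0_sc by blast
  finally show ?thesis .
qed


section \<open>Decomposition of derivations and the cohomology group\<close>

lemma pder_in_R: "pder_on R T \<Longrightarrow> a \<in> R \<Longrightarrow> T a \<in> R"
  by (simp add: pder_on_def)

lemma pder_on_smult:
  assumes T: "pder_on R T"
  shows "pder_on R (\<lambda>a. sc c * T a)"
  unfolding pder_on_def
proof (intro conjI ballI allI)
  fix a b d assume a: "a \<in> R"
  show "sc c * T a \<in> R" by (intro R0_mult R0_sc pder_in_R[OF T a])
  show "sc c * T (sc d * a) = sc d * (sc c * T a)"
    using T a by (simp add: pder_on_def ac_simps)
  assume b: "b \<in> R"
  show "sc c * T (a + b) = sc c * T a + sc c * T b"
    "sc c * T (a * b) = sc c * T a * b + a * (sc c * T b)"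
    "sc c * T (br a b) = br (sc c * T a) b + br a (sc c * T b)"
    using T a b by (simp_all add: pder_on_def br_simps br_left_simps algebra_simps)
qed

lemma pder_on_zero: "pder_on R (\<lambda>_. 0)"
  using R0_sc[of 0 \<alpha> \<beta>] by (simp add: pder_on_def br_simps br_left_simps sc_simps)

text \<open>Uniqueness refers to the derivation \<open>ham A x\<close> and not to \<open>x\<close>,
  which may be changed by a constant; so existence is the whole content.\<close>

lemma unique_inner:
  assumes "\<And>T. pder_on R T \<Longrightarrow> \<exists>x\<in>R. \<forall>a\<in>R. T a = br x a" and E: "poisson_derivation A E"
  shows "\<exists>!h. (\<exists>x\<in>carrier A. h = ham A x) \<and> E = h"
proof -
  obtain D where D: "pder_on R D" "E = lift D" using poisson_derivation_cases[OF E] by blast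
  then obtain x where x: "x \<in> R" "\<forall>a\<in>R. D a = br x a" using assms(1) by blast
  then have "E = ham A (fib x)" unfolding D(2) ham_lift[OF x(1)] by (intro lift_eqI) simp
  then show ?thesis using x(1) by (intro ex1I[of _ E]) auto
qed

lemma HP1_zero:
  assumes "\<And>T. pder_on R T \<Longrightarrow> \<exists>x\<in>R. \<forall>a\<in>R. T a = br x a"
  shows "carrier (HP1 A) = {HP1_class A \<zero>\<^bsub>poisson_Der A\<^esub>}"
proof -
  have "cls T = cls (\<lambda>_. 0)" if "pder_on R T" for T
  proof -
    obtain x where "x \<in> R" "\<forall>a\<in>R. T a = br x a" using assms[OF \<open>pder_on R T\<close>] by blast
    then show ?thesis
      using R0_sc[of 0 \<alpha> \<beta>] by (intro cls_eqI[of _ x]) (simp_all add: sc_simps)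
  qed
  then show ?thesis
    unfolding carrier_HP1 HP1_class_def zero_Der cls_def[symmetric] using pder_on_zero by blast
qed

text \<open>The value on T6 determines the scalar by \<open>weight_not_inner\<close>; cancelling its
  term leaves the Hamiltonian part.\<close>

lemma unique_inner_plus:
  assumes T: "pder_on R T" and T6: "T (tm T6) = sc d * tm T6" "d \<noteq> 0"
    and form: "\<And>D. pder_on R D \<Longrightarrow> \<exists>x\<in>R. \<exists>c. \<forall>a\<in>R. D a = br x a + sc c * T a"
    and E: "poisson_derivation A E"
  shows "\<exists>!(h, c). (\<exists>x\<in>carrier A. h = ham A x) \<and>
    E = h \<oplus>\<^bsub>poisson_Der A\<^esub> (c \<odot>\<^bsub>poisson_Der A\<^esub> lift T)"
proof -
  have sum: "ham A (fib x) \<oplus>\<^bsub>poisson_Der A\<^esub> (c \<odot>\<^bsub>poisson_Der A\<^esub> lift T) =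
      lift (\<lambda>a. br x a + sc c * T a)" if "x \<in> R" for x c
  proof -
    have "c \<odot>\<^bsub>poisson_Der A\<^esub> lift T = lift (\<lambda>a. sc c * T a)"
      by (rule smult_Der) (rule pder_in_R[OF T])
    then show ?thesis
      unfolding ham_lift[OF that]
      by (simp only:) (rule add_Der; intro br_in_R0 that R0_mult R0_sc pder_in_R[OF T])
  qed
  have inj: "T' a = S' a" if "lift T' = lift S'" "a \<in> R" "T' a \<in> R" "S' a \<in> R" for T' S' a
  proof -
    have "fib (T' a) = fib (S' a)" using lift_fib[OF that(2)] that(1) by metis
    then show ?thesis using fib_eq_iff[OF that(3,4)] by simp
  qed
  obtain D where D: "pder_on R D" "E = lift D" using poisson_derivation_cases[OF E] by blast
  then obtain x c where x: "x \<in> R" "\<forall>a\<in>R. D a = br x a + sc c * T a" using form by blast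
  then have Ex: "E = ham A (fib x) \<oplus>\<^bsub>poisson_Der A\<^esub> (c \<odot>\<^bsub>poisson_Der A\<^esub> lift T)"
    unfolding D(2) sum[OF x(1)] by (intro lift_eqI) simp
  have uniq: "fst q = ham A (fib x) \<and> snd q = c"
    if q: "(\<exists>y\<in>carrier A. fst q = ham A y) \<and>
      E = fst q \<oplus>\<^bsub>poisson_Der A\<^esub> (snd q \<odot>\<^bsub>poisson_Der A\<^esub> lift T)" for q
  proof -
    from q obtain y where y: "y \<in> R" "fst q = ham A (fib y)" by (auto simp: carrier_A)
    have "lift (\<lambda>a. br y a + sc (snd q) * T a) = lift (\<lambda>a. br x a + sc c * T a)"
      using q Ex unfolding y(2) sum[OF x(1)] sum[OF y(1)] by simp
    then have eq: "br y a + sc (snd q) * T a = br x a + sc c * T a" if "a \<in> R" for a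
      by (rule inj) (intro that R0_add br_in_R0 x y R0_mult R0_sc pder_in_R[OF T])+
    have c: "snd q = c"
      by (rule weight_not_inner[where T = T, OF T6 eq[OF R0_generators(2)]])
    have "lift (br y) = lift (br x)"
    proof (rule lift_eqI)
      show "br y a = br x a" if "a \<in> R" for a using eq[OF that] unfolding c by simp
    qed
    then show ?thesis using c unfolding y(2) ham_lift[OF y(1)] ham_lift[OF x(1)] by simp
  qed
  show ?thesis
  proof (rule ex1I[of _ "(ham A (fib x), c)"], goal_cases)
    case 1
    show ?case unfolding prod.case using Ex fib_in[OF x(1)] by blast
  next
    case (2 q)
    then show ?case using uniq[of q] by (cases q) (simp only: prod.case fst_conv snd_conv)
  qed
qed

lemma HP1_line:
  assumes T: "pder_on R T"
    and form: "\<And>D. pder_on R D \<Longrightarrow> \<exists>x\<in>R. \<exists>c. \<forall>a\<in>R. D a = br x a + sc c * T a"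
  shows "carrier (HP1 A) = {c \<odot>\<^bsub>HP1 A\<^esub> HP1_class A (lift T) | c. True}"
proof -
  have s: "c \<odot>\<^bsub>HP1 A\<^esub> HP1_class A (lift T) = cls (\<lambda>a. sc c * T a)" for c
    unfolding HP1_class_def cls_def[symmetric] by (rule smult_cls) (rule pder_in_R[OF T])
  have "\<exists>c. cls D = cls (\<lambda>a. sc c * T a)" if D: "pder_on R D" for D
  proof -
    obtain x c where "x \<in> R" "\<forall>a\<in>R. D a = br x a + sc c * T a" using form[OF D] by blast
    then have "cls D = cls (\<lambda>a. sc c * T a)"
      by (intro cls_eqI[of _ x]) (auto intro: R0_mult R0_sc pder_in_R[OF T])
    then show ?thesis by blast
  qed
  then show ?thesis unfolding carrier_HP1 s using pder_on_smult[OF T] by blast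
qed

end

lemma all_var: "(\<forall>i. P i) \<longleftrightarrow> P V1 \<and> P V2 \<and> P V3 \<and> P V4 \<and> P V5 \<and> P V6"
  by (metis var.exhaust)

lemma vartheta_lift:
  assumes "\<alpha> \<noteq> 0"
  shows "vartheta \<alpha> = relations.lift \<alpha> 0 Theta1"
proof -
  interpret relations \<alpha> 0 by standard (use assms in simp)
  show ?thesis
    unfolding vartheta_def
    by (rule the_lift[OF Theta1_weight(1)])
      (simp add: Theta1_weight(2) all_var gen_fib smult_A R0_generators zero_A sc_simps
        del: xt.simps)
qed

lemma vartheta_tilde_lift:
  assumes "\<beta> \<noteq> 0"
  shows "vartheta_tilde \<beta> = relations.lift 0 \<beta> Theta2"
proof -
  interpret relations 0 \<beta> by standard (use assms in simp)
  show ?thesis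
    unfolding vartheta_tilde_def
    by (rule the_lift[OF Theta2_weight(1)])
      (simp add: Theta2_weight(2) all_var gen_fib smult_A R0_generators zero_A sc_simps
        del: xt.simps)
qed

theorem theorem5p11:
  fixes \<alpha> \<beta> :: "'k::field_char_0"
  assumes "(\<alpha>, \<beta>) \<noteq> (0, 0)"
  shows
    "(\<alpha> \<noteq> 0 \<and> \<beta> \<noteq> 0 \<longrightarrow>
        (\<forall>D. poisson_derivation (A_alg \<alpha> \<beta>) D \<longrightarrow>
          (\<exists>!h. (\<exists>x\<in>carrier (A_alg \<alpha> \<beta>). h = ham (A_alg \<alpha> \<beta>) x) \<and> D = h)))
   \<and> (\<alpha> \<noteq> 0 \<and> \<beta> = 0 \<longrightarrow>
        (\<forall>D. poisson_derivation (A_alg \<alpha> 0) D \<longrightarrow>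
          (\<exists>!(h, c). (\<exists>x\<in>carrier (A_alg \<alpha> 0). h = ham (A_alg \<alpha> 0) x) \<and>
             D = h \<oplus>\<^bsub>poisson_Der (A_alg \<alpha> 0)\<^esub>
                   (c \<odot>\<^bsub>poisson_Der (A_alg \<alpha> 0)\<^esub> vartheta \<alpha>))))
   \<and> (\<alpha> = 0 \<and> \<beta> \<noteq> 0 \<longrightarrow>
        (\<forall>D. poisson_derivation (A_alg 0 \<beta>) D \<longrightarrow>
          (\<exists>!(h, c). (\<exists>x\<in>carrier (A_alg 0 \<beta>). h = ham (A_alg 0 \<beta>) x) \<and>
             D = h \<oplus>\<^bsub>poisson_Der (A_alg 0 \<beta>)\<^esub>
                   (c \<odot>\<^bsub>poisson_Der (A_alg 0 \<beta>)\<^esub> vartheta_tilde \<beta>))))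
   \<and> (\<alpha> \<noteq> 0 \<longrightarrow>
        carrier (HP1 (A_alg \<alpha> 0)) =
          {c \<odot>\<^bsub>HP1 (A_alg \<alpha> 0)\<^esub> HP1_class (A_alg \<alpha> 0) (vartheta \<alpha>) | c. True})
   \<and> (\<beta> \<noteq> 0 \<longrightarrow>
        carrier (HP1 (A_alg 0 \<beta>)) =
          {c \<odot>\<^bsub>HP1 (A_alg 0 \<beta>)\<^esub> HP1_class (A_alg 0 \<beta>) (vartheta_tilde \<beta>) | c. True})
   \<and> (\<alpha> \<noteq> 0 \<and> \<beta> \<noteq> 0 \<longrightarrow>
        carrier (HP1 (A_alg \<alpha> \<beta>)) =
          {HP1_class (A_alg \<alpha> \<beta>) \<zero>\<^bsub>poisson_Der (A_alg \<alpha> \<beta>)\<^esub>})"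
proof -
  \<comment> \<open>T6 has nonzero weight, 2 or 3, in both cases; this separates the scalar from the
    inner part.\<close>
  have T6: "Theta1 (tm T6) = sc 2 * (tm T6 :: 'k laurent)"
    "Theta2 (tm T6) = sc 3 * (tm T6 :: 'k laurent)"
    by (simp_all add: Theta1_def Theta2_def theta_tm sc_simps)
  have 1: "\<exists>!h. (\<exists>x\<in>carrier (A_alg \<alpha> \<beta>). h = ham (A_alg \<alpha> \<beta>) x) \<and> D = h"
    if "\<alpha> \<noteq> 0" "\<beta> \<noteq> 0" "poisson_derivation (A_alg \<alpha> \<beta>) D" for D
  proof -
    interpret relations \<alpha> \<beta> by standard (use that in simp)
    show ?thesis by (rule unique_inner[OF pder_inner[OF that(1,2)] that(3)])
  qed
  have 2: "\<exists>!(h, c). (\<exists>x\<in>carrier (A_alg \<alpha> 0). h = ham (A_alg \<alpha> 0) x) \<and>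
      D = h \<oplus>\<^bsub>poisson_Der (A_alg \<alpha> 0)\<^esub> (c \<odot>\<^bsub>poisson_Der (A_alg \<alpha> 0)\<^esub> vartheta \<alpha>)"
    if "\<alpha> \<noteq> 0" "poisson_derivation (A_alg \<alpha> 0) D" for D
  proof -
    interpret relations \<alpha> 0 by standard (use that in simp)
    show ?thesis
      unfolding vartheta_lift[OF that(1)]
      by (rule unique_inner_plus[OF Theta1_weight(1) T6(1) _ pder_inner_Theta1[OF that(1)] that(2)])
        simp_all
  qed
  have 3: "\<exists>!(h, c). (\<exists>x\<in>carrier (A_alg 0 \<beta>). h = ham (A_alg 0 \<beta>) x) \<and>
      D = h \<oplus>\<^bsub>poisson_Der (A_alg 0 \<beta>)\<^esub> (c \<odot>\<^bsub>poisson_Der (A_alg 0 \<beta>)\<^esub> vartheta_tilde \<beta>)"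
    if "\<beta> \<noteq> 0" "poisson_derivation (A_alg 0 \<beta>) D" for D
  proof -
    interpret relations 0 \<beta> by standard (use that in simp)
    show ?thesis
      unfolding vartheta_tilde_lift[OF that(1)]
      by (rule unique_inner_plus[OF Theta2_weight(1) T6(2) _ pder_inner_Theta2[OF that(1)] that(2)])
        simp_all
  qed
  have 4: "carrier (HP1 (A_alg \<alpha> 0)) =
      {c \<odot>\<^bsub>HP1 (A_alg \<alpha> 0)\<^esub> HP1_class (A_alg \<alpha> 0) (vartheta \<alpha>) | c. True}" if "\<alpha> \<noteq> 0"
  proof -
    interpret relations \<alpha> 0 by standard (use that in simp)
    show ?thesis
      unfolding vartheta_lift[OF that] by (rule HP1_line[OF Theta1_weight(1) pder_inner_Theta1[OF that]])
  qed
  have 5: "carrier (HP1 (A_alg 0 \<beta>)) =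
      {c \<odot>\<^bsub>HP1 (A_alg 0 \<beta>)\<^esub> HP1_class (A_alg 0 \<beta>) (vartheta_tilde \<beta>) | c. True}"
    if "\<beta> \<noteq> 0"
  proof -
    interpret relations 0 \<beta> by standard (use that in simp)
    show ?thesis
      unfolding vartheta_tilde_lift[OF that]
      by (rule HP1_line[OF Theta2_weight(1) pder_inner_Theta2[OF that]])
  qed
  have 6: "carrier (HP1 (A_alg \<alpha> \<beta>)) =
      {HP1_class (A_alg \<alpha> \<beta>) \<zero>\<^bsub>poisson_Der (A_alg \<alpha> \<beta>)\<^esub>}" if "\<alpha> \<noteq> 0" "\<beta> \<noteq> 0"
  proof -
    interpret relations \<alpha> \<beta> by standard (use that in simp)
    show ?thesis by (rule HP1_zero[OF pder_inner[OF that]])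
  qed
  show ?thesis
    by (intro conjI impI allI; (elim conjE)?; (rule 1 | rule 2 | rule 3 | rule 4 | rule 5 | rule 6);
      assumption)
qed

end
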